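(* Let $\alpha\ge0$ and fix $v>0$. There exists a solution $E^*\in\mathcal{A}^y(v)\cap\mathcal{S}_x^*\cap\mathcal{S}_y$, bounded and $y$-transformed-convex, to the minimal partition problem $$\inf\{\mathcal{P}_\alpha^y(E) : E\in\mathcal{A}^y(v)\}.$$ Moreover, there exist $r\in\,]0,+\infty[$ and $g\in C([0,r])\cap\mathrm{Lip}_{loc}(]0,r[)$ such that $$E^*=\{(x,y)\in\mathbb{R}^2 : |x|\le g(|y|),\ |y|\le r\}.$$
   Context: For $\alpha\ge0$ and an $\mathcal{L}^2$-measurable set $E\subset\mathbb{R}^2$, the Grushin $\alpha$-perimeter is $$P_\alpha(E)=\sup\left\{\int_E(\partial_x\phi_1+|x|^\alpha\partial_y\phi_2)\,dx\,dy : \phi_1,\phi_2\in C^1_c(\mathbb{R}^2),\ \sup_{\mathbb{R}^2}\sqrt{\phi_1^2+\phi_2^2}\le1\right\}.$$ Set $E^{+y}=E\cap\{y>0\}$, $E^{-y}=E\cap\{y<0\}$. For $v>0$, $\mathcal{A}^y(v)$ is the class of $\mathcal{L}^2$-measurable $E\subset\mathbb{R}^2$ with $\mathcal{L}^2(E^{+y})=\mathcal{L}^2(E^{-y})=v$, and $\mathcal{P}_\alpha^y(E)=\frac12(P_\alpha(E^{+y})+P_\alpha(E^{-y})+P_\alpha(E))$. Sets are considered up to $\mathcal{L}^2$-negligible sets. $\mathcal{S}_y$ is the class of $\mathcal{L}^2$-measurable $y$-symmetric sets ($(x,y)\in E$ implies $(x,-y)\in E$). $\mathcal{S}_x^*$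 is the class of $\mathcal{L}^2$-measurable $x$-Schwarz symmetric sets, i.e. $x$-symmetric ($(x,y)\in E$ implies $(-x,y)\in E$) and $x$-convex (for each $t$ the section $\{x:(x,t)\in E\}$ is a, possibly empty, open interval). A set $E\in\mathcal{S}_y$ is $y$-transformed-convex if $\Psi(E^{+y})$ is convex, where $\Psi(x,y)=\left(\operatorname{sgn}(x)\frac{|x|^{\alpha+1}}{\alpha+1},\,y\right)$. *)

theory Defs
  imports "HOL-Analysis.Analysis"
begin

definition C1c :: "(real \<times> real \<Rightarrow> real) set" where
  "C1c = {\<phi>. (\<forall>p. \<phi> differentiable (at p))
            \<and> (\<forall>h. continuous_on UNIV (\<lambda>p. frechet_derivative \<phi> (at p) h))
            \<and> compact (closure {p. \<phi> p \<noteq> 0})}"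

definition partial_x :: "(real \<times> real \<Rightarrow> real) \<Rightarrow> real \<times> real \<Rightarrow> real" where
  "partial_x \<phi> p = frechet_derivative \<phi> (at p) (1, 0)"

definition partial_y :: "(real \<times> real \<Rightarrow> real) \<Rightarrow> real \<times> real \<Rightarrow> real" where
  "partial_y \<phi> p = frechet_derivative \<phi> (at p) (0, 1)"

text \<open>The case distinction is needed only at \<open>x = 0\<close>: the weight is to be constantly 1
  for exponent 0, whereas \<open>0 powr 0 = 0\<close>.\<close>

definition grushin_weight :: "real \<Rightarrow> real \<Rightarrow> real" where
  "grushin_weight \<alpha> x = (if \<alpha> = 0 then 1 else \<bar>x\<bar> powr \<alpha>)"

definition grushin_perimeter :: "real \<Rightarrow> (real \<times> real) set \<Rightarrow> ereal" where
  "grushin_perimeter \<alpha> E =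
     Sup {ereal (LINT p:E|lebesgue. partial_x \<phi>1 p + grushin_weight \<alpha> (fst p) * partial_y \<phi>2 p)
          | \<phi>1 \<phi>2. \<phi>1 \<in> C1c \<and> \<phi>2 \<in> C1c \<and> (\<forall>p. sqrt ((\<phi>1 p)\<^sup>2 + (\<phi>2 p)\<^sup>2) \<le> 1)}"

definition upper_part :: "(real \<times> real) set \<Rightarrow> (real \<times> real) set" where
  "upper_part E = E \<inter> {(x, y). y > 0}"

definition lower_part :: "(real \<times> real) set \<Rightarrow> (real \<times> real) set" where
  "lower_part E = E \<inter> {(x, y). y < 0}"

definition admissible_y :: "real \<Rightarrow> (real \<times> real) set set" where
  "admissible_y v = {E. E \<in> sets lebesgue
      \<and> emeasure lebesgue (upper_part E) = ennreal v
      \<and> emeasure lebesgue (lower_part E) = ennreal v}"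

definition partition_perimeter :: "real \<Rightarrow> (real \<times> real) set \<Rightarrow> ereal" where
  "partition_perimeter \<alpha> E = ereal (1 / 2) *
     (grushin_perimeter \<alpha> (upper_part E) + grushin_perimeter \<alpha> (lower_part E)
       + grushin_perimeter \<alpha> E)"

definition y_symmetric :: "(real \<times> real) set set" where
  "y_symmetric = {E. E \<in> sets lebesgue \<and> (\<forall>x y. (x, y) \<in> E \<longrightarrow> (x, - y) \<in> E)}"

definition x_schwarz_symmetric :: "(real \<times> real) set set" where
  "x_schwarz_symmetric = {E. E \<in> sets lebesgue
      \<and> (\<forall>x y. (x, y) \<in> E \<longrightarrow> (- x, y) \<in> E)
      \<and> (\<forall>t. open {x. (x, t) \<in> E} \<and> is_interval {x. (x, t) \<in> E})}"

definition grushin_transform :: "real \<Rightarrow> real \<times> real \<Rightarrow> real \<times> real" where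
  "grushin_transform \<alpha> = (\<lambda>(x, y). (sgn x * (\<bar>x\<bar> powr (\<alpha> + 1) / (\<alpha> + 1)), y))"

definition y_transformed_convex :: "real \<Rightarrow> (real \<times> real) set \<Rightarrow> bool" where
  "y_transformed_convex \<alpha> E \<longleftrightarrow> convex (grushin_transform \<alpha> ` upper_part E)"

definition lip_loc :: "real set \<Rightarrow> (real \<Rightarrow> real) set" where
  "lip_loc U = {g. \<forall>K. compact K \<and> K \<subseteq> U \<longrightarrow> (\<exists>L. L-lipschitz_on K g)}"

text \<open>Sets are identified when they differ by a Lebesgue-null set. This is unavoidable when a set
  whose horizontal sections are open intervals is described by non-strict inequalities.\<close>

definition ae_equal :: "(real \<times> real) set \<Rightarrow> (real \<times> real) set \<Rightarrow> bool" where
  "ae_equal E F \<longleftrightarrow> sym_diff E F \<in> null_sets lebesgue"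

end

(* Let W x = |x|^alpha.  The candidate is explicit: its upper half is bounded by
   t |-> (l sin t, Y t), 0 <= t <= 2 pi / 3, where t is the angle of the (Grushin) normal
   (sin t, cos t) and dY = - l W(l) sin t W(sin t) dt; the end angle 2 pi / 3 is Young's law, since
   the interface on the x-axis costs one half on either side.

   Lower bound, a calibration depending on the competitor, in the spirit of Gromov's proof of the
   isoperimetric inequality: if F lies in the upper half plane and m y is the length of its section
   at height y, let t(y) be the angle at which the extremal set has below it the same area as F has
   below y.  The field (s(x,y) sin t(y), cos t(y)), s running from -1 to 1 across each section, has
   divergence at least 2 sin t + (d/dy cos t) 2 U(m/2) per section, U' = W, and Bernoulli's
   inequality bounds this below by (alpha+2)/(alpha+1) m / l, with equality for the extremal set.
   No symmetrisation or compactness is needed.  Polynomial approximation of the indicator of F makes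
   the field C^1.  The upper bound is the divergence theorem on the explicit set. *)

theory Submission
  imports Defs "HOL-Computational_Algebra.Polynomial"
begin

section \<open>The Grushin weight\<close>

text \<open>With \<open>S\<close> and \<open>N\<close> the components of the extremal normal at the
  enclosed area, \<open>N\<close> grows with the height at rate \<open>curvature l S * m\<close>.
  The divergence over a section is then at least
  \<open>2 * S + 2 * U (m / 2) * m * curvature l S\<close>, and with
  \<open>z = m / (2 * l * S)\<close> this is
  \<open>2 * S * (1 + z^2 * W z / (\<alpha> + 1))\<close>. Matching by enclosed area, not by height,
  makes the resulting bound linear in \<open>m\<close>, so it integrates to
  \<open>rate l * v\<close> whatever the shape of the competitor. The obstacle is regularity: test
  fields are C^1 with compact support, sections are merely measurable. Section lengths and enclosed
  areas are therefore those of a polynomial density, whose mass may exceed \<open>v\<close>, while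
  the curvature blows up as the enclosed area tends to \<open>area l\<close>. Hence the bound is
  first proved for \<open>v < area l\<close>, up to \<open>eps\<close>, and then the scale decreases
  to its limit. Only a bounded core away from the axis is estimated sharply; elsewhere the
  divergence must not be much below 0. Near the axis this is exactly the condition that the vertical
  normal component is at least Young's value -1/2.\<close>

locale grushin =
  fixes \<alpha> :: real
  assumes alpha_nonneg: "0 \<le> \<alpha>"
begin

abbreviation W :: "real \<Rightarrow> real" where "W \<equiv> grushin_weight \<alpha>"

text \<open>The antiderivative of \<open>W\<close> vanishing at 0, and the first coordinate of
  \<open>grushin_transform\<close>. Written through \<open>W\<close> it needs no case distinction on
  \<alpha> and inherits the multiplicativity \<open>W_mult\<close>.\<close>

definition U :: "real \<Rightarrow> real" where "U x = x * W x / (\<alpha> + 1)"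

text \<open>The guaranteed divergence per unit area in the calibration. The lower and the upper
  bound meet at \<open>2 * (rate l * area l)\<close>, so this is half of the minimal value divided
  by the area of one half.\<close>

abbreviation rate :: "real \<Rightarrow> real" where
  "rate l \<equiv> (\<alpha> + 2) / ((\<alpha> + 1) * l)"

text \<open>The derivative of the vertical normal component with respect to the enclosed area, at a point of
  the extremal curve with horizontal normal component \<open>s\<close>.\<close>

abbreviation curvature :: "real \<Rightarrow> real \<Rightarrow> real" where
  "curvature l s \<equiv> 1 / (2 * l\<^sup>2 * W l * (s * W s))"

lemma W_mult: "W (a * b) = W a * W b"
  by (simp add: grushin_weight_def abs_mult powr_mult)

lemma W_1 [simp]: "W 1 = 1"
  by (simp add: grushin_weight_def)

lemma W_minus [simp]: "W (- x) = W x"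
  by (simp add: grushin_weight_def)

lemma W_nonneg [simp]: "0 \<le> W x"
  by (simp add: grushin_weight_def)

lemma W_pos: "x \<noteq> 0 \<Longrightarrow> 0 < W x"
  by (simp add: grushin_weight_def)

lemma W_powr: "x \<noteq> 0 \<Longrightarrow> W x = \<bar>x\<bar> powr \<alpha>"
  by (simp add: grushin_weight_def)

lemma W_mono: "\<bar>x\<bar> \<le> \<bar>y\<bar> \<Longrightarrow> W x \<le> W y"
  using alpha_nonneg by (auto simp: grushin_weight_def intro: powr_mono2)

lemma continuous_on_W: "continuous_on A W"
proof (cases "\<alpha> = 0")
  case True
  then have "W = (\<lambda>x. 1)" by (auto simp: grushin_weight_def)
  then show ?thesis by simp
next
  case False
  then have "W = (\<lambda>x. \<bar>x\<bar> powr \<alpha>)" by (auto simp: grushin_weight_def)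
  then show ?thesis using False alpha_nonneg
    by (auto intro!: continuous_on_powr' continuous_on_rabs continuous_on_id continuous_on_const)
qed

lemma continuous_on_W' [continuous_intros]:
  "continuous_on A f \<Longrightarrow> continuous_on A (\<lambda>x. W (f x))"
  using continuous_on_compose2[OF continuous_on_W[of UNIV]] by blast

lemma U_minus: "U (- x) = - U x"
  by (simp add: U_def)

lemma U_nonneg: "0 \<le> x \<Longrightarrow> 0 \<le> U x"
  using alpha_nonneg by (simp add: U_def)

lemma U_0 [simp]: "U 0 = 0"
  by (simp add: U_def)

lemma DERIV_U: "(U has_real_derivative W x) (at x)"
proof -
  have pos: "(U has_real_derivative W x) (at x)" if "x > 0" for x
  proof -
    have "((\<lambda>x. x powr (\<alpha> + 1) / (\<alpha> + 1)) has_real_derivative W x) (at x)"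
      using that alpha_nonneg by (auto intro!: derivative_eq_intros simp: W_powr)
    then show ?thesis
      by (rule has_field_derivative_transform_within_open[where S="{0<..}"])
         (use that in \<open>auto simp: U_def W_powr powr_add\<close>)
  qed
  consider "x > 0" | "x < 0" | "x = 0" by linarith
  then show ?thesis
  proof cases
    case 1 then show ?thesis by (rule pos)
  next
    case 2
    have "((\<lambda>x. - U (- x)) has_real_derivative - (W (- x) * - 1)) (at x)"
      by (rule DERIV_minus, rule DERIV_chain'[OF _ pos])
         (use 2 in \<open>auto intro!: derivative_eq_intros\<close>)
    then show ?thesis by (simp add: U_minus)
  next
    case 3
    have c: "((\<lambda>h. W h) \<longlongrightarrow> W 0) (at 0)"
      using continuous_on_W[of UNIV] by (simp add: continuous_on_def)
    have "((\<lambda>h. W h / (\<alpha> + 1)) \<longlongrightarrow> W 0 / (\<alpha> + 1)) (at 0)"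
      using alpha_nonneg by (intro tendsto_intros c) auto
    \<comment> \<open>Either \<alpha> is 0 or \<open>W 0\<close> is 0.\<close>
    moreover have "W 0 / (\<alpha> + 1) = W 0"
      by (simp add: grushin_weight_def)
    moreover have "((\<lambda>h. (U (0 + h) - U 0) / h) \<longlongrightarrow> W 0) (at 0) \<longleftrightarrow> ((\<lambda>h. W h / (\<alpha> + 1)) \<longlongrightarrow> W 0) (at 0)"
      by (rule filterlim_cong[OF refl refl]) (auto simp: eventually_at_filter U_def)
    ultimately show ?thesis using 3
      by (simp add: DERIV_def)
  qed
qed

lemma continuous_on_U [continuous_intros]:
  "continuous_on A f \<Longrightarrow> continuous_on A (\<lambda>x. U (f x))"
  using alpha_nonneg unfolding U_def by (intro continuous_intros) auto

lemma U_strict_mono: "x < y \<Longrightarrow> 0 \<le> x \<Longrightarrow> U x < U y"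
proof -
  assume *: "x < y" "0 \<le> x"
  have "x * W x \<le> x * W y"
    using * W_mono[of x y] by (intro mult_left_mono) auto
  also have "\<dots> < y * W y"
    using * W_pos[of y] by (intro mult_strict_right_mono) auto
  finally show ?thesis
    using alpha_nonneg by (simp add: U_def divide_strict_right_mono)
qed

text \<open>The power of exponent \<open>\<alpha> + 2\<close> lies above its tangent at 1: the
  difference has derivative \<open>(\<alpha> + 2) * (z * W z - 1)\<close>, which changes sign at 1
  only. Equality at \<open>z = 1\<close> is what makes the calibration sharp.\<close>

lemma Bernoulli_W:
  assumes "0 \<le> z"
  shows "(\<alpha> + 2) * z \<le> (\<alpha> + 1) + z\<^sup>2 * W z"
proof -
  define f where "f z = (\<alpha> + 1) * (z * U z) - (\<alpha> + 2) * z" for z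
  have d: "(f has_real_derivative (\<alpha> + 2) * (z * W z - 1)) (at z)" for z
  proof -
    have "(f has_real_derivative (\<alpha> + 1) * (z * W z + 1 * U z) - (\<alpha> + 2) * 1) (at z)"
      unfolding f_def
      by (auto intro!: derivative_eq_intros DERIV_U simp: algebra_simps)
    moreover have "(\<alpha> + 1) * (z * W z + 1 * U z) - (\<alpha> + 2) * 1 = (\<alpha> + 2) * (z * W z - 1)"
      using alpha_nonneg by (simp add: U_def field_simps)
    ultimately show ?thesis by simp
  qed
  have "f 1 \<le> f z"
  proof (cases "z \<ge> 1")
    case True
    then show ?thesis
    proof (rule DERIV_nonneg_imp_nondecreasing)
      fix x :: real assume "1 \<le> x"
      then have "1 * 1 \<le> x * W x"
        using W_mono[of 1 x] by (intro mult_mono) auto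
      then have "0 \<le> (\<alpha> + 2) * (x * W x - 1)"
        using alpha_nonneg by simp
      with d show "\<exists>y. (f has_real_derivative y) (at x) \<and> 0 \<le> y"
        by blast
    qed
  next
    case False
    then have "z \<le> 1" by simp
    then show ?thesis
    proof (rule DERIV_nonpos_imp_nonincreasing)
      fix x :: real assume "z \<le> x" "x \<le> 1"
      then have "x * W x \<le> 1 * 1"
        using W_mono[of x 1] assms by (intro mult_mono) auto
      then have "(\<alpha> + 2) * (x * W x - 1) \<le> 0"
        using alpha_nonneg by (simp add: mult_nonneg_nonpos)
      with d show "\<exists>y. (f has_real_derivative y) (at x) \<and> y \<le> 0"
        by blast
    qed
  qed
  moreover have "f 1 = - \<alpha> - 1" "f z = z\<^sup>2 * W z - (\<alpha> + 2) * z"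
    using alpha_nonneg by (simp_all add: f_def U_def field_simps power2_eq_square)
  ultimately show ?thesis by simp
qed

end

lemma ex_antiderivative:
  fixes f :: "real \<Rightarrow> real"
  assumes "continuous_on UNIV f"
  obtains F where "\<And>x. (F has_real_derivative f x) (at x)"
proof -
  \<comment> \<open>The signed integral from 0: for either sign of \<open>x\<close> one of the two
    intervals is empty or a point.\<close>
  define F where "F x = integral {0..x} f - integral {x..0} f" for x
  have "(F has_real_derivative f x) (at x)" for x
  proof -
    define a where "a = min 0 x - 1"
    define b where "b = max 0 x + 1"
    have int: "f integrable_on {c..d}" for c d
      by (rule integrable_continuous_real) (rule continuous_on_subset[OF assms], simp)
    have F: "F y = integral {a..y} f - integral {a..0} f" if "y \<in> {a..b}" for y
    proof (cases "y \<ge> 0")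
      case True
      have "integral {a..0} f + integral {0..y} f = integral {a..y} f"
        by (rule Henstock_Kurzweil_Integration.integral_combine) (use True int a_def in auto)
      moreover have "integral {y..0} f = 0" using True by (cases "y = 0") auto
      ultimately show ?thesis by (simp add: F_def)
    next
      case False
      have "integral {a..y} f + integral {y..0} f = integral {a..0} f"
        by (rule Henstock_Kurzweil_Integration.integral_combine) (use False int that in auto)
      moreover have "integral {0..y} f = 0" using False by auto
      ultimately show ?thesis by (simp add: F_def)
    qed
    have x: "x \<in> {a<..<b}" "{a<..<b} \<subseteq> {a..b}" by (auto simp: a_def b_def)
    have "((\<lambda>u. integral {a..u} f) has_vector_derivative f x) (at x within {a..b})"
      by (rule integral_has_vector_derivative[OF continuous_on_subset[OF assms]]) (use x in auto)
    then have "((\<lambda>u. integral {a..u} f) has_real_derivative f x) (at x)"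
      using x(1) by (simp add: has_real_derivative_iff_has_vector_derivative at_within_Icc_at)
    then have "((\<lambda>u. integral {a..u} f - integral {a..0} f) has_real_derivative f x) (at x)"
      by (auto intro!: derivative_eq_intros)
    then show ?thesis
      by (rule has_field_derivative_transform_within_open[where S="{a<..<b}"])
         (use x F in auto)
  qed
  then show ?thesis using that by blast
qed

section \<open>Continuously differentiable test functions and cut-offs\<close>

text \<open>The partial derivatives are carried as arguments, so that those of a composite field are
  produced by the rules below and \<open>frechet_derivative\<close> is evaluated only once, in
  \<open>C1d_partial\<close>.\<close>

definition C1d :: "(real \<times> real \<Rightarrow> real) \<Rightarrow> (real \<times> real \<Rightarrow> real) \<Rightarrow> (real \<times> real \<Rightarrow> real) \<Rightarrow> bool" where
  "C1d f fx fy \<longleftrightarrow> continuous_on UNIV fx \<and> continuous_on UNIV fy \<and>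
     (\<forall>z. (f has_derivative (\<lambda>h. fx z * fst h + fy z * snd h)) (at z))"

lemma C1dD:
  assumes "C1d f fx fy"
  shows "(f has_derivative (\<lambda>h. fx z * fst h + fy z * snd h)) (at z)"
    "continuous_on UNIV fx" "continuous_on UNIV fy"
  using assms unfolding C1d_def by blast+

lemma C1d_const: "C1d (\<lambda>_. c) (\<lambda>_. 0) (\<lambda>_. 0)"
  by (simp add: C1d_def)

lemma C1d_continuous: "C1d f fx fy \<Longrightarrow> continuous_on A f"
  unfolding C1d_def by (meson continuous_at_imp_continuous_on has_derivative_continuous)

lemma C1d_add:
  assumes "C1d f fx fy" "C1d g gx gy"
  shows "C1d (\<lambda>z. f z + g z) (\<lambda>z. fx z + gx z) (\<lambda>z. fy z + gy z)"
  using assms unfolding C1d_def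
  by (auto intro!: continuous_intros derivative_eq_intros simp: algebra_simps)

lemma C1d_diff:
  assumes "C1d f fx fy" "C1d g gx gy"
  shows "C1d (\<lambda>z. f z - g z) (\<lambda>z. fx z - gx z) (\<lambda>z. fy z - gy z)"
  using assms unfolding C1d_def
  by (auto intro!: continuous_intros derivative_eq_intros simp: algebra_simps)

lemma C1d_mult:
  assumes "C1d f fx fy" "C1d g gx gy"
  shows "C1d (\<lambda>z. f z * g z) (\<lambda>z. fx z * g z + f z * gx z) (\<lambda>z. fy z * g z + f z * gy z)"
  using assms C1d_continuous[OF assms(1), of UNIV] C1d_continuous[OF assms(2), of UNIV]
  unfolding C1d_def
  by (auto intro!: continuous_intros derivative_eq_intros simp: algebra_simps)

lemma C1d_sum:
  assumes "\<And>i. i \<in> I \<Longrightarrow> C1d (f i) (fx i) (fy i)"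
  shows "C1d (\<lambda>z. \<Sum>i\<in>I. f i z) (\<lambda>z. \<Sum>i\<in>I. fx i z) (\<lambda>z. \<Sum>i\<in>I. fy i z)"
  using assms unfolding C1d_def
  by (auto intro!: continuous_intros derivative_eq_intros simp: sum_distrib_right sum.distrib)

definition C1r :: "(real \<Rightarrow> real) \<Rightarrow> (real \<Rightarrow> real) \<Rightarrow> bool" where
  "C1r f f' \<longleftrightarrow> (\<forall>x. (f has_real_derivative f' x) (at x)) \<and> continuous_on UNIV f'"

lemma C1rD: "C1r f f' \<Longrightarrow> (f has_real_derivative f' x) (at x)" "C1r f f' \<Longrightarrow> continuous_on UNIV f'"
  by (auto simp: C1r_def)

lemma C1r_continuous: "C1r f f' \<Longrightarrow> continuous_on A f"
  by (intro continuous_at_imp_continuous_on ballI DERIV_isCont) (rule C1rD)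

lemma C1d_fst:
  assumes "C1r f f'"
  shows "C1d (\<lambda>z. f (fst z)) (\<lambda>z. f' (fst z)) (\<lambda>_. 0)"
proof -
  have "((\<lambda>z. f (fst z)) has_derivative (\<lambda>h. f' (fst z) * fst h)) (at z)" for z :: "real \<times> real"
    by (rule has_derivative_compose[OF has_derivative_fst[OF has_derivative_ident] C1rD(1)[OF assms, unfolded has_field_derivative_def]])
  moreover have "continuous_on UNIV (\<lambda>z::real \<times> real. f' (fst z))"
    by (rule continuous_on_compose2[OF C1rD(2)[OF assms]]) (auto intro!: continuous_intros)
  ultimately show ?thesis by (simp add: C1d_def)
qed

lemma C1d_snd:
  assumes "C1r f f'"
  shows "C1d (\<lambda>z. f (snd z)) (\<lambda>_. 0) (\<lambda>z. f' (snd z))"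
proof -
  have "((\<lambda>z. f (snd z)) has_derivative (\<lambda>h. f' (snd z) * snd h)) (at z)" for z :: "real \<times> real"
    by (rule has_derivative_compose[OF has_derivative_snd[OF has_derivative_ident] C1rD(1)[OF assms, unfolded has_field_derivative_def]])
  moreover have "continuous_on UNIV (\<lambda>z::real \<times> real. f' (snd z))"
    by (rule continuous_on_compose2[OF C1rD(2)[OF assms]]) (auto intro!: continuous_intros)
  ultimately show ?thesis by (simp add: C1d_def)
qed

definition reflect :: "real \<times> real \<Rightarrow> real \<times> real" where
  "reflect p = (fst p, - snd p)"

lemma reflect_simps [simp]: "fst (reflect p) = fst p" "snd (reflect p) = - snd p" "reflect (x, y) = (x, - y)"
  "reflect (reflect p) = p"
  by (simp_all add: reflect_def)

lemma continuous_on_reflect: "continuous_on A reflect"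
  unfolding reflect_def by (intro continuous_intros)

lemma C1d_reflect:
  assumes "C1d f fx fy"
  shows "C1d (\<lambda>z. f (reflect z)) (\<lambda>z. fx (reflect z)) (\<lambda>z. - fy (reflect z))"
proof -
  have r: "(reflect has_derivative reflect) (at z)" for z
    unfolding reflect_def by (auto intro!: derivative_eq_intros)
  have "((\<lambda>z. f (reflect z)) has_derivative (\<lambda>h. fx (reflect z) * fst h - fy (reflect z) * snd h)) (at z)" for z
    using has_derivative_compose[OF r C1dD(1)[OF assms], of z] by simp
  moreover have "continuous_on UNIV (\<lambda>z. fx (reflect z))" "continuous_on UNIV (\<lambda>z. fy (reflect z))"
    using assms by (auto simp: C1d_def intro!: continuous_on_compose2[OF _ continuous_on_reflect])
  ultimately show ?thesis by (auto simp: C1d_def intro!: continuous_intros)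
qed

lemma C1d_partial:
  assumes "C1d f fx fy"
  shows "partial_x f p = fx p" "partial_y f p = fy p"
proof -
  have "frechet_derivative f (at p) = (\<lambda>h. fx p * fst h + fy p * snd h)"
    by (rule frechet_derivative_at[symmetric, OF C1dD(1)[OF assms]])
  then show "partial_x f p = fx p" "partial_y f p = fy p"
    by (simp_all add: partial_x_def partial_y_def)
qed

lemma C1d_imp_C1c:
  assumes f: "C1d f fx fy" and B: "\<And>p. f p \<noteq> 0 \<Longrightarrow> \<bar>fst p\<bar> \<le> B \<and> \<bar>snd p\<bar> \<le> B"
  shows "f \<in> C1c"
proof -
  have "bounded {p. f p \<noteq> 0}"
  proof (rule bounded_subset[OF bounded_cbox])
    show "{p. f p \<noteq> 0} \<subseteq> cbox (-B, -B) (B, B)"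
      using B by (fastforce simp: cbox_Pair_eq abs_le_iff)
  qed
  then have "compact (closure {p. f p \<noteq> 0})" by simp
  moreover have eq: "frechet_derivative f (at p) h = fx p * fst h + fy p * snd h" for p h
    by (rule fun_cong[OF frechet_derivative_at[symmetric, OF C1dD(1)[OF f]]])
  moreover have "continuous_on UNIV (\<lambda>p. frechet_derivative f (at p) h)" for h :: "real \<times> real"
    unfolding eq by (intro continuous_intros C1dD(2,3)[OF f])
  ultimately show ?thesis
    unfolding C1c_def using differentiableI[OF C1dD(1)[OF f]] by blast
qed

lemma C1c_imp_C1d:
  assumes "f \<in> C1c"
  shows "C1d f (partial_x f) (partial_y f)"
proof -
  have d: "(f has_derivative frechet_derivative f (at z)) (at z)" for z
    using assms unfolding C1c_def frechet_derivative_works by blast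
  have "frechet_derivative f (at z) h = partial_x f z * fst h + partial_y f z * snd h" for z h
  proof -
    interpret linear "frechet_derivative f (at z)"
      using d has_derivative_linear by blast
    have "h = fst h *\<^sub>R (1, 0) + snd h *\<^sub>R (0, 1)" by (simp add: prod_eq_iff)
    then have "frechet_derivative f (at z) h = frechet_derivative f (at z) (fst h *\<^sub>R (1, 0) + snd h *\<^sub>R (0, 1))" by simp
    then show ?thesis by (simp only: add scale) (simp add: partial_x_def partial_y_def)
  qed
  then have "frechet_derivative f (at z) = (\<lambda>h. partial_x f z * fst h + partial_y f z * snd h)" for z
    by blast
  with d have "(f has_derivative (\<lambda>h. partial_x f z * fst h + partial_y f z * snd h)) (at z)" for z
    by metis
  moreover have "continuous_on UNIV (\<lambda>p. frechet_derivative f (at p) h)" for h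
    using assms unfolding C1c_def by blast
  ultimately show ?thesis
    unfolding C1d_def partial_x_def[abs_def] partial_y_def[abs_def] by blast
qed

lemma C1d_vanish_open:
  assumes "C1d f fx fy" "open S" "p \<in> S" "\<And>q. q \<in> S \<Longrightarrow> f q = 0"
  shows "fx p = 0" "fy p = 0"
proof -
  have "(f has_derivative (\<lambda>h. 0)) (at p)"
    by (rule has_derivative_transform_within_open[of "\<lambda>_. 0" _ _ _ S]) (use assms in auto)
  then have "(\<lambda>h. fx p * fst h + fy p * snd h) = (\<lambda>h. 0)"
    by (rule has_derivative_unique[OF C1dD(1)[OF assms(1)]])
  from fun_cong[OF this, of "(1, 0)"] fun_cong[OF this, of "(0, 1)"]
  show "fx p = 0" "fy p = 0" by auto
qed

lemma C1c_support:
  assumes "f \<in> C1c"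
  obtains B where "B > 0"
    "\<And>p. p \<notin> cbox (-B, -B) (B, B) \<Longrightarrow> f p = 0 \<and> partial_x f p = 0 \<and> partial_y f p = 0"
proof -
  have "bounded (closure {p. f p \<noteq> 0})"
    using assms by (auto simp: C1c_def intro: compact_imp_bounded)
  then have "bounded {p. f p \<noteq> 0}"
    by (rule bounded_subset) (rule closure_subset)
  then obtain B where B: "B > 0" "\<And>p. f p \<noteq> 0 \<Longrightarrow> norm p \<le> B"
    by (auto simp: bounded_pos)
  show ?thesis
  proof (rule that[OF B(1)])
    fix p :: "real \<times> real" assume p: "p \<notin> cbox (-B, -B) (B, B)"
    have 0: "f q = 0" if "q \<in> - cbox (-B, -B) (B, B)" for q
    proof (rule ccontr)
      assume "f q \<noteq> 0"
      with B have "norm q \<le> B" by auto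
      moreover have "\<bar>fst q\<bar> \<le> norm q" "\<bar>snd q\<bar> \<le> norm q"
        using norm_fst_le[of "fst q" "snd q"] norm_snd_le[of "snd q" "fst q"] by auto
      ultimately show False using that by (cases q) (auto simp: cbox_Pair_eq)
    qed
    have "open (- cbox (-B, -B) (B, B :: real))" by (rule open_Compl, rule closed_cbox)
    from C1d_vanish_open[OF C1c_imp_C1d[OF assms] this _ 0] 0 p
    show "f p = 0 \<and> partial_x f p = 0 \<and> partial_y f p = 0" by auto
  qed
qed

lemma C1d_DERIV_x:
  assumes "C1d f fx fy"
  shows "((\<lambda>x. f (x, y)) has_real_derivative fx (x, y)) (at x)"
proof -
  have "((\<lambda>x. (x, y)) has_derivative (\<lambda>h. (h, 0))) (at x)"
    by (auto intro!: derivative_eq_intros)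
  from has_derivative_compose[OF this C1dD(1)[OF assms]] show ?thesis
    by (simp add: has_field_derivative_def)
qed

lemma C1d_DERIV_y:
  assumes "C1d f fx fy"
  shows "((\<lambda>y. f (x, y)) has_real_derivative fy (x, y)) (at y)"
proof -
  have "((\<lambda>y. (x, y)) has_derivative (\<lambda>h. (0, h))) (at y)"
    by (auto intro!: derivative_eq_intros)
  from has_derivative_compose[OF this C1dD(1)[OF assms]] show ?thesis
    by (simp add: has_field_derivative_def)
qed

section \<open>Cut-offs as quadratic splines\<close>

definition pos2 :: "real \<Rightarrow> real" where "pos2 t = (max 0 t)\<^sup>2"

lemma DERIV_pos2: "(pos2 has_real_derivative 2 * max 0 t) (at t)"
proof -
  consider "t > 0" | "t < 0" | "t = 0" by linarith
  then show ?thesis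
  proof cases
    case 1
    have "((\<lambda>t. t\<^sup>2) has_real_derivative 2 * max 0 t) (at t)"
      using 1 by (auto intro!: derivative_eq_intros)
    then show ?thesis
      by (rule has_field_derivative_transform_within_open[where S="{0<..}"])
         (use 1 in \<open>auto simp: pos2_def\<close>)
  next
    case 2
    have "((\<lambda>t. 0) has_real_derivative 2 * max 0 t) (at t)"
      using 2 by (auto intro!: derivative_eq_intros)
    then show ?thesis
      by (rule has_field_derivative_transform_within_open[where S="{..<0}"])
         (use 2 in \<open>auto simp: pos2_def\<close>)
  next
    case 3
    have "((\<lambda>h. max 0 h) \<longlongrightarrow> max 0 0) (at (0::real))"
      by (intro tendsto_intros)
    moreover have "((\<lambda>h. (pos2 (0 + h) - pos2 0) / h) \<longlongrightarrow> 0) (at 0) \<longleftrightarrow> ((\<lambda>h. max 0 h) \<longlongrightarrow> 0) (at (0::real))"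
      by (rule filterlim_cong[OF refl refl])
         (auto simp: eventually_at_filter pos2_def max_def power2_eq_square)
    ultimately show ?thesis using 3 by (simp add: DERIV_def)
  qed
qed

lemma DERIV_pos2_shift: "((\<lambda>t. pos2 (t - c)) has_real_derivative 2 * max 0 (t - c)) (at t)"
  using DERIV_shift[of pos2 "2 * max 0 (t - c)" t "- c"] DERIV_pos2[of "t - c"] by simp

text \<open>The integral of the tent function on \<open>[0, 1]\<close> with peak 2 at 1/2, hence a
  C^1 transition from 0 to 1. The peak is the slope bound that later controls the cut-offs.\<close>

definition step :: "real \<Rightarrow> real" where
  "step t = 2 * pos2 t - 4 * pos2 (t - 1 / 2) + 2 * pos2 (t - 1)"

definition step' :: "real \<Rightarrow> real" where
  "step' t = 4 * max 0 t - 8 * max 0 (t - 1 / 2) + 4 * max 0 (t - 1)"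

lemma DERIV_step: "(step has_real_derivative step' t) (at t)"
proof -
  have "((\<lambda>t. 2 * pos2 t - 4 * pos2 (t - 1 / 2) + 2 * pos2 (t - 1)) has_real_derivative
      2 * (2 * max 0 t) - 4 * (2 * max 0 (t - 1 / 2)) + 2 * (2 * max 0 (t - 1))) (at t)"
    by (intro DERIV_add DERIV_diff DERIV_cmult DERIV_pos2 DERIV_pos2_shift)
  moreover have "2 * (2 * a) - 4 * (2 * b) + 2 * (2 * c) = 4 * a - 8 * b + 4 * c" for a b c :: real
    by simp
  ultimately show ?thesis by (simp only: step_def[abs_def] step'_def)
qed

lemma continuous_on_step': "continuous_on A step'"
  unfolding step'_def by (intro continuous_intros)

lemma step'_bounds: "0 \<le> step' t \<and> step' t \<le> 2"
proof -
  consider "t \<le> 0" | "0 \<le> t" "t \<le> 1 / 2" | "1 / 2 \<le> t" "t \<le> 1" | "1 \<le> t" by linarith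
  then show ?thesis
  proof cases
    case 1
    then have "max 0 t = 0" "max 0 (t - 1 / 2) = 0" "max 0 (t - 1) = 0" by auto
    then show ?thesis unfolding step'_def by simp
  next
    case 2
    then have "max 0 t = t" "max 0 (t - 1 / 2) = 0" "max 0 (t - 1) = 0" by auto
    then show ?thesis using 2 unfolding step'_def by simp
  next
    case 3
    then have "max 0 t = t" "max 0 (t - 1 / 2) = t - 1 / 2" "max 0 (t - 1) = 0" by auto
    then show ?thesis using 3 unfolding step'_def by simp
  next
    case 4
    then have "max 0 t = t" "max 0 (t - 1 / 2) = t - 1 / 2" "max 0 (t - 1) = t - 1" by auto
    then show ?thesis using 4 unfolding step'_def by simp
  qed
qed

lemma step_0: "t \<le> 0 \<Longrightarrow> step t = 0"
  by (simp add: step_def pos2_def)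

lemma step_1: "1 \<le> t \<Longrightarrow> step t = 1"
  by (simp add: step_def pos2_def power2_eq_square field_simps)

lemma step_mono: "x \<le> y \<Longrightarrow> step x \<le> step y"
  by (rule DERIV_nonneg_imp_nondecreasing) (use DERIV_step step'_bounds in auto)

lemma step_bounds: "0 \<le> step t" "step t \<le> 1"
  using step_mono[of "min 0 t" t] step_mono[of t "max 1 t"]
  by (auto simp: step_0 step_1)

text \<open>The integral of the trapezoid that is 1 on \<open>[-R, R]\<close> and 0 outside
  \<open>[-R - 1, R + 1]\<close>; the constant \<open>R + 1 / 2\<close> is the area of its left
  half, so that 0 is mapped to 0. It pulls the whole line into a bounded interval, which allows a
  polynomial controlled only on a box to be used in a globally bounded field.\<close>

definition clamp1 :: "real \<Rightarrow> real \<Rightarrow> real" where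
  "clamp1 R x = (pos2 (x - (- R - 1)) - pos2 (x - (- R)) - pos2 (x - R) + pos2 (x - (R + 1))) / 2 - (R + 1 / 2)"

definition clamp1' :: "real \<Rightarrow> real \<Rightarrow> real" where
  "clamp1' R x = max 0 (x - (- R - 1)) - max 0 (x - (- R)) - max 0 (x - R) + max 0 (x - (R + 1))"

lemma DERIV_clamp1: "(clamp1 R has_real_derivative clamp1' R x) (at x)"
proof -
  have "((\<lambda>x. (pos2 (x - (- R - 1)) - pos2 (x - (- R)) - pos2 (x - R) + pos2 (x - (R + 1))) / 2 - (R + 1 / 2))
      has_real_derivative
      (2 * max 0 (x - (- R - 1)) - 2 * max 0 (x - (- R)) - 2 * max 0 (x - R) + 2 * max 0 (x - (R + 1))) / 2 - 0) (at x)"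
    by (intro DERIV_add DERIV_diff DERIV_cdivide DERIV_pos2_shift DERIV_const)
  moreover have "(2 * a - 2 * b - 2 * c + 2 * d) / 2 - 0 = a - b - c + d" for a b c d :: real
    by simp
  ultimately show ?thesis by (simp only: clamp1_def[abs_def] clamp1'_def)
qed

lemma continuous_on_clamp1': "continuous_on A (clamp1' R)"
  unfolding clamp1'_def by (intro continuous_intros)

lemma clamp1'_nonneg: "0 \<le> R \<Longrightarrow> 0 \<le> clamp1' R x"
  unfolding clamp1'_def by (smt (verit))

lemma clamp1_id:
  assumes "\<bar>x\<bar> \<le> R"
  shows "clamp1 R x = x" "clamp1' R x = 1"
proof -
  have "max 0 (x - (- R - 1)) = x + R + 1" "max 0 (x - (- R)) = x + R" "max 0 (x - R) = 0" "max 0 (x - (R + 1)) = 0"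
    using assms by auto
  then show "clamp1 R x = x" "clamp1' R x = 1"
    unfolding clamp1_def clamp1'_def pos2_def by (simp_all add: power2_eq_square field_simps)
qed

lemma clamp1_mono: "0 \<le> R \<Longrightarrow> x \<le> y \<Longrightarrow> clamp1 R x \<le> clamp1 R y"
  by (rule DERIV_nonneg_imp_nondecreasing) (auto intro: DERIV_clamp1 clamp1'_nonneg)

lemma clamp1_bounds: assumes "0 \<le> R" shows "\<bar>clamp1 R x\<bar> \<le> R + 1"
proof -
  have u: "clamp1 R t \<le> R + 1" if "t \<ge> R + 1" for t
  proof -
    have "max 0 (t - (- R - 1)) = t + R + 1" "max 0 (t - (- R)) = t + R" "max 0 (t - R) = t - R" "max 0 (t - (R + 1)) = t - R - 1"
      using assms that by auto
    then show ?thesis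
      unfolding clamp1_def pos2_def by (simp add: power2_eq_square field_simps)
  qed
  have l: "- (R + 1) \<le> clamp1 R t" if "t \<le> - R - 1" for t
  proof -
    have "max 0 (t - (- R - 1)) = 0" "max 0 (t - (- R)) = 0" "max 0 (t - R) = 0" "max 0 (t - (R + 1)) = 0"
      using assms that by auto
    then show ?thesis
      unfolding clamp1_def pos2_def by simp
  qed
  show ?thesis
    using u[of "max x (R + 1)"] l[of "min x (- R - 1)"] clamp1_mono[OF assms, of x "max x (R + 1)"] clamp1_mono[OF assms, of "min x (- R - 1)" x]
    by auto
qed

section \<open>Perimeter through Borel representatives\<close>

lemma C1d_compose:
  assumes f: "C1d f fx fy"
    and u: "C1r u u'" and w: "C1r w w'"
  shows "C1d (\<lambda>z. f (u (fst z), w (snd z))) (\<lambda>z. fx (u (fst z), w (snd z)) * u' (fst z))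
           (\<lambda>z. fy (u (fst z), w (snd z)) * w' (snd z))"
proof -
  note U = C1d_fst[OF u] and W = C1d_snd[OF w]
  have d: "((\<lambda>z. (u (fst z), w (snd z))) has_derivative (\<lambda>h. (u' (fst z) * fst h, w' (snd z) * snd h))) (at z)" for z
    using has_derivative_Pair[OF C1dD(1)[OF U] C1dD(1)[OF W], of z] by simp
  have c: "continuous_on UNIV (\<lambda>z. (u (fst z), w (snd z)))"
    by (intro continuous_on_Pair C1d_continuous[OF U] C1d_continuous[OF W])
  show ?thesis
    unfolding C1d_def
  proof (intro conjI allI)
    show "continuous_on UNIV (\<lambda>z. fx (u (fst z), w (snd z)) * u' (fst z))"
      by (intro continuous_on_mult C1dD(2)[OF U] continuous_on_compose2[OF C1dD(2)[OF f] c]) simp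
    show "continuous_on UNIV (\<lambda>z. fy (u (fst z), w (snd z)) * w' (snd z))"
      by (intro continuous_on_mult C1dD(3)[OF W] continuous_on_compose2[OF C1dD(3)[OF f] c]) simp
    show "((\<lambda>z. f (u (fst z), w (snd z))) has_derivative
        (\<lambda>h. fx (u (fst z), w (snd z)) * u' (fst z) * fst h + fy (u (fst z), w (snd z)) * w' (snd z) * snd h)) (at z)" for z
      using has_derivative_compose[OF d C1dD(1)[OF f]] by (simp add: mult.assoc)
  qed
qed

lemma integrable_continuous_support:
  fixes f :: "'a::euclidean_space \<Rightarrow> real"
  assumes "continuous_on UNIV f" "\<And>p. p \<notin> cbox a b \<Longrightarrow> f p = 0"
  shows "integrable lborel f"
proof -
  have "integrable lborel (\<lambda>x. indicator (cbox a b) x *\<^sub>R f x)"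
    by (rule borel_integrable_compact) (use assms in \<open>auto intro: continuous_on_subset\<close>)
  moreover have "(\<lambda>x. indicator (cbox a b) x *\<^sub>R f x) = f"
    using assms(2) by (auto simp: fun_eq_iff indicator_def)
  ultimately show ?thesis by simp
qed

text \<open>Competitors are Lebesgue measurable, whereas Fubini's theorem and the reflection are
  applied to Borel sets and \<open>lborel\<close>. This is the passage from the one to the
  other.\<close>

lemma set_integral_lebesgue_borel:
  fixes f :: "'a::euclidean_space \<Rightarrow> real"
  assumes f: "f \<in> borel_measurable borel" and E: "E \<in> sets lebesgue" and G: "G \<in> sets borel"
    and N: "sym_diff E G \<in> null_sets lebesgue"
  shows "(LINT p:E|lebesgue. f p) = (LINT p:G|lborel. f p)"
proof -
  have m: "(\<lambda>p. indicator G p *\<^sub>R f p) \<in> borel_measurable lborel"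
    using f G by simp
  have [measurable]: "f \<in> borel_measurable lebesgue"
    using f by (intro measurable_completion) simp
  have [measurable]: "E \<in> sets lebesgue" "G \<in> sets lebesgue"
    using E G by auto
  have "(LINT p:E|lebesgue. f p) = (LINT p|lebesgue. indicator G p *\<^sub>R f p)"
    unfolding set_lebesgue_integral_def
  proof (rule integral_cong_AE)
    show "AE p in lebesgue. indicator E p *\<^sub>R f p = indicator G p *\<^sub>R f p"
      using AE_not_in[OF N] by eventually_elim (auto simp: indicator_def)
  qed measurable
  also have "\<dots> = (LINT p:G|lborel. f p)"
    unfolding set_lebesgue_integral_def by (rule integral_completion[OF m])
  finally show ?thesis .
qed

lemma lebesgue_borel_subset:
  fixes E :: "'a::euclidean_space set"
  assumes "E \<in> sets lebesgue"
  obtains G where "G \<in> sets borel" "G \<subseteq> E" "E - G \<in> null_sets lebesgue"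
proof -
  obtain S N N' where *: "E = S \<union> N" "N \<subseteq> N'" "N' \<in> null_sets lborel" "S \<in> sets lborel"
    using sets_completionE[OF assms] by metis
  have "E - S \<in> null_sets lebesgue"
    by (rule null_sets_completion_subset[OF _ null_sets_completionI[OF *(3)]]) (use * in blast)
  then show ?thesis using * that[of S] by (metis Un_upper1 sets_lborel)
qed

section \<open>Invariance of Lebesgue measure under reflection in the x-axis\<close>

lemma lborel_distr_reflect: "distr lborel borel reflect = lborel"
proof -
  \<comment> \<open>The diagonal entries 1 and -1 of the reflection; its Jacobian factor is
    1.\<close>
  define c :: "real \<times> real \<Rightarrow> real" where "c j = (if j = (1, 0) then 1 else -1)" for j
  have T: "reflect = (\<lambda>x. 0 + (\<Sum>j\<in>Basis. (c j * (x \<bullet> j)) *\<^sub>R j))"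
    by (auto simp: fun_eq_iff Basis_prod_def c_def reflect_def sum.union_disjoint)
  have "lborel = density (distr lborel borel reflect) (\<lambda>_. (\<Prod>j\<in>Basis. \<bar>c j\<bar>))"
    unfolding T by (rule lborel_affine_euclidean) (auto simp: c_def)
  moreover have "(\<Prod>j\<in>Basis. \<bar>c j\<bar>) = 1" by (rule prod.neutral) (auto simp: c_def)
  ultimately show ?thesis by (simp add: density_1)
qed

lemma measurable_reflect [measurable]: "reflect \<in> borel \<rightarrow>\<^sub>M borel"
  by (rule borel_measurable_continuous_onI) (rule continuous_on_reflect)

lemma integral_reflect:
  fixes f :: "real \<times> real \<Rightarrow> real"
  assumes [measurable]: "f \<in> borel_measurable borel"
  shows "(LINT p|lborel. f (reflect p)) = (LINT p|lborel. f p)"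
proof -
  have "(LINT p|lborel. f p) = (LINT p|distr lborel borel reflect. f p)"
    by (simp add: lborel_distr_reflect)
  also have "\<dots> = (LINT p|lborel. f (reflect p))"
    by (rule integral_distr) auto
  finally show ?thesis by simp
qed

lemma set_integral_reflect:
  fixes f :: "real \<times> real \<Rightarrow> real"
  assumes [measurable]: "f \<in> borel_measurable borel" "G \<in> sets borel"
  shows "(LINT p:reflect -` G|lborel. f p) = (LINT p:G|lborel. f (reflect p))"
proof -
  have "(LINT p:reflect -` G|lborel. f p) = (LINT p|lborel. indicator G (reflect p) *\<^sub>R f (reflect (reflect p)))"
    unfolding set_lebesgue_integral_def by (simp add: indicator_def vimage_def)
  also have "\<dots> = (LINT p|lborel. indicator G p *\<^sub>R f (reflect p))"
    by (rule integral_reflect[of "\<lambda>p. indicator G p *\<^sub>R f (reflect p)"]) measurable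
  finally show ?thesis by (simp add: set_lebesgue_integral_def)
qed

lemma emeasure_reflect:
  assumes [measurable]: "G \<in> sets borel"
  shows "emeasure lborel (reflect -` G) = emeasure lborel G"
proof -
  have "emeasure lborel G = emeasure (distr lborel borel reflect) G"
    by (simp add: lborel_distr_reflect)
  also have "\<dots> = emeasure lborel (reflect -` G)"
    by (subst emeasure_distr) auto
  finally show ?thesis by simp
qed

lemma reflect_vimage_borel [measurable]: "G \<in> sets borel \<Longrightarrow> reflect -` G \<in> sets borel"
  using measurable_sets_borel[OF measurable_reflect] by simp

context grushin
begin

definition gdiv :: "(real \<times> real \<Rightarrow> real) \<Rightarrow> (real \<times> real \<Rightarrow> real) \<Rightarrow> real \<times> real \<Rightarrow> real" where
  "gdiv f1 f2 p = partial_x f1 p + W (fst p) * partial_y f2 p"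

lemma continuous_on_gdiv: "f1 \<in> C1c \<Longrightarrow> f2 \<in> C1c \<Longrightarrow> continuous_on A (gdiv f1 f2)"
  unfolding gdiv_def
  using C1dD(2)[OF C1c_imp_C1d, of f1] C1dD(3)[OF C1c_imp_C1d, of f2]
  by (intro continuous_intros) (simp_all add: continuous_on_subset[OF _ subset_UNIV])

lemma borel_measurable_gdiv: "f1 \<in> C1c \<Longrightarrow> f2 \<in> C1c \<Longrightarrow> gdiv f1 f2 \<in> borel_measurable borel"
  by (intro borel_measurable_continuous_onI continuous_on_gdiv)

lemma integrable_gdiv:
  assumes "f1 \<in> C1c" "f2 \<in> C1c"
  shows "integrable lborel (gdiv f1 f2)"
proof -
  obtain B1 where B1: "\<And>p. p \<notin> cbox (-B1, -B1) (B1, B1) \<Longrightarrow> partial_x f1 p = 0"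
    using C1c_support[OF assms(1)] by metis
  obtain B2 where B2: "\<And>p. p \<notin> cbox (-B2, -B2) (B2, B2) \<Longrightarrow> partial_y f2 p = 0"
    using C1c_support[OF assms(2)] by metis
  define B where "B = max B1 B2"
  have sub: "cbox (-B1, -B1) (B1, B1) \<subseteq> cbox (-B, -B) (B, B)" "cbox (-B2, -B2) (B2, B2) \<subseteq> cbox (-B, -B) (B, B)"
    by (auto simp: cbox_Pair_eq B_def)
  show ?thesis
  proof (rule integrable_continuous_support[OF continuous_on_gdiv[OF assms]])
    fix p :: "real \<times> real" assume "p \<notin> cbox (-B, -B) (B, B)"
    with sub have "p \<notin> cbox (-B1, -B1) (B1, B1)" "p \<notin> cbox (-B2, -B2) (B2, B2)" by blast+
    then show "gdiv f1 f2 p = 0" by (simp add: gdiv_def B1 B2)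
  qed
qed

lemma set_integrable_gdiv:
  assumes "f1 \<in> C1c" "f2 \<in> C1c" "G \<in> sets borel"
  shows "set_integrable lborel G (gdiv f1 f2)"
  unfolding set_integrable_def
  by (intro integrable_mult_indicator integrable_gdiv) (use assms in auto)

text \<open>Each integral in the supremum ignores null sets, so the perimeter can be computed on any
  Borel representative.\<close>

lemma grushin_perimeter_eq:
  assumes "E \<in> sets lebesgue" "G \<in> sets borel" "sym_diff E G \<in> null_sets lebesgue"
  shows "grushin_perimeter \<alpha> E = Sup {ereal (LINT p:G|lborel. gdiv f1 f2 p)
          | f1 f2. f1 \<in> C1c \<and> f2 \<in> C1c \<and> (\<forall>p. sqrt ((f1 p)\<^sup>2 + (f2 p)\<^sup>2) \<le> 1)}"
  unfolding grushin_perimeter_def gdiv_def[symmetric]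
  by (rule arg_cong[where f=Sup], rule Collect_cong, intro ex_cong1)
     (auto simp: set_integral_lebesgue_borel[OF borel_measurable_gdiv assms])

lemma grushin_perimeter_ge:
  assumes "E \<in> sets lebesgue" "G \<in> sets borel" "sym_diff E G \<in> null_sets lebesgue"
    and "f1 \<in> C1c" "f2 \<in> C1c" "\<And>p. (f1 p)\<^sup>2 + (f2 p)\<^sup>2 \<le> 1"
  shows "ereal (LINT p:G|lborel. gdiv f1 f2 p) \<le> grushin_perimeter \<alpha> E"
  unfolding grushin_perimeter_eq[OF assms(1-3)]
  by (rule Sup_upper) (use assms(4-6) in \<open>auto simp: real_sqrt_le_1_iff\<close>)

lemma grushin_perimeter_le:
  assumes "E \<in> sets lebesgue" "G \<in> sets borel" "sym_diff E G \<in> null_sets lebesgue"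
    and "\<And>f1 f2. f1 \<in> C1c \<Longrightarrow> f2 \<in> C1c \<Longrightarrow> (\<And>p. (f1 p)\<^sup>2 + (f2 p)\<^sup>2 \<le> 1) \<Longrightarrow>
          (LINT p:G|lborel. gdiv f1 f2 p) \<le> c"
  shows "grushin_perimeter \<alpha> E \<le> ereal c"
  unfolding grushin_perimeter_eq[OF assms(1-3)]
  by (rule Sup_least) (use assms(4) in \<open>auto simp: real_sqrt_le_1_iff\<close>)

end

section \<open>The extremal normal and polynomial approximation\<close>

abbreviation tau :: real where "tau \<equiv> 2 * pi / 3"

lemma cos_tau: "cos tau = - 1 / 2"
proof -
  have "cos (2 * (pi / 3)) = 2 * (cos (pi / 3))\<^sup>2 - 1" by (rule cos_double_cos)
  then show ?thesis by (simp add: cos_60 power2_eq_square)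
qed

lemma tau_bounds: "0 < tau" "tau < pi" "pi / 2 < tau" "tau \<le> pi"
  using pi_gt_zero by auto

context grushin
begin

text \<open>The integral of \<open>sin ^ k * W sin\<close> from 0, taken as an antiderivative on the
  whole line so that it has a two-sided derivative everywhere. The indices 0, 1, 2 give the weighted
  length, the height and the area of the extremal curve.\<close>

definition sin_moment :: "nat \<Rightarrow> real \<Rightarrow> real" where
  "sin_moment k = (SOME H. (\<forall>x. (H has_real_derivative sin x ^ k * W (sin x)) (at x)) \<and> H 0 = 0)"

lemma sin_moment: "(sin_moment k has_real_derivative sin x ^ k * W (sin x)) (at x)" "sin_moment k 0 = 0"
proof -
  have "continuous_on UNIV (\<lambda>x. sin x ^ k * W (sin x))"
    by (intro continuous_intros)
  then obtain F where F: "\<And>x. (F has_real_derivative sin x ^ k * W (sin x)) (at x)"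
    by (rule ex_antiderivative) blast
  have "\<exists>H. (\<forall>x. (H has_real_derivative sin x ^ k * W (sin x)) (at x)) \<and> H 0 = 0"
    by (rule exI[of _ "\<lambda>x. F x - F 0"]) (auto intro!: derivative_eq_intros F)
  from someI_ex[OF this] show "(sin_moment k has_real_derivative sin x ^ k * W (sin x)) (at x)" "sin_moment k 0 = 0"
    unfolding sin_moment_def[symmetric] by blast+
qed

lemma sin_moment_strict_mono:
  assumes "0 \<le> x" "x < y" "y \<le> pi"
  shows "sin_moment k x < sin_moment k y"
proof (rule DERIV_pos_imp_increasing_open[OF assms(2)])
  fix t assume "x < t" "t < y"
  then have "sin t > 0" using assms by (intro sin_gt_zero) auto
  then have "0 < sin t ^ k * W (sin t)" using W_pos[of "sin t"] by simp
  with sin_moment(1) show "\<exists>d. (sin_moment k has_real_derivative d) (at t) \<and> 0 < d" by blast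
qed (intro continuous_at_imp_continuous_on ballI DERIV_isCont[OF sin_moment(1)])

lemma sin_moment_pos: "0 < x \<Longrightarrow> x \<le> pi \<Longrightarrow> 0 < sin_moment k x"
  using sin_moment_strict_mono[of 0 x k] by (simp add: sin_moment)

text \<open>Integration by parts, proved by checking that the difference has derivative 0. It is the
  only link between length (index 0) and area (index 2); at \<open>tau\<close> its boundary term is
  exactly the cost of the interface on the axis, which makes the upper bound coincide with the lower
  one.\<close>

lemma sin_moment_reduction:
  "(\<alpha> + 2) * sin_moment 2 t = (\<alpha> + 1) * sin_moment 0 t - cos t * sin t * W (sin t)"
proof -
  define F where "F t = (\<alpha> + 2) * sin_moment 2 t - (\<alpha> + 1) * sin_moment 0 t + (\<alpha> + 1) * (cos t * U (sin t))" for t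
  have "(F has_real_derivative 0) (at t)" for t
  proof -
    have "(F has_real_derivative (\<alpha> + 2) * ((sin t)\<^sup>2 * W (sin t)) - (\<alpha> + 1) * W (sin t)
        + (\<alpha> + 1) * (cos t * (W (sin t) * cos t) + - sin t * U (sin t))) (at t)"
      unfolding F_def
      by (intro DERIV_add DERIV_diff DERIV_cmult DERIV_mult' DERIV_cos DERIV_chain2[OF DERIV_U DERIV_sin])
         (use sin_moment(1)[of 2 t] sin_moment(1)[of 0 t] in simp_all)
    moreover have "(\<alpha> + 1) * (cos t * (W (sin t) * cos t) + - sin t * U (sin t))
        = (\<alpha> + 1) * (cos t)\<^sup>2 * W (sin t) - (sin t)\<^sup>2 * W (sin t)"
      using alpha_nonneg by (simp add: U_def power2_eq_square field_simps)
    ultimately show ?thesis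
      by (simp add: cos_squared_eq algebra_simps)
  qed
  then have "F t = F 0" by (intro DERIV_isconst_all) blast
  moreover have "(\<alpha> + 1) * (cos t * U (sin t)) = cos t * sin t * W (sin t)"
    using alpha_nonneg by (simp add: U_def)
  ultimately show ?thesis by (simp add: F_def sin_moment)
qed

text \<open>The area of the upper half of the extremal set of scale \<open>l\<close>.\<close>

abbreviation area :: "real \<Rightarrow> real" where
  "area l \<equiv> 2 * l\<^sup>2 * W l * sin_moment 2 tau"

text \<open>The normal \<open>(S, N)\<close> of the extremal curve, as a function of the area enclosed below it.\<close>

lemma normal_by_volume:
  assumes "0 < l"
  obtains lo N S S' where "lo < 0"
    "\<And>V. lo < V \<Longrightarrow> V < area l \<Longrightarrow>
       (N has_real_derivative curvature l (S V)) (at V) \<and>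
       (S has_real_derivative S' V) (at V) \<and> 0 < S V \<and> (S V)\<^sup>2 + (N V)\<^sup>2 = 1"
    "continuous_on {lo<..<area l} S'"
    "\<And>V. 0 \<le> V \<Longrightarrow> V < area l \<Longrightarrow> - 1 / 2 \<le> N V"
proof -
  define K where "K = 2 * l\<^sup>2 * W l"
  have K: "K > 0" using assms W_pos[of l] by (simp add: K_def)
  define f where "f t = K * (sin_moment 2 tau - sin_moment 2 t)" for t
  have f': "(f has_real_derivative - (K * ((sin t)\<^sup>2 * W (sin t)))) (at t)" for t
    unfolding f_def by (auto intro!: derivative_eq_intros sin_moment)
  have cf: "continuous_on A f" for A
    by (intro continuous_at_imp_continuous_on ballI DERIV_isCont[OF f'])
  have dec: "f y < f x" if "0 \<le> x" "x < y" "y \<le> pi" for x y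
    using sin_moment_strict_mono[OF that] K by (simp add: f_def)
  have inj: "inj_on f {0<..<pi}"
  proof (rule inj_onI)
    fix x y assume "x \<in> {0<..<pi}" "y \<in> {0<..<pi}" "f x = f y"
    with dec[of x y] dec[of y x] show "x = y" by force
  qed
  define g where "g = the_inv_into {0<..<pi} f"
  have gf: "g (f t) = t" if "t \<in> {0<..<pi}" for t
    unfolding g_def using inj that by (rule the_inv_into_f_f)
  have ex: "\<exists>t\<in>{0<..<pi}. f t = V" if "f pi < V" "V < f 0" for V
  proof -
    have "\<exists>t\<ge>0. t \<le> pi \<and> f t = V"
      by (rule IVT2') (use that cf in auto)
    then obtain t where t: "0 \<le> t" "t \<le> pi" "f t = V" by blast
    with that have "t \<noteq> 0" "t \<noteq> pi" by auto
    then show ?thesis using t by (intro bexI[of _ t]) (auto simp: less_le)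
  qed
  define S where "S V = sin (g V)" for V
  define N where "N V = cos (g V)" for V
  define S' where "S' V = - (N V / (K * ((S V)\<^sup>2 * W (S V))))" for V
  have f0: "f 0 = K * sin_moment 2 tau" by (simp add: f_def sin_moment)
  have main: "(N has_real_derivative 1 / (K * (S V * W (S V)))) (at V) \<and> (S has_real_derivative S' V) (at V)
      \<and> 0 < S V \<and> (S V)\<^sup>2 + (N V)\<^sup>2 = 1" if V: "f pi < V" "V < f 0" for V
  proof -
    obtain t where t: "t \<in> {0<..<pi}" "f t = V" using ex[OF V] by blast
    have s: "sin t > 0" using t by (intro sin_gt_zero) auto
    with W_pos[of "sin t"] have w: "W (sin t) > 0" by simp
    have "(g has_real_derivative inverse (- (K * ((sin t)\<^sup>2 * W (sin t))))) (at (f t))"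
      unfolding has_field_derivative_def
    proof (rule has_derivative_inverse_strong[OF _ t(1) cf gf])
      show "(f has_derivative (*) (- (K * ((sin t)\<^sup>2 * W (sin t))))) (at t)"
        using f' by (simp only: has_field_derivative_def)
      have "- (K * ((sin t)\<^sup>2 * W (sin t))) \<noteq> 0" using s w K by simp
      then show "(*) (- (K * ((sin t)\<^sup>2 * W (sin t)))) \<circ> (*) (inverse (- (K * ((sin t)\<^sup>2 * W (sin t))))) = id"
        by (simp only: fun_eq_iff o_apply id_apply mult.assoc[symmetric] right_inverse mult_1_left simp_thms)
    qed simp
    then have g': "(g has_real_derivative - inverse (K * ((S V)\<^sup>2 * W (S V)))) (at V)"
      using gf[OF t(1)] t(2) by (simp add: S_def)
    have gV: "g V = t" using gf[OF t(1)] t(2) by simp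
    have "(N has_real_derivative 1 / (K * (S V * W (S V)))) (at V)"
      unfolding N_def
      by (rule derivative_eq_intros g' refl)+
         (use s w K in \<open>simp add: S_def gV field_simps power2_eq_square\<close>)
    moreover have "(S has_real_derivative S' V) (at V)"
      unfolding S_def
      by (rule derivative_eq_intros g' refl)+
         (use s w K in \<open>simp add: S_def S'_def N_def gV field_simps power2_eq_square\<close>)
    ultimately show ?thesis using s by (simp add: S_def N_def gV)
  qed
  show ?thesis
  proof (rule that[of "f pi" N S S'])
    show "f pi < 0" using dec[of tau pi] tau_bounds by (simp add: f_def)
    show "(N has_real_derivative curvature l (S V)) (at V) \<and>
       (S has_real_derivative S' V) (at V) \<and> 0 < S V \<and> (S V)\<^sup>2 + (N V)\<^sup>2 = 1"
      if "f pi < V" "V < area l" for V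
      using main[of V] that by (simp add: f0 K_def)
    have cN: "continuous_on {f pi<..<f 0} N" and cS: "continuous_on {f pi<..<f 0} S"
      by (auto intro!: continuous_at_imp_continuous_on dest!: main intro: DERIV_isCont)
    have nz: "K * ((S V)\<^sup>2 * W (S V)) \<noteq> 0" if "V \<in> {f pi<..<f 0}" for V
      using main[of V] K W_pos[of "S V"] that by simp
    have "continuous_on {f pi<..<f 0} S'"
      unfolding S'_def by (intro continuous_intros cN cS) (use nz in auto)
    then show "continuous_on {f pi<..<area l} S'"
      by (simp add: f0 K_def)
    \<comment> \<open>Nonnegative area means an angle of at most \<open>tau\<close>, and
      \<open>cos tau\<close> is -1/2. This bound pays for switching the fields on near the
      axis.\<close>
    show "- 1 / 2 \<le> N V" if V: "0 \<le> V" "V < area l" for V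
    proof -
      have "f pi < f tau" "f tau = 0"
        by (rule dec) (use pi_gt_zero in \<open>auto simp: f_def\<close>)
      with V(1) have "f pi < V" by linarith
      moreover have "V < f 0" using V by (simp add: f0 K_def)
      ultimately obtain t where t: "t \<in> {0<..<pi}" "f t = V" using ex by blast
      have "t \<le> tau"
      proof (rule ccontr)
        assume "\<not> t \<le> tau"
        then have "f t < f tau" using dec[of tau t] t tau_bounds by auto
        with t V show False by (simp add: f_def)
      qed
      then have "cos tau \<le> cos t"
        using t tau_bounds by (intro cos_monotone_0_pi_le) auto
      then show ?thesis using gf[OF t(1)] t(2) by (simp add: N_def cos_tau)
    qed
  qed
qed

end

section \<open>Polynomial approximation of indicators\<close>

lemma real_polynomial_function_poly_poly:
  assumes "real_polynomial_function (f :: real \<times> real \<Rightarrow> real)"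
  shows "\<exists>P. \<forall>x y. f (x, y) = poly (poly P [:x:]) y"
  using assms
proof induction
  case (linear f)
  interpret bounded_linear f by fact
  have "f (x, y) = x * f (1, 0) + y * f (0, 1)" for x y
  proof -
    have "(x, y) = x *\<^sub>R (1, 0) + y *\<^sub>R (0, 1)" by simp
    then have "f (x, y) = f (x *\<^sub>R (1, 0) + y *\<^sub>R (0, 1))" by simp
    then show ?thesis by (simp only: add scaleR) simp
  qed
  moreover have "x * c + y * d = poly (poly [:[:0, d:], [:c:]:] [:x:]) y" for x y c d :: real
    by (simp add: algebra_simps)
  ultimately show ?case by metis
next
  case (const c)
  show ?case by (intro exI[of _ "[:[:c:]:]"]) simp
next
  case (add f g)
  then obtain P Q where "\<forall>x y. f (x, y) = poly (poly P [:x:]) y" "\<forall>x y. g (x, y) = poly (poly Q [:x:]) y"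
    by blast
  then show ?case by (intro exI[of _ "P + Q"]) simp
next
  case (mult f g)
  then obtain P Q where "\<forall>x y. f (x, y) = poly (poly P [:x:]) y" "\<forall>x y. g (x, y) = poly (poly Q [:x:]) y"
    by blast
  then show ?case by (intro exI[of _ "P * Q"]) simp
qed

text \<open>The reason for approximating by polynomials: as a polynomial in \<open>x\<close> with
  coefficients polynomial in \<open>y\<close>, the density is integrated in \<open>x\<close> term by
  term, and the result is C^1 in both variables. The test field is built from this
  antiderivative.\<close>

lemma real_polynomial_function_antiderivative:
  assumes "real_polynomial_function (p :: real \<times> real \<Rightarrow> real)"
  obtains C Cy where "C1d C p Cy" "\<And>y. C (a, y) = 0"
proof -
  obtain P where P: "\<And>x y. p (x, y) = poly (poly P [:x:]) y"
    using real_polynomial_function_poly_poly[OF assms] by blast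
  have p: "p (x, y) = (\<Sum>i\<le>degree P. poly (coeff P i) y * x ^ i)" for x y
    by (simp add: P poly_altdef[of P] poly_sum poly_power)
  define u where "u i x = (x ^ Suc i - a ^ Suc i) / real (Suc i)" for i :: nat and x
  define C where "C z = (\<Sum>i\<le>degree P. u i (fst z) * poly (coeff P i) (snd z))" for z
  have u: "(u i has_real_derivative x ^ i) (at x)" for i x
  proof -
    have "(u i has_real_derivative (real (Suc i) * x ^ i - 0) / real (Suc i)) (at x)"
      unfolding u_def by (intro DERIV_cdivide DERIV_diff DERIV_const) (use DERIV_pow[of "Suc i" x] in simp)
    then show ?thesis by simp
  qed
  have "C1d (\<lambda>z. u i (fst z) * poly (coeff P i) (snd z))
      (\<lambda>z. fst z ^ i * poly (coeff P i) (snd z) + u i (fst z) * 0)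
      (\<lambda>z. 0 * poly (coeff P i) (snd z) + u i (fst z) * poly (pderiv (coeff P i)) (snd z))" for i
    by (intro C1d_mult C1d_fst[where f'="\<lambda>x. x ^ i"] C1d_snd; simp add: C1r_def u poly_DERIV continuous_intros)
  then have 1: "C1d C (\<lambda>z. \<Sum>i\<le>degree P. fst z ^ i * poly (coeff P i) (snd z) + u i (fst z) * 0)
     (\<lambda>z. \<Sum>i\<le>degree P. 0 * poly (coeff P i) (snd z) + u i (fst z) * poly (pderiv (coeff P i)) (snd z))"
    unfolding C_def by (intro C1d_sum)
  have 2: "(\<lambda>z. \<Sum>i\<le>degree P. fst z ^ i * poly (coeff P i) (snd z) + u i (fst z) * 0) = p"
    by (auto simp: fun_eq_iff p mult.commute)
  have "C (a, y) = 0" for y by (simp add: C_def u_def)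
  from that[OF 1[unfolded 2] this] show ?thesis .
qed

lemma integrable_box_error:
  fixes p :: "'a::euclidean_space \<Rightarrow> real"
  assumes p: "continuous_on UNIV p" and A [measurable]: "A \<in> sets borel" and fin: "emeasure lborel A < \<infinity>"
  shows "integrable lborel (\<lambda>x. indicator (cbox a b) x * \<bar>p x - indicator A x\<bar>)"
proof -
  have [measurable]: "p \<in> borel_measurable borel"
    by (rule borel_measurable_continuous_onI[OF p])
  have "integrable lborel (\<lambda>x. indicator (cbox a b) x *\<^sub>R \<bar>p x\<bar>)"
    by (intro borel_integrable_compact compact_cbox continuous_intros continuous_on_subset[OF p]) auto
  moreover have "integrable lborel (indicator A :: 'a \<Rightarrow> real)"
    using fin by (intro integrable_real_indicator) auto
  ultimately have "integrable lborel (\<lambda>x. indicator (cbox a b) x *\<^sub>R \<bar>p x\<bar> + indicator A x)"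
    by (rule Bochner_Integration.integrable_add)
  then show ?thesis
    by (rule Bochner_Integration.integrable_bound) (measurable, auto simp: indicator_def)
qed

text \<open>Continuous functions converging almost everywhere to the indicator converge in L^1 on
  the box after truncation; one of them is then replaced by a polynomial through
  Stone-Weierstrass.\<close>

lemma indicator_L1_approx:
  fixes G :: "'a::euclidean_space set"
  assumes G: "G \<in> sets borel" and e: "0 < e"
  obtains p where "real_polynomial_function p" "\<And>x. x \<in> cbox a b \<Longrightarrow> 0 \<le> p x"
    "(LINT x:cbox a b|lborel. \<bar>p x - indicator G x\<bar>) < e"
proof -
  have "(indicator G :: 'a \<Rightarrow> real) measurable_on UNIV"
    using G by (intro lebesgue_measurable_imp_measurable_on borel_measurable_indicator) auto
  then obtain Z h where Z: "negligible Z" and h: "\<And>n. continuous_on UNIV (h n)"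
    and lim: "\<And>x. x \<notin> Z \<Longrightarrow> (\<lambda>n. h n x) \<longlonglongrightarrow> (indicator G x :: real)"
    by (auto simp: measurable_on_def)
  \<comment> \<open>Truncation to \<open>[0, 1]\<close> supplies the dominating function and does
    not alter the limit, which takes the values 0 and 1 only.\<close>
  define k where "k n x = max 0 (min 1 (h n x))" for n x
  have k: "continuous_on A (k n)" for n A
    unfolding k_def by (intro continuous_intros continuous_on_subset[OF h]) auto
  define gap where "gap n x = indicator (cbox a b) x * \<bar>k n x - indicator G x\<bar>" for n x
  have [measurable]: "k n \<in> borel_measurable borel" for n
    by (rule borel_measurable_continuous_onI[OF k])
  have [measurable]: "G \<in> sets borel" by fact
  have AE: "AE x in lborel. x \<notin> Z"
  proof -
    have "Z \<in> null_sets lebesgue" using Z by (simp add: negligible_iff_null_sets)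
    then have "AE x in lebesgue. x \<notin> Z" by (rule AE_not_in)
    then show ?thesis by (simp add: AE_completion_iff)
  qed
  have "(\<lambda>n. LINT x|lborel. gap n x) \<longlonglongrightarrow> (LINT x::'a|lborel. (0::real))"
  proof (rule integral_dominated_convergence[where s=gap and w="indicator (cbox a b)"])
    show "AE x in lborel. (\<lambda>n. gap n x) \<longlonglongrightarrow> (0::real)"
      using AE
    proof eventually_elim
      case (elim x)
      have "(\<lambda>n. gap n x)
          \<longlonglongrightarrow> indicator (cbox a b) x * \<bar>max 0 (min 1 (indicator G x)) - indicator G x :: real\<bar>"
        unfolding gap_def k_def by (intro tendsto_intros lim elim)
      moreover have "max 0 (min 1 (indicator G x)) = (indicator G x :: real)"
        by (simp add: indicator_def)
      ultimately show ?case by simp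
    qed
    show "integrable lborel (indicator (cbox a b) :: 'a \<Rightarrow> real)"
      by (rule integrable_real_indicator) (auto simp: emeasure_lborel_cbox_eq)
    show "AE x in lborel. norm (gap n x) \<le> indicator (cbox a b) x" for n
      by (auto simp: gap_def indicator_def k_def)
    show "gap n \<in> borel_measurable lborel" for n unfolding gap_def[abs_def] by measurable
  qed measurable
  then have "(\<lambda>n. LINT x|lborel. gap n x) \<longlonglongrightarrow> 0" by simp
  then have "\<forall>\<^sub>F n in sequentially. (LINT x|lborel. gap n x) < e / 2"
    using e by (intro order_tendstoD(2)) auto
  then obtain n where n: "(LINT x|lborel. gap n x) < e / 2"
    by (auto simp: eventually_sequentially)
  define c where "c = measure lborel (cbox a b)"
  \<comment> \<open>The uniform error \<open>d\<close> and the later shift by \<open>d\<close> cost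
    at most \<open>2 * d\<close> on a box of measure \<open>c\<close>, which is less than
    \<open>e / 2\<close>.\<close>
  define d where "d = e / (4 * (c + 1))"
  have c: "c \<ge> 0" by (simp add: c_def)
  then have d: "d > 0" "2 * d * c < e / 2" using e by (auto simp: d_def field_simps)
  obtain p where p: "real_polynomial_function p" "\<And>x. x \<in> cbox a b \<Longrightarrow> \<bar>k n x - p x\<bar> < d"
    using Stone_Weierstrass_real_polynomial_function[OF compact_cbox k d(1)] by metis
  have [measurable]: "p \<in> borel_measurable borel"
    by (rule borel_measurable_continuous_onI[OF continuous_on_polymonial_function])
       (use p(1) in \<open>simp add: real_polynomial_function_eq\<close>)
  \<comment> \<open>The polynomial is above \<open>- d\<close> on the box, so adding
    \<open>d\<close> makes it nonnegative there.\<close>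
  show ?thesis
  proof (rule that[of "\<lambda>x. p x + d"])
    show "real_polynomial_function (\<lambda>x. p x + d)"
      by (rule real_polynomial_function.intros(3)[OF p(1) real_polynomial_function.intros(2)])
    show "0 \<le> p x + d" if "x \<in> cbox a b" for x
    proof -
      have "0 \<le> k n x" by (simp add: k_def)
      with p(2)[OF that] show ?thesis by linarith
    qed
    have i1: "integrable lborel (gap n)"
    proof (rule Bochner_Integration.integrable_bound)
      show "integrable lborel (indicator (cbox a b) :: 'a \<Rightarrow> real)"
        by (rule integrable_real_indicator) (auto simp: emeasure_lborel_cbox_eq)
      show "gap n \<in> borel_measurable lborel" unfolding gap_def[abs_def] by measurable
    qed (auto simp: gap_def indicator_def k_def)
    have i2: "integrable lborel (\<lambda>x. indicator (cbox a b) x * (2 * d))"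
      by (intro integrable_mult_left integrable_real_indicator) (auto simp: emeasure_lborel_cbox_eq)
    have "(LINT x:cbox a b|lborel. \<bar>p x + d - indicator G x\<bar>)
        \<le> (LINT x|lborel. gap n x + indicator (cbox a b) x * (2 * d))"
      unfolding set_lebesgue_integral_def
    proof (rule integral_mono')
      show "integrable lborel (\<lambda>x. gap n x + indicator (cbox a b) x * (2 * d))"
        by (intro Bochner_Integration.integrable_add i1 i2)
      show "indicator (cbox a b) x *\<^sub>R \<bar>p x + d - indicator G x\<bar>
          \<le> gap n x + indicator (cbox a b) x * (2 * d)" for x
        using p(2)[of x] by (auto simp: gap_def indicator_def split: if_splits)
      show "0 \<le> gap n x + indicator (cbox a b) x * (2 * d)" for x
        using d by (simp add: gap_def)
    qed
    also have "\<dots> = (LINT x|lborel. gap n x) + 2 * d * c"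
      by (subst Bochner_Integration.integral_add[OF i1 i2]) (simp add: c_def)
    also have "\<dots> < e" using n d by simp
    finally show "(LINT x:cbox a b|lborel. \<bar>p x + d - indicator G x\<bar>) < e" .
  qed
qed

section \<open>The one-dimensional inequality on slices\<close>

context grushin
begin

lemma integral_W_interval:
  assumes "0 \<le> f"
  shows "integrable lborel (\<lambda>x. indicator {-f..f} x * W x)" "(LINT x|lborel. indicator {-f..f} x * W x) = 2 * U f"
proof -
  have "has_bochner_integral lborel (\<lambda>x. W x * indicator {-f..f} x) (U f - U (-f))"
    by (rule has_bochner_integral_FTC_Icc_real) (use assms DERIV_U continuous_on_W[of UNIV] in \<open>auto simp: continuous_on_eq_continuous_at\<close>)
  then show "integrable lborel (\<lambda>x. indicator {-f..f} x * W x)" "(LINT x|lborel. indicator {-f..f} x * W x) = 2 * U f"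
    by (simp_all add: has_bochner_integral_iff U_minus mult.commute)
qed

text \<open>Bathtub principle: \<open>W\<close> is even and grows with the distance from 0, so among
  sets of given length the centred interval has least weight. With \<open>f\<close> half of the
  length, the integrand of the difference is \<open>(W x - W f)\<close> times a difference of
  indicators, of constant sign; the \<open>W f\<close> terms cancel because the lengths
  agree.\<close>

lemma integral_W_rearrangement:
  assumes A: "A \<in> sets borel" "A \<subseteq> {-R..R}"
  shows "integrable lborel (\<lambda>x. indicator A x * W x)"
    "2 * U (measure lborel A / 2) \<le> (LINT x|lborel. indicator A x * W x)"
proof -
  have fin: "emeasure lborel A < \<infinity>"
    using emeasure_mono[OF A(2), of lborel] by (auto simp: emeasure_lborel_Icc_eq less_top[symmetric] top_unique)
  define f where "f = measure lborel A / 2"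
  have f: "f \<ge> 0" by (simp add: f_def)
  have [measurable]: "W \<in> borel_measurable borel"
    by (intro borel_measurable_continuous_onI continuous_on_W)
  have [measurable]: "A \<in> sets borel" by fact
  show iA: "integrable lborel (\<lambda>x. indicator A x * W x)"
  proof (rule Bochner_Integration.integrable_bound)
    show "integrable lborel (\<lambda>x. indicator A x * W R)"
      using fin A by (intro integrable_mult_left integrable_real_indicator) auto
    show "AE x in lborel. norm (indicator A x * W x) \<le> norm (indicator A x * W R)"
      using A(2) by (intro AE_I2) (force simp: indicator_def intro!: W_mono)
  qed measurable
  have i1: "integrable lborel (\<lambda>x. indicator A x * W f)" "integrable lborel (\<lambda>x. indicator {-f..f} x * W f)"
    using fin A by (auto intro!: integrable_mult_left integrable_real_indicator simp: emeasure_lborel_Icc_eq)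
  have "(LINT x|lborel. indicator {-f..f} x * W x + indicator A x * W f)
      \<le> (LINT x|lborel. indicator A x * W x + indicator {-f..f} x * W f)"
  proof (rule integral_mono)
    show "indicator {-f..f} x * W x + indicator A x * W f \<le> indicator A x * W x + indicator {-f..f} x * W f" for x
      using W_mono[of x f] W_mono[of f x] f by (auto simp: indicator_def abs_le_iff)
  qed (intro Bochner_Integration.integrable_add i1 iA integral_W_interval f)+
  moreover have "(LINT x|lborel. indicator {-f..f} x * W x + indicator A x * W f) = 2 * U f + measure lborel A * W f"
    by (subst Bochner_Integration.integral_add[OF integral_W_interval(1)[OF f] i1(1)]) (simp add: integral_W_interval(2)[OF f])
  moreover have "(LINT x|lborel. indicator A x * W x + indicator {-f..f} x * W f) = (LINT x|lborel. indicator A x * W x) + 2 * f * W f"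
    by (subst Bochner_Integration.integral_add[OF iA i1(2)]) (use f in simp)
  ultimately show "2 * U (measure lborel A / 2) \<le> (LINT x|lborel. indicator A x * W x)"
    by (simp add: f_def)
qed

text \<open>Let \<open>z\<close> be the ratio of the half length \<open>m / 2\<close> to the
  extremal half length \<open>l * S\<close>. Then the second summand is
  \<open>2 * S * (z^2 * W z) / (\<alpha> + 1)\<close>, and the claim is Bernoulli's inequality at
  \<open>z\<close>, with equality when the section is the extremal one.\<close>

lemma young_slice:
  assumes l: "0 < l" and S: "0 < S" and m: "0 \<le> m"
  shows "rate l * m \<le> 2 * S + 2 * U (m / 2) * m * curvature l S"
proof -
  define z where "z = m / (2 * l * S)"
  have z: "0 \<le> z" "m / 2 = z * (l * S)" "m = 2 * (z * (l * S))" using l S m by (auto simp: z_def)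
  have pos: "W l > 0" "W S > 0" "l > 0" "S > 0" using l S by (auto intro: W_pos)
  have "2 * U (m / 2) * m * curvature l S = 2 * S * (z\<^sup>2 * W z) / (\<alpha> + 1)"
    using pos alpha_nonneg unfolding z(2) U_def W_mult
    by (subst z(3)) (simp add: power2_eq_square field_simps)
  moreover have "rate l * m = 2 * S * ((\<alpha> + 2) * z) / (\<alpha> + 1)"
  proof -
    have "b / (a * l) * (2 * (z * (l * S))) = 2 * S * (b * z) / a" if "a \<noteq> 0" for a b
      using that pos by (simp add: field_simps)
    then show ?thesis using alpha_nonneg by (subst z(3)) simp
  qed
  moreover have "2 * S * ((\<alpha> + 2) * z) / (\<alpha> + 1) \<le> 2 * S * ((\<alpha> + 1) + z\<^sup>2 * W z) / (\<alpha> + 1)"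
    using Bernoulli_W[OF z(1)] pos alpha_nonneg by (intro divide_right_mono mult_left_mono) auto
  moreover have "2 * S * ((\<alpha> + 1) + z\<^sup>2 * W z) / (\<alpha> + 1) = 2 * S + 2 * S * (z\<^sup>2 * W z) / (\<alpha> + 1)"
    using alpha_nonneg by (simp add: field_simps)
  ultimately show ?thesis by linarith
qed

text \<open>\<open>young_slice\<close> in a form stable under approximation: \<open>m\<close> is the
  true section length, \<open>q\<close> the mass of the polynomial on the section, \<open>e\<close>
  its L^1 error. The square of \<open>eta\<close> keeps the denominator away from 0 on short
  sections, and \<open>s0\<close> bounds the curvature from above.\<close>

lemma slice_estimate:
  assumes l: "0 < l" and S: "0 < s0" "s0 \<le> S" "S \<le> 1" and m: "0 \<le> m" "m \<le> 2 * R"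
    and eta: "0 < eta" and q: "0 \<le> q" "\<bar>q - m\<bar> \<le> e"
  shows "rate l * (m / (1 + eta) - eta)
      - (4 / eta\<^sup>2 + 2 * U R * curvature l s0) * e
    \<le> 2 * S / (q + eta\<^sup>2) * (m - e) + 2 * U (m / 2) * (q * curvature l S)"
proof -
  define c where "c = rate l"
  define k where "k = curvature l S"
  define k0 where "k0 = curvature l s0"
  have pos: "S > 0" "W l > 0" "W S > 0" "W s0 > 0" "c > 0"
    using S l alpha_nonneg by (auto intro: W_pos simp: c_def)
  have e: "e \<ge> 0" using q by linarith
  have "s0 * W s0 \<le> S * W S" using S W_mono[of s0 S] by (intro mult_mono) auto
  then have k: "0 \<le> k" "k \<le> k0" using pos l S by (auto simp: k_def k0_def intro!: divide_left_mono mult_left_mono)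
  have Um: "0 \<le> U (m / 2)" "U (m / 2) \<le> U R"
    using U_nonneg[of "m / 2"] U_strict_mono[of "m / 2" R] m by (auto simp: order.order_iff_strict)
  \<comment> \<open>One \<open>e / eta^2\<close> pays for \<open>e\<close> in the numerator, the
    other for \<open>q\<close> in place of \<open>m\<close> in the denominator.\<close>
  have 1: "m / (m + eta\<^sup>2) - 2 * e / eta\<^sup>2 \<le> (m - e) / (q + eta\<^sup>2)"
  proof -
    define d where "d = eta\<^sup>2"
    have d: "d > 0" using eta by (simp add: d_def)
    have "m * (m + d) \<ge> 0" "m * e \<ge> 0" "m * (m + e - q) \<ge> 0" "(2 * e / d * q) * (m + d) \<ge> 0" "e * d \<ge> 0"
      using m d e q by auto
    have "(m / (m + d) - 2 * e / d) * (q + d) * (m + d) = m * (q + d) - (2 * e / d * q) * (m + d) - 2 * e * (m + d)"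
    proof -
      have "(M - E) * (q + d) * (m + d) = M * (m + d) * (q + d) - (E * q) * (m + d) - E * d * (m + d)" for M E
        by (simp add: algebra_simps)
      moreover have "m / (m + d) * (m + d) = m" "2 * e / d * d = 2 * e" using m d by auto
      ultimately show ?thesis by metis
    qed
    also have "\<dots> \<le> (m - e) * (m + d)"
      using \<open>m * (m + e - q) \<ge> 0\<close> \<open>(2 * e / d * q) * (m + d) \<ge> 0\<close> \<open>e * d \<ge> 0\<close>
      by (simp add: algebra_simps)
    finally have "(m / (m + d) - 2 * e / d) * (q + d) \<le> m - e"
      by (rule mult_right_le_imp_le) (use m d in simp)
    moreover have "0 < q + d" using q d by simp
    ultimately show ?thesis unfolding d_def[symmetric] by (simp only: pos_le_divide_eq)
  qed
  have 2: "2 * S * (m / (m + eta\<^sup>2)) - 4 / eta\<^sup>2 * e \<le> 2 * S / (q + eta\<^sup>2) * (m - e)"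
  proof -
    have "2 * S * (m / (m + eta\<^sup>2) - 2 * e / eta\<^sup>2) \<le> 2 * S * ((m - e) / (q + eta\<^sup>2))"
      using 1 pos by (intro mult_left_mono) auto
    moreover have "S * (e * 4) / eta\<^sup>2 \<le> 1 * (e * 4) / eta\<^sup>2"
      using S e by (intro divide_right_mono mult_right_mono) auto
    ultimately show ?thesis by (simp add: algebra_simps)
  qed
  have 3: "2 * U (m / 2) * m * k - 2 * U R * k0 * e \<le> 2 * U (m / 2) * (q * k)"
  proof -
    have "U (m / 2) * k * (m - q) \<le> U (m / 2) * k * e"
      using Um k q by (intro mult_left_mono) auto
    also have "\<dots> \<le> U R * k0 * e"
      using Um k e by (intro mult_mono) auto
    finally show ?thesis by (simp add: algebra_simps)
  qed
  have y: "c * m \<le> 2 * S + 2 * U (m / 2) * m * k"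
    using young_slice[OF l pos(1) m(1)] by (simp add: c_def k_def)
  \<comment> \<open>For \<open>eta <= m\<close> the regularisation \<open>eta^2\<close> is at most
    \<open>eta * m\<close> and costs a factor \<open>1 / (1 + eta)\<close>; for shorter sections the
    subtracted \<open>eta\<close> makes the left side nonpositive.\<close>
  have 4: "c * (m / (1 + eta) - eta) \<le> 2 * S * (m / (m + eta\<^sup>2)) + 2 * U (m / 2) * m * k"
  proof (cases "eta \<le> m")
    case True
    have "1 / (1 + eta) \<le> m / (m + eta\<^sup>2)"
    proof -
      have "0 < m + eta\<^sup>2" "eta * eta \<le> eta * m"
        using True eta by (auto intro!: mult_left_mono add_pos_pos)
      then show ?thesis using eta by (simp add: pos_divide_le_eq pos_le_divide_eq power2_eq_square algebra_simps)
    qed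
    then have a: "2 * S * (1 / (1 + eta)) \<le> 2 * S * (m / (m + eta\<^sup>2))"
      using pos by (intro mult_left_mono) auto
    have "2 * U (m / 2) * m * k * (1 / (1 + eta)) \<le> 2 * U (m / 2) * m * k * 1"
      using eta Um m k by (intro mult_left_mono) auto
    moreover have "c * m * (1 / (1 + eta)) \<le> (2 * S + 2 * U (m / 2) * m * k) * (1 / (1 + eta))"
      using y eta by (intro mult_right_mono) auto
    moreover have "c * eta \<ge> 0" using pos eta by simp
    ultimately show ?thesis using a by (simp add: algebra_simps)
  next
    case False
    have "m / (1 + eta) \<le> m / 1" using m eta by (intro divide_left_mono) auto
    with False pos have "c * (m / (1 + eta) - eta) \<le> 0" by (intro mult_nonneg_nonpos) auto
    moreover have "0 \<le> 2 * S * (m / (m + eta\<^sup>2)) + 2 * U (m / 2) * m * k"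
      using pos m Um k by (intro add_nonneg_nonneg mult_nonneg_nonneg divide_nonneg_nonneg) auto
    ultimately show ?thesis by linarith
  qed
  show ?thesis
    using 2 3 4 unfolding c_def[symmetric] k_def[symmetric] k0_def[symmetric] by (simp add: algebra_simps)
qed

text \<open>The horizontal term sees only the mass of \<open>p\<close> inside \<open>A\<close>,
  which is at least the length of \<open>A\<close> minus \<open>e\<close>; the vertical term is
  bounded below by rearrangement. What remains is \<open>slice_estimate\<close>.\<close>

lemma slice_bound:
  assumes l: "0 < l" and S: "0 < s0" "s0 \<le> S" "S \<le> 1" and eta: "0 < eta"
    and A: "A \<in> sets borel" "A \<subseteq> {-R..R}" and R: "0 \<le> R" "R \<le> b"
    and p: "continuous_on UNIV p" "\<And>x. \<bar>x\<bar> \<le> b \<Longrightarrow> 0 \<le> p x"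
    and q: "q = (LINT x|lborel. indicator {-b..b} x * p x)"
    and e: "e = (LINT x|lborel. indicator {-b..b} x * \<bar>p x - indicator A x\<bar>)"
  shows "rate l * (measure lborel A / (1 + eta) - eta)
      - (4 / eta\<^sup>2 + 2 * U R * curvature l s0) * e
    \<le> (LINT x|lborel. indicator A x * (2 * S / (q + eta\<^sup>2) * p x + W x * (q * curvature l S)))"
proof -
  define k where "k = curvature l S"
  have k: "k \<ge> 0" using S l by (simp add: k_def)
  have [measurable]: "p \<in> borel_measurable borel"
    by (rule borel_measurable_continuous_onI[OF p(1)])
  have [measurable]: "A \<in> sets borel" by fact
  have fin: "emeasure lborel A < \<infinity>"
    using emeasure_mono[OF A(2), of lborel] by (auto simp: emeasure_lborel_Icc_eq less_top[symmetric] top_unique)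
  have Ab: "A \<subseteq> {-b..b}" using A R by force
  have ip: "integrable lborel (\<lambda>x. indicator {-b..b} x * p x)"
    using borel_integrable_compact[of "{-b..b}" p] p(1) by (auto intro: continuous_on_subset)
  have iA: "integrable lborel (indicator A :: real \<Rightarrow> real)"
    using fin by (intro integrable_real_indicator) auto
  have ipA: "integrable lborel (\<lambda>x. indicator A x * p x)"
  proof (rule Bochner_Integration.integrable_bound[OF ip])
    show "AE x in lborel. norm (indicator A x * p x) \<le> norm (indicator {-b..b} x * p x)"
      using Ab by (intro AE_I2) (auto simp: indicator_def)
  qed measurable
  have idiff: "integrable lborel (\<lambda>x. indicator {-b..b} x * \<bar>p x - indicator A x\<bar>)"
    using integrable_box_error[OF p(1) A(1) fin, of "-b" b] by simp
  have e0: "0 \<le> e" unfolding e by (rule integral_nonneg_AE) auto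
  have q0: "0 \<le> q" unfolding q by (rule integral_nonneg_AE) (auto simp: indicator_def p(2) abs_le_iff)
  have m2: "measure lborel A \<le> 2 * R"
    using measure_mono_fmeasurable[of A "{-R..R}" lborel] A R by (auto simp: fmeasurable_def emeasure_lborel_Icc_eq)
  have mA: "(LINT x|lborel. indicator A x) = measure lborel A" by simp
  have 1: "measure lborel A \<le> (LINT x|lborel. indicator A x * p x) + e"
    unfolding e mA[symmetric] Bochner_Integration.integral_add[OF ipA idiff, symmetric]
  proof (rule integral_mono[OF iA Bochner_Integration.integrable_add[OF ipA idiff]])
    show "indicator A x \<le> indicator A x * p x + indicator {-b..b} x * \<bar>p x - indicator A x\<bar>" for x
      using Ab by (auto simp: indicator_def)
  qed
  have 2: "q \<le> measure lborel A + e"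
    unfolding e q mA[symmetric] Bochner_Integration.integral_add[OF iA idiff, symmetric]
  proof (rule integral_mono[OF ip Bochner_Integration.integrable_add[OF iA idiff]])
    show "indicator {-b..b} x * p x \<le> indicator A x + indicator {-b..b} x * \<bar>p x - indicator A x\<bar>" for x
      by (auto simp: indicator_def)
  qed
  have 3: "(LINT x|lborel. indicator A x * p x) \<le> q"
    unfolding q by (rule integral_mono[OF ipA ip]) (use Ab p(2) in \<open>auto simp: indicator_def abs_le_iff\<close>)
  note iW = integral_W_rearrangement[OF A]
  have "rate l * (measure lborel A / (1 + eta) - eta)
      - (4 / eta\<^sup>2 + 2 * U R * curvature l s0) * e
    \<le> 2 * S / (q + eta\<^sup>2) * (measure lborel A - e) + 2 * U (measure lborel A / 2) * (q * k)"
    unfolding k_def by (rule slice_estimate[OF l S _ m2 eta q0]) (use 1 2 3 in auto)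
  also have "\<dots> \<le> 2 * S / (q + eta\<^sup>2) * (LINT x|lborel. indicator A x * p x) + (LINT x|lborel. indicator A x * W x) * (q * k)"
    using 1 iW(2) q0 k S by (intro add_mono mult_left_mono mult_right_mono) auto
  also have "\<dots> = (LINT x|lborel. 2 * S / (q + eta\<^sup>2) * (indicator A x * p x) + indicator A x * W x * (q * k))"
    by (subst Bochner_Integration.integral_add)
       (use ipA iW(1) in \<open>auto intro!: integrable_mult_right integrable_mult_left\<close>)
  also have "\<dots> = (LINT x|lborel. indicator A x * (2 * S / (q + eta\<^sup>2) * p x + W x * (q * k)))"
    by (rule Bochner_Integration.integral_cong) (auto simp: indicator_def)
  finally show ?thesis by (simp add: k_def)
qed

end

section \<open>Test fields for the lower bound\<close>

lemma C1r_const: "C1r (\<lambda>_. c) (\<lambda>_. 0)"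
  by (simp add: C1r_def)

lemma C1r_add: "C1r f f' \<Longrightarrow> C1r g g' \<Longrightarrow> C1r (\<lambda>x. f x + g x) (\<lambda>x. f' x + g' x)"
  by (auto simp: C1r_def intro!: DERIV_add continuous_intros)

lemma C1r_diff: "C1r f f' \<Longrightarrow> C1r g g' \<Longrightarrow> C1r (\<lambda>x. f x - g x) (\<lambda>x. f' x - g' x)"
  by (auto simp: C1r_def intro!: DERIV_diff continuous_intros)

lemma C1r_mult:
  assumes "C1r f f'" "C1r g g'"
  shows "C1r (\<lambda>x. f x * g x) (\<lambda>x. f' x * g x + f x * g' x)"
  unfolding C1r_def
proof (intro conjI allI)
  show "((\<lambda>x. f x * g x) has_real_derivative f' x * g x + f x * g' x) (at x)" for x
    using DERIV_mult[OF C1rD(1)[OF assms(1)] C1rD(1)[OF assms(2)], of x] by (simp add: algebra_simps)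
  show "continuous_on UNIV (\<lambda>x. f' x * g x + f x * g' x)"
    by (intro continuous_intros C1rD(2)[OF assms(1)] C1rD(2)[OF assms(2)]
        C1r_continuous[OF assms(1)] C1r_continuous[OF assms(2)])
qed

lemma C1r_compose:
  assumes "C1r f f'" "C1r g g'"
  shows "C1r (\<lambda>x. f (g x)) (\<lambda>x. f' (g x) * g' x)"
  unfolding C1r_def
proof (intro conjI allI)
  show "((\<lambda>x. f (g x)) has_real_derivative f' (g x) * g' x) (at x)" for x
    by (rule DERIV_chain2[OF C1rD(1)[OF assms(1)] C1rD(1)[OF assms(2)]])
  show "continuous_on UNIV (\<lambda>x. f' (g x) * g' x)"
    by (intro continuous_on_mult C1rD(2)[OF assms(2)]
        continuous_on_compose2[OF C1rD(2)[OF assms(1)] C1r_continuous[OF assms(2)]]) simp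
qed

lemma C1r_inverse:
  assumes "C1r f f'" "\<And>x. f x \<noteq> 0"
  shows "C1r (\<lambda>x. inverse (f x)) (\<lambda>x. - (f' x * inverse ((f x)\<^sup>2)))"
  unfolding C1r_def
proof (intro conjI allI)
  show "((\<lambda>x. inverse (f x)) has_real_derivative - (f' x * inverse ((f x)\<^sup>2))) (at x)" for x
    using DERIV_inverse_fun[OF C1rD(1)[OF assms(1)] assms(2), of x] by (simp add: power2_eq_square)
  show "continuous_on UNIV (\<lambda>x. - (f' x * inverse ((f x)\<^sup>2)))"
    by (intro continuous_intros C1rD(2)[OF assms(1)] C1r_continuous[OF assms(1)]) (use assms(2) in auto)
qed

lemma C1r_step: "C1r step step'"
  by (simp add: C1r_def DERIV_step continuous_on_step')

lemma C1r_affine: "C1r (\<lambda>x. (a + s * x) / L) (\<lambda>_. s / L)"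
proof -
  have "((\<lambda>x. (a + s * x) / L) has_real_derivative (0 + s * 1) / L) (at x)" for x
    by (intro DERIV_cdivide DERIV_add DERIV_const DERIV_cmult DERIV_ident)
  then show ?thesis by (simp add: C1r_def)
qed

text \<open>Equal to 1 on \<open>[-A, A]\<close> and to 0 outside \<open>[-A - L, A + L]\<close>,
  with slope of order \<open>1 / L\<close>. Both arguments have the shape required by
  \<open>C1r_affine\<close>.\<close>

definition cutoff :: "real \<Rightarrow> real \<Rightarrow> real \<Rightarrow> real" where
  "cutoff A L x = step ((A + L + (- 1) * x) / L) * step ((A + L + 1 * x) / L)"

definition cutoff' :: "real \<Rightarrow> real \<Rightarrow> real \<Rightarrow> real" where
  "cutoff' A L x = step' ((A + L + (- 1) * x) / L) * (- 1 / L) * step ((A + L + 1 * x) / L)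
     + step ((A + L + (- 1) * x) / L) * (step' ((A + L + 1 * x) / L) * (1 / L))"

lemma C1r_cutoff: "C1r (cutoff A L) (cutoff' A L)"
  using C1r_mult[OF C1r_compose[OF C1r_step C1r_affine[of "A + L" "- 1" L]]
      C1r_compose[OF C1r_step C1r_affine[of "A + L" 1 L]]]
  unfolding cutoff_def[abs_def] cutoff'_def[abs_def] .

lemma cutoff_bounds: "0 \<le> cutoff A L x" "cutoff A L x \<le> 1"
  by (auto simp: cutoff_def step_bounds mult_le_one)

lemma step'_0: "1 \<le> t \<Longrightarrow> step' t = 0"
  by (simp add: step'_def)

lemma cutoff_inside:
  assumes "0 < L" "\<bar>x\<bar> \<le> A"
  shows "cutoff A L x = 1" "cutoff' A L x = 0"
proof -
  have "1 \<le> (A + L + (- 1) * x) / L" "1 \<le> (A + L + 1 * x) / L"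
    using assms by (auto simp: pos_le_divide_eq)
  then show "cutoff A L x = 1" "cutoff' A L x = 0"
    unfolding cutoff_def cutoff'_def by (simp_all only: step_1 step'_0 mult_zero_left mult_zero_right mult_1_left add_0_left)
qed

lemma cutoff_outside:
  assumes "0 < L" "A + L \<le> \<bar>x\<bar>"
  shows "cutoff A L x = 0"
proof -
  have "(A + L + (- 1) * x) / L \<le> 0 \<or> (A + L + 1 * x) / L \<le> 0"
    using assms by (auto simp: divide_nonpos_pos abs_if split: if_splits)
  then show ?thesis
    unfolding cutoff_def using step_0 by (metis mult_zero_left mult_zero_right)
qed

lemma cutoff'_bound:
  assumes "0 < L"
  shows "\<bar>cutoff' A L x\<bar> \<le> 4 / L"
proof -
  have *: "\<bar>step' s * (1 / L) * step t\<bar> \<le> 2 / L" for s t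
  proof -
    have "step' s * (1 / L) * step t \<le> 2 * (1 / L) * 1"
      using step'_bounds[of s] step_bounds[of t] assms by (intro mult_mono) auto
    moreover have "0 \<le> step' s * (1 / L) * step t"
      using step'_bounds[of s] step_bounds[of t] assms by simp
    ultimately show ?thesis by simp
  qed
  have "cutoff' A L x = - (step' ((A + L + (- 1) * x) / L) * (1 / L) * step ((A + L + 1 * x) / L))
     + step' ((A + L + 1 * x) / L) * (1 / L) * step ((A + L + (- 1) * x) / L)"
    by (simp add: cutoff'_def)
  then show ?thesis
    using *[of "(A + L + (- 1) * x) / L" "(A + L + 1 * x) / L"] *[of "(A + L + 1 * x) / L" "(A + L + (- 1) * x) / L"]
    by linarith
qed

context grushin
begin

text \<open>\<open>slice_bound\<close> at every height, integrated by Fubini. The heights of the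
  core fill an interval of length at most \<open>R\<close>, hence the loss \<open>eta * R\<close>;
  the errors of the sections add up to the L^1 error on the box.\<close>

lemma core_bound:
  fixes Gc :: "(real \<times> real) set"
  defines "B \<equiv> \<lambda>b::real. cbox (-b, -b) (b, b)"
  assumes l: "0 < l" and s0: "0 < s0" and eta: "0 < eta" and R: "0 \<le> h" "h \<le> R" "R \<le> b"
    and Gc [measurable]: "Gc \<in> sets borel"
    and core: "\<And>x y. (x, y) \<in> Gc \<Longrightarrow> \<bar>x\<bar> \<le> R \<and> h \<le> y \<and> y \<le> R"
    and p: "continuous_on UNIV p" "\<And>z. z \<in> B b \<Longrightarrow> 0 \<le> p z"
    and q: "\<And>y. q y = (LINT x|lborel. indicator {-b..b} x * p (x, y))"
    and n: "\<And>y. h \<le> y \<Longrightarrow> y \<le> R \<Longrightarrow> s0 \<le> n y \<and> n y \<le> 1"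
    and int: "integrable lborel (\<lambda>z. indicator Gc z * (2 * n (snd z) / (q (snd z) + eta\<^sup>2) * p z
        + W (fst z) * (q (snd z) * curvature l (n (snd z)))))"
  shows "rate l * (measure lborel Gc / (1 + eta) - eta * R)
      - (4 / eta\<^sup>2 + 2 * U R * curvature l s0) * (LINT z:B b|lborel. \<bar>p z - indicator Gc z\<bar>)
    \<le> (LINT z|lborel. indicator Gc z * (2 * n (snd z) / (q (snd z) + eta\<^sup>2) * p z
        + W (fst z) * (q (snd z) * curvature l (n (snd z)))))"
    (is "?c * _ - ?C * ?E \<le> (LINT z|lborel. ?f z)")
proof -
  have [measurable]: "p \<in> borel_measurable borel"
    by (rule borel_measurable_continuous_onI[OF p(1)])
  have [measurable]: "B b \<in> sets borel" by (simp add: B_def)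
  have Bmem: "(x, y) \<in> B b \<longleftrightarrow> x \<in> {-b..b} \<and> y \<in> {-b..b}" for x y
    by (auto simp: B_def cbox_Pair_eq)
  have GB: "Gc \<subseteq> B b" using core R by (force simp: Bmem abs_le_iff)
  have finB: "emeasure lborel (B b) < \<infinity>" by (simp add: B_def emeasure_lborel_cbox_eq)
  have finG: "emeasure lborel Gc < \<infinity>"
    using emeasure_mono[OF GB, of lborel] finB by (simp add: le_less_trans)
  have c: "0 \<le> ?c" using l alpha_nonneg by simp
  have C: "0 \<le> ?C" using l s0 U_nonneg[of R] R by simp
  have iG: "integrable lborel (indicator Gc :: real \<times> real \<Rightarrow> real)"
    using finG by (intro integrable_real_indicator) auto
  define d where "d z = indicator (B b) z * \<bar>p z - indicator Gc z\<bar>" for z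
  have iE: "integrable lborel d"
    unfolding d_def[abs_def] B_def by (rule integrable_box_error[OF p(1) Gc finG])
  have E: "?E = (LINT z|lborel. d z)"
    by (simp add: set_lebesgue_integral_def d_def)
  define F where "F z = ?f z" for z
  have iF: "integrable lborel F" using int by (simp only: F_def[abs_def])
  have iG': "integrable (lborel \<Otimes>\<^sub>M lborel) (\<lambda>(x, y). indicator Gc (x, y) :: real)"
    and iE': "integrable (lborel \<Otimes>\<^sub>M lborel) (\<lambda>(x, y). d (x, y))"
    and if': "integrable (lborel \<Otimes>\<^sub>M lborel) (\<lambda>(x, y). F (x, y))"
    using iG iE iF by (simp_all add: lborel_prod)
  define m where "m y = (LINT x|lborel. indicator Gc (x, y) :: real)" for y
  define e where "e y = (LINT x|lborel. d (x, y))" for y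
  have im: "integrable lborel m" and ie: "integrable lborel e"
    unfolding m_def e_def using lborel_pair.integrable_snd[OF iG'] lborel_pair.integrable_snd[OF iE'] .
  have sm: "(LINT y|lborel. m y) = measure lborel Gc"
    unfolding m_def using lborel_pair.integral_snd[OF iG'] finG by (simp add: lborel_prod)
  have se: "(LINT y|lborel. e y) = ?E"
    unfolding e_def E using lborel_pair.integral_snd[OF iE'] by (simp add: lborel_prod)
  have e0: "0 \<le> e y" for y unfolding e_def d_def by (rule integral_nonneg_AE) auto
  have m0: "m y = 0" if "y \<notin> {h..R}" for y
  proof -
    have "indicator Gc (x, y) = (0::real)" for x using core[of x y] that by (auto simp: indicator_def)
    then show ?thesis by (simp add: m_def)
  qed
  define low where "low y = ?c * (m y / (1 + eta) - eta * indicator {h..R} y) - ?C * (e y * indicator {h..R} y)" for y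
  have ieR: "integrable lborel (\<lambda>y. e y * indicator {h..R} y)"
    using integrable_real_mult_indicator[OF _ ie, of "{h..R}"] by simp
  have ihR: "integrable lborel (indicator {h..R} :: real \<Rightarrow> real)"
    by (rule integrable_real_indicator) (auto simp: emeasure_lborel_Icc_eq)
  have ilow: "integrable lborel low"
    unfolding low_def using im ieR ihR
    by (intro Bochner_Integration.integrable_diff integrable_mult_right integrable_divide) auto
  have "low y \<le> (LINT x|lborel. F (x, y))" for y
  proof (cases "y \<in> {h..R}")
    case True
    define A where "A = {x. (x, y) \<in> Gc}"
    have "x \<in> {-R..R}" if "x \<in> A" for x
      using core[of x y] that by (auto simp: A_def)
    then have A: "A \<in> sets borel" "A \<subseteq> {-R..R}"
      unfolding A_def by (measurable, auto)
    have iA: "indicator Gc (x, y) = indicator A x" for x by (auto simp: A_def indicator_def)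
    have mA: "m y = measure lborel A" by (simp add: m_def iA)
    have yb: "y \<in> {-b..b}" using True R by auto
    have eA: "e y = (LINT x|lborel. indicator {-b..b} x * \<bar>p (x, y) - indicator A x\<bar>)"
      unfolding e_def d_def by (rule Bochner_Integration.integral_cong) (use yb in \<open>auto simp: Bmem indicator_def A_def\<close>)
    have "?c * (measure lborel A / (1 + eta) - eta) - ?C * e y
      \<le> (LINT x|lborel. indicator A x * (2 * n y / (q y + eta\<^sup>2) * p (x, y) + W x * (q y * curvature l (n y))))"
    proof (rule slice_bound[OF l s0 _ _ eta A _ R(3) _ _ q eA])
      show "continuous_on UNIV (\<lambda>x. p (x, y))"
        by (rule continuous_on_compose2[OF p(1)]) (auto intro!: continuous_intros)
      show "0 \<le> p (x, y)" if "\<bar>x\<bar> \<le> b" for x using that yb by (intro p(2)) (auto simp: Bmem)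
    qed (use n[of y] True R in auto)
    then show ?thesis using True by (simp add: low_def mA iA F_def)
  next
    case False
    then have "F (x, y) = 0" for x using core[of x y] by (auto simp: indicator_def F_def)
    with False show ?thesis by (simp add: low_def m0)
  qed
  then have "(LINT y|lborel. low y) \<le> (LINT y|lborel. LINT x|lborel. F (x, y))"
    by (intro integral_mono ilow lborel_pair.integrable_snd[OF if'])
  also have "\<dots> = (LINT z|lborel. F z)"
    using lborel_pair.integral_snd[OF if'] by (simp add: lborel_prod)
  finally have 1: "(LINT y|lborel. low y) \<le> (LINT z|lborel. ?f z)" by (simp only: F_def)
  have "(LINT y|lborel. low y) = ?c * (measure lborel Gc / (1 + eta) - eta * (R - h)) - ?C * (LINT y|lborel. e y * indicator {h..R} y)"
    unfolding low_def using im ieR ihR R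
    by (simp add: Bochner_Integration.integral_diff Bochner_Integration.integrable_diff sm)
  moreover have "(LINT y|lborel. e y * indicator {h..R} y) \<le> ?E"
    unfolding se[symmetric] by (rule integral_mono[OF ieR ie]) (use e0 in \<open>auto simp: indicator_def\<close>)
  then have "?C * (LINT y|lborel. e y * indicator {h..R} y) \<le> ?C * ?E"
    by (rule mult_left_mono[OF _ C])
  moreover have "?c * (measure lborel Gc / (1 + eta) - eta * R) \<le> ?c * (measure lborel Gc / (1 + eta) - eta * (R - h))"
    using c eta R by (intro mult_left_mono) auto
  ultimately show ?thesis using 1 by linarith
qed

end

text \<open>The open upper half plane is exhausted by boxes that keep a distance from the axis; in
  such a box all cut-offs of the field can be made equal to 1.\<close>

lemma measure_core_limit:
  fixes G :: "(real \<times> real) set"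
  assumes G: "G \<in> sets borel" "\<And>p. p \<in> G \<Longrightarrow> 0 < snd p" and fin: "emeasure lborel G < \<infinity>" and e: "0 < e"
  obtains R :: real where "1 \<le> R" "measure lborel G - e < measure lborel (G \<inter> cbox (- R, 1 / R) (R, R))"
proof -
  define K where "K n = cbox (- real (Suc n), 1 / real (Suc n)) (real (Suc n), real (Suc n))" for n
  have K: "(x, y) \<in> K n \<longleftrightarrow> \<bar>x\<bar> \<le> real (Suc n) \<and> 1 / real (Suc n) \<le> y \<and> y \<le> real (Suc n)" for x y n
    by (auto simp: K_def cbox_Pair_eq)
  have inc: "incseq (\<lambda>n. G \<inter> K n)"
  proof (rule incseq_SucI, rule subsetI)
    fix n z assume z: "z \<in> G \<inter> K n"
    have "1 / real (Suc (Suc n)) \<le> 1 / real (Suc n)" by (rule divide_left_mono) auto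
    with z show "z \<in> G \<inter> K (Suc n)" by (cases z) (auto simp: K)
  qed
  have U: "(\<Union>n. G \<inter> K n) = G"
  proof (intro equalityI subsetI)
    fix z assume z: "z \<in> G"
    obtain x y where xy: "z = (x, y)" by (cases z)
    have y: "0 < y" using G(2)[OF z] xy by simp
    obtain n where n: "max (max \<bar>x\<bar> y) (1 / y) < real n" using reals_Archimedean2 by blast
    then have "1 / real (Suc n) \<le> y"
      using y by (simp add: field_simps)
    with n have "z \<in> K n" unfolding xy K by auto
    with z show "z \<in> (\<Union>n. G \<inter> K n)" by auto
  qed auto
  have "(\<lambda>n. measure lborel (G \<inter> K n)) \<longlonglongrightarrow> measure lborel (\<Union>n. G \<inter> K n)"
    by (rule Lim_measure_incseq[OF _ inc]) (use G fin U in \<open>auto simp: K_def\<close>)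
  then have "(\<lambda>n. measure lborel (G \<inter> K n)) \<longlonglongrightarrow> measure lborel G" by (simp only: U)
  then have "\<forall>\<^sub>F n in sequentially. measure lborel G - e < measure lborel (G \<inter> K n)"
    using e by (intro order_tendstoD(1)) auto
  then obtain n where "measure lborel G - e < measure lborel (G \<inter> K n)"
    by (auto simp: eventually_sequentially)
  then show ?thesis using that[of "real (Suc n)"] by (simp add: K_def)
qed

lemma C1r_slice:
  assumes "C1d f fx fy"
  shows "C1r (\<lambda>y. f (a, y)) (\<lambda>y. fy (a, y))"
  unfolding C1r_def
proof (intro conjI allI)
  show "((\<lambda>y. f (a, y)) has_real_derivative fy (a, y)) (at y)" for y by (rule C1d_DERIV_y[OF assms])
  show "continuous_on UNIV (\<lambda>y. fy (a, y))"
    by (rule continuous_on_compose2[OF C1dD(3)[OF assms]]) (auto intro!: continuous_intros)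
qed

lemma C1r_clamp1: "C1r (clamp1 R) (clamp1' R)"
  by (simp add: C1r_def DERIV_clamp1 continuous_on_clamp1')

text \<open>A C^1 substitute for the geometry of the core: \<open>p\<close> replaces the indicator,
  \<open>C\<close> the length of a section to the left of a point, \<open>q\<close> the section
  length and \<open>M\<close> the area below a height. The summand \<open>e\<close> in the bound for
  \<open>M\<close> is the excess area for which the scale must leave room.\<close>

lemma indicator_model:
  fixes Gc :: "(real \<times> real) set"
  assumes Gc: "Gc \<in> sets borel" "Gc \<subseteq> cbox (-b, -b) (b, b)" and b: "0 < b" and e: "0 < e"
  obtains p C Cy q M where
    "C1d C p Cy"
    "\<And>z. z \<in> cbox (-b, -b) (b, b) \<Longrightarrow> 0 \<le> p z"
    "(LINT z:cbox (-b, -b) (b, b)|lborel. \<bar>p z - indicator Gc z\<bar>) < e"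
    "\<And>y. q y = C (b, y)"
    "\<And>y. q y = (LINT x|lborel. indicator {-b..b} x * p (x, y))"
    "\<And>x y. \<bar>x\<bar> \<le> b \<Longrightarrow> \<bar>y\<bar> \<le> b \<Longrightarrow> 0 \<le> C (x, y) \<and> C (x, y) \<le> q y"
    "C1r M q"
    "\<And>y. \<bar>y\<bar> \<le> b \<Longrightarrow> 0 \<le> M y \<and> M y \<le> measure lborel Gc + e"
proof -
  define B where "B = cbox (-b, -b) (b, b)"
  have Bmem: "(x, y) \<in> B \<longleftrightarrow> x \<in> {-b..b} \<and> y \<in> {-b..b}" for x y
    by (auto simp: B_def cbox_Pair_eq)
  obtain p where p: "real_polynomial_function p" "\<And>z. z \<in> B \<Longrightarrow> 0 \<le> p z"
    "(LINT z:B|lborel. \<bar>p z - indicator Gc z\<bar>) < e"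
    using indicator_L1_approx[OF Gc(1) e] unfolding B_def by metis
  obtain C Cy where C: "C1d C p Cy" "\<And>y. C (-b, y) = 0"
    using real_polynomial_function_antiderivative[OF p(1)] by metis
  note cp = C1dD(2)[OF C(1)]
  have [measurable]: "p \<in> borel_measurable borel" by (rule borel_measurable_continuous_onI[OF cp])
  have [measurable]: "Gc \<in> sets borel" "B \<in> sets borel" using Gc by (auto simp: B_def)
  define q where "q y = C (b, y)" for y
  have cpx: "continuous_on UNIV (\<lambda>x. p (x, y))" for y
    by (rule continuous_on_compose2[OF cp]) (auto intro!: continuous_intros)
  have qint: "q y = (LINT x|lborel. indicator {-b..b} x * p (x, y))" for y
  proof -
    have "has_bochner_integral lborel (\<lambda>x. p (x, y) * indicator {-b..b} x) (C (b, y) - C (-b, y))"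
      by (rule has_bochner_integral_FTC_Icc_real)
         (use b cpx[of y] C1d_DERIV_x[OF C(1)] in \<open>auto simp: continuous_on_eq_continuous_at\<close>)
    then show ?thesis by (simp add: q_def C(2) has_bochner_integral_iff mult.commute)
  qed
  have mono: "C (x, y) \<le> C (x', y)" if "-b \<le> x" "x \<le> x'" "x' \<le> b" "\<bar>y\<bar> \<le> b" for x x' y
  proof (rule DERIV_nonneg_imp_nondecreasing[OF that(2)])
    fix t assume "x \<le> t" "t \<le> x'"
    then have "0 \<le> p (t, y)" using that by (intro p(2)) (auto simp: Bmem)
    then show "\<exists>d. ((\<lambda>x. C (x, y)) has_real_derivative d) (at t) \<and> 0 \<le> d"
      using C1d_DERIV_x[OF C(1)] by blast
  qed
  have Cb: "0 \<le> C (x, y) \<and> C (x, y) \<le> q y" if "\<bar>x\<bar> \<le> b" "\<bar>y\<bar> \<le> b" for x y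
    using mono[of "-b" x y] mono[of x b y] that C(2)[of y] by (auto simp: q_def)
  have C1q: "C1r q (\<lambda>y. Cy (b, y))" unfolding q_def[abs_def] by (rule C1r_slice[OF C(1)])
  note cq = C1r_continuous[OF C1q]
  obtain Q where Q: "\<And>y. (Q has_real_derivative q y) (at y)"
    using ex_antiderivative[OF cq] by metis
  define M where "M y = Q y - Q (-b)" for y
  have C1M: "C1r M q"
    unfolding C1r_def M_def using cq[of UNIV] DERIV_diff[OF Q DERIV_const] by auto
  have Mmono: "M y \<le> M y'" if "-b \<le> y" "y \<le> y'" "y' \<le> b" for y y'
  proof (rule DERIV_nonneg_imp_nondecreasing[OF that(2)])
    fix t assume "y \<le> t" "t \<le> y'"
    then have "\<bar>t\<bar> \<le> b" using that by linarith
    then have "0 \<le> q t" using Cb[of b t] b by simp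
    then show "\<exists>d. (M has_real_derivative d) (at t) \<and> 0 \<le> d" using C1rD(1)[OF C1M] by blast
  qed
  have ip: "integrable lborel (\<lambda>z. indicator B z * p z)"
    using borel_integrable_compact[of B p] cp by (auto simp: B_def intro: continuous_on_subset)
  have finG: "emeasure lborel Gc < \<infinity>"
    using emeasure_mono[OF Gc(2), of lborel] by (simp add: le_less_trans emeasure_lborel_cbox_eq)
  then have iG: "integrable lborel (indicator Gc :: _ \<Rightarrow> real)"
    by (intro integrable_real_indicator) auto
  have idiff: "integrable lborel (\<lambda>z. indicator B z * \<bar>p z - indicator Gc z\<bar>)"
    unfolding B_def by (rule integrable_box_error[OF cp Gc(1) finG])
  \<comment> \<open>At the top of the box \<open>M\<close> is the total mass of \<open>p\<close>,
    which exceeds the measure of the core by at most the L^1 error.\<close>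
  have "M b = (LINT z|lborel. indicator B z * p z)"
  proof -
    have "has_bochner_integral lborel (\<lambda>y. q y * indicator {-b..b} y) (M b - M (-b))"
      by (rule has_bochner_integral_FTC_Icc_real)
         (use b cq[of UNIV] C1rD(1)[OF C1M] in \<open>auto simp: continuous_on_eq_continuous_at\<close>)
    then have "M b = (LINT y|lborel. q y * indicator {-b..b} y)"
      by (simp add: M_def has_bochner_integral_iff)
    also have "\<dots> = (LINT y|lborel. LINT x|lborel. indicator B (x, y) * p (x, y))"
    proof (rule Bochner_Integration.integral_cong)
      show "q y * indicator {-b..b} y = (LINT x|lborel. indicator B (x, y) * p (x, y))" for y
        unfolding qint by (cases "y \<in> {-b..b}") (auto simp: indicator_def Bmem)
    qed simp
    also have "\<dots> = (LINT z|lborel. indicator B z * p z)"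
      using lborel_pair.integral_snd[of "\<lambda>x y. indicator B (x, y) * p (x, y)"] ip
      by (simp add: lborel_prod split_beta')
    finally show ?thesis .
  qed
  also have "\<dots> \<le> (LINT z|lborel. indicator Gc z + indicator B z * \<bar>p z - indicator Gc z\<bar>)"
    by (rule integral_mono[OF ip Bochner_Integration.integrable_add[OF iG idiff]])
       (auto simp: indicator_def)
  also have "\<dots> \<le> measure lborel Gc + e"
    using p(3) by (subst Bochner_Integration.integral_add[OF iG idiff]) (simp add: set_lebesgue_integral_def)
  finally have Mb: "M b \<le> measure lborel Gc + e" .
  have Mbd: "0 \<le> M y \<and> M y \<le> measure lborel Gc + e" if "\<bar>y\<bar> \<le> b" for y
  proof -
    have "M (-b) = 0" by (simp add: M_def)
    moreover have "-b \<le> y" "y \<le> b" using that by linarith+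
    ultimately show ?thesis using Mmono[of "-b" y] Mmono[of y b] Mb by linarith
  qed
  show ?thesis
    by (rule that[OF C(1) p(2,3)[unfolded B_def] q_def qint Cb C1M Mbd])
qed

lemma C1d_eq:
  assumes "C1d f fx fy" "\<And>z. f z = g z" "\<And>z. fx z = gx z" "\<And>z. fy z = gy z"
  shows "C1d g gx gy"
proof -
  have "f = g" "fx = gx" "fy = gy" using assms(2-4) by blast+
  with assms(1) show ?thesis by simp
qed

context grushin
begin

text \<open>The field \<open>b\<close> is used for the half-plane part of the competitor and \<open>a\<close> for the whole competitor.
  Near the axis their vertical components tend to \<open>-1\<close> and \<open>0\<close>: so \<open>a\<close> can be glued to its reflected
  counterpart, and the mean of both keeps the Young value \<open>-1/2\<close>.\<close>

lemma lower_fields: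
  fixes G :: "(real \<times> real) set"
  assumes G: "G \<in> sets borel" "\<And>p. p \<in> G \<Longrightarrow> 0 < snd p" "emeasure lborel G = ennreal v"
    and v: "0 < v" and l: "0 < l" and vl: "v < area l" and eps: "0 < eps"
  obtains a1 a2 b1 b2 where "a1 \<in> C1c" "a2 \<in> C1c" "b1 \<in> C1c" "b2 \<in> C1c"
    "\<And>p. (a1 p)\<^sup>2 + (a2 p)\<^sup>2 \<le> 1" "\<And>p. (b1 p)\<^sup>2 + (b2 p)\<^sup>2 \<le> 1"
    "\<And>p. snd p \<le> 0 \<Longrightarrow> a1 p = 0 \<and> a2 p = 0"
    "rate l * v - eps \<le> ((LINT p:G|lborel. gdiv a1 a2 p) + (LINT p:G|lborel. gdiv b1 b2 p)) / 2"
proof -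
  define vmax where "vmax = area l"
  \<comment> \<open>The smoothed enclosed area may exceed \<open>v\<close> but will stay below
    \<open>v1\<close>. On \<open>[0, v1]\<close> the component \<open>S\<close> has a positive
    minimum \<open>s0\<close>, since it degenerates only as the area tends to
    \<open>vmax\<close>.\<close>
  define v1 where "v1 = (v + vmax) / 2"
  have v1: "v < v1" "v1 < vmax" "0 \<le> v1" using v vl by (simp_all add: v1_def vmax_def[symmetric])
  obtain lo N S S' where lo: "lo < 0"
    and NS: "\<And>V. lo < V \<Longrightarrow> V < vmax \<Longrightarrow>
       (N has_real_derivative curvature l (S V)) (at V) \<and>
       (S has_real_derivative S' V) (at V) \<and> 0 < S V \<and> (S V)\<^sup>2 + (N V)\<^sup>2 = 1"
    and cS': "continuous_on {lo<..<vmax} S'"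
    and Nlow: "\<And>V. 0 \<le> V \<Longrightarrow> V < vmax \<Longrightarrow> - 1 / 2 \<le> N V"
    using normal_by_volume[OF l] unfolding vmax_def by metis
  have cS: "continuous_on {lo<..<vmax} S"
    by (intro continuous_at_imp_continuous_on ballI DERIV_isCont) (use NS in auto)
  have NS1: "0 < S V" "S V \<le> 1" "\<bar>N V\<bar> \<le> 1" "(S V)\<^sup>2 + (N V)\<^sup>2 = 1" "- 1 / 2 \<le> N V"
    if "0 \<le> V" "V \<le> v1" for V
  proof -
    have *: "0 < S V" "(S V)\<^sup>2 + (N V)\<^sup>2 = 1" using NS[of V] that lo v1 by auto
    have "(S V)\<^sup>2 \<le> 1\<^sup>2" "(N V)\<^sup>2 \<le> 1\<^sup>2" using *(2) zero_le_power2[of "S V"] zero_le_power2[of "N V"]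
      unfolding one_power2 by linarith+
    then show "0 < S V" "S V \<le> 1" "\<bar>N V\<bar> \<le> 1" "(S V)\<^sup>2 + (N V)\<^sup>2 = 1" "- 1 / 2 \<le> N V"
      using * Nlow[of V] that v1 abs_le_square_iff[of "N V" 1] by (auto intro: power2_le_imp_le)
  qed
  obtain s0 where s0: "0 < s0" "\<And>V. 0 \<le> V \<Longrightarrow> V \<le> v1 \<Longrightarrow> s0 \<le> S V"
  proof -
    have "continuous_on {0..v1} S" by (rule continuous_on_subset[OF cS]) (use lo v1 in auto)
    then obtain V0 where "V0 \<in> {0..v1}" "\<And>V. V \<in> {0..v1} \<Longrightarrow> S V0 \<le> S V"
      using continuous_attains_inf[of "{0..v1}" S] v1 by auto
    then show ?thesis using that[of "S V0"] NS1(1)[of V0] by auto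
  qed
  \<comment> \<open>The loss \<open>eps\<close> is split into quarters: the mass outside the core,
    the regularisation \<open>eta\<close>, the L^1 error \<open>E0\<close>, and the slopes of the
    cut-offs of width \<open>L\<close>.\<close>
  define c where "c = rate l"
  have c: "0 < c" using alpha_nonneg l by (simp add: c_def)
  have mG: "measure lborel G = v" using G(3) v by (simp add: measure_def)
  obtain R where R: "1 \<le> R" "v - eps / (4 * c) < measure lborel (G \<inter> cbox (- R, 1 / R) (R, R))"
    using measure_core_limit[OF G(1,2), of "eps / (4 * c)"] G(3) eps c mG by auto
  define h where "h = 1 / R"
  define b where "b = R + 1"
  define Gc where "Gc = G \<inter> cbox (- R, h) (R, R)"
  define mu where "mu = measure lborel Gc"
  have h: "0 < h" "h \<le> 1" using R(1) by (auto simp: h_def)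
  then have hR: "h \<le> R" using R(1) by linarith
  have [measurable]: "G \<in> sets borel" "Gc \<in> sets borel" using G(1) by (auto simp: Gc_def)
  have core: "(x, y) \<in> Gc \<longleftrightarrow> (x, y) \<in> G \<and> \<bar>x\<bar> \<le> R \<and> h \<le> y \<and> y \<le> R" for x y
    by (auto simp: Gc_def cbox_Pair_eq)
  have mu: "v - eps / (4 * c) < mu" "mu \<le> v" "0 \<le> mu"
  proof -
    show "v - eps / (4 * c) < mu" using R(2) by (simp add: mu_def Gc_def h_def)
    have "G \<in> fmeasurable lborel" using G by (auto simp: fmeasurable_def)
    then show "mu \<le> v" unfolding mG[symmetric] mu_def by (intro measure_mono_fmeasurable) (auto simp: Gc_def)
  qed (simp add: mu_def)
  define eta where "eta = eps / (4 * c * (v + R))"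
  have eta: "0 < eta" "c * (eta * (v + R)) = eps / 4" using eps c v R(1) by (auto simp: eta_def)
  define C0 where "C0 = 4 / eta\<^sup>2 + 2 * U R * curvature l s0"
  have C0: "0 \<le> C0" using l s0 U_nonneg[of R] R(1) by (simp add: C0_def)
  \<comment> \<open>The second bound keeps the smoothed area in \<open>[0, v1]\<close>.\<close>
  define E0 where "E0 = min (eps / (4 * (C0 + 1))) (v1 - v)"
  have E0: "0 < E0" "E0 \<le> v1 - v" "C0 * E0 \<le> eps / 4"
  proof -
    show "0 < E0" "E0 \<le> v1 - v" using eps C0 v1 by (auto simp: E0_def)
    have "C0 * E0 \<le> C0 * (eps / (4 * (C0 + 1)))" using C0 by (intro mult_left_mono) (auto simp: E0_def)
    also have "\<dots> = (C0 / (C0 + 1)) * (eps / 4)" using C0 by (simp add: divide_simps)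
    also have "\<dots> \<le> 1 * (eps / 4)" using C0 eps by (intro mult_right_mono) auto
    finally show "C0 * E0 \<le> eps / 4" by simp
  qed
  have "Gc \<subseteq> cbox (-b, -b) (b, b)"
    using h R(1) by (auto simp: core b_def cbox_Pair_eq)
  moreover have "0 < b" using R(1) by (simp add: b_def)
  ultimately obtain p C Cy q M where C1C: "C1d C p Cy"
    and p0: "\<And>z. z \<in> cbox (-b, -b) (b, b) \<Longrightarrow> 0 \<le> p z"
    and E: "(LINT z:cbox (-b, -b) (b, b)|lborel. \<bar>p z - indicator Gc z\<bar>) < E0"
    and qC: "\<And>y. q y = C (b, y)"
    and qint: "\<And>y. q y = (LINT x|lborel. indicator {-b..b} x * p (x, y))"
    and Cb: "\<And>x y. \<bar>x\<bar> \<le> b \<Longrightarrow> \<bar>y\<bar> \<le> b \<Longrightarrow> 0 \<le> C (x, y) \<and> C (x, y) \<le> q y"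
    and C1M: "C1r M q"
    and Mb: "\<And>y. \<bar>y\<bar> \<le> b \<Longrightarrow> 0 \<le> M y \<and> M y \<le> measure lborel Gc + E0"
    by (rule indicator_model[OF \<open>Gc \<in> sets borel\<close> _ _ E0(1)]) (rule that)
  have C1q: "C1r q (\<lambda>y. Cy (b, y))" unfolding qC[abs_def] by (rule C1r_slice[OF C1C])
  \<comment> \<open>Signs and bounds of \<open>p\<close>, \<open>C\<close>, \<open>q\<close>,
    \<open>M\<close> are known on the box only; clamping both coordinates makes them valid in the
    whole plane and changes nothing on the core.\<close>
  define clamp where "clamp = clamp1 R"
  define clamp' where "clamp' = clamp1' R"
  have zeta: "\<bar>clamp x\<bar> \<le> b" "0 \<le> clamp' x" "\<bar>x\<bar> \<le> R \<Longrightarrow> clamp x = x" "\<bar>x\<bar> \<le> R \<Longrightarrow> clamp' x = 1" for x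
    using clamp1_bounds[of R x] clamp1'_nonneg[of R x] clamp1_id[of x R] R(1) by (auto simp: clamp_def clamp'_def b_def)
  have C1z: "C1r clamp clamp'" unfolding clamp_def clamp'_def by (rule C1r_clamp1)
  define V where "V y = M (clamp y)" for y
  define V' where "V' y = q (clamp y) * clamp' y" for y
  have C1V: "C1r V V'" unfolding V_def[abs_def] V'_def[abs_def] by (rule C1r_compose[OF C1M C1z])
  have Vb: "0 \<le> V y" "V y \<le> v1" "V y \<in> {lo<..<vmax}" for y
    using Mb[OF zeta(1)[of y]] mu(2) E0(2) lo v1 by (auto simp: V_def mu_def)
  have q0: "0 \<le> q (clamp y)" for y using Cb[of b "clamp y"] zeta(1)[of y] \<open>0 < b\<close> by auto
  have V'0: "0 \<le> V' y" for y using q0 zeta(2) by (simp add: V'_def)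
  define k where "k V = curvature l (S V)" for V
  have k0: "0 \<le> k (V y)" for y using l NS1(1)[OF Vb(1,2)] by (simp add: k_def less_imp_le)
  have ck: "continuous_on {lo<..<vmax} k"
  proof -
    have "2 * l\<^sup>2 * W l * (S V * W (S V)) \<noteq> 0" if "V \<in> {lo<..<vmax}" for V
      using NS[of V] that l W_pos[of l] W_pos[of "S V"] by auto
    then show ?thesis unfolding k_def by (intro continuous_intros cS) auto
  qed
  \<comment> \<open>The extremal normal taken where the extremal set encloses the smoothed area that
    the competitor has below \<open>y\<close>.\<close>
  define n1 where "n1 y = S (V y)" for y
  define nu where "nu y = N (V y)" for y
  have C1n1: "C1r n1 (\<lambda>y. S' (V y) * V' y)"
    unfolding C1r_def
  proof (intro conjI allI)
    show "(n1 has_real_derivative S' (V y) * V' y) (at y)" for y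
      unfolding n1_def using NS[of "V y"] Vb(3)[of y] by (intro DERIV_chain2[OF _ C1rD(1)[OF C1V]]) auto
    show "continuous_on UNIV (\<lambda>y. S' (V y) * V' y)"
      by (intro continuous_on_mult C1rD(2)[OF C1V] continuous_on_compose2[OF cS' C1r_continuous[OF C1V]]) (use Vb in auto)
  qed
  have C1nu: "C1r nu (\<lambda>y. k (V y) * V' y)"
    unfolding C1r_def
  proof (intro conjI allI)
    show "(nu has_real_derivative k (V y) * V' y) (at y)" for y
      unfolding nu_def using NS[of "V y"] Vb(3)[of y] by (intro DERIV_chain2[OF _ C1rD(1)[OF C1V]]) (auto simp: k_def)
    show "continuous_on UNIV (\<lambda>y. k (V y) * V' y)"
      by (intro continuous_on_mult C1rD(2)[OF C1V] continuous_on_compose2[OF ck C1r_continuous[OF C1V]]) (use Vb in auto)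
  qed
  have n: "s0 \<le> n1 y" "0 < n1 y" "n1 y \<le> 1" "\<bar>nu y\<bar> \<le> 1" "(n1 y)\<^sup>2 + (nu y)\<^sup>2 = 1" "- 1 / 2 \<le> nu y" for y
    using s0(2)[OF Vb(1,2)] NS1[OF Vb(1,2), of y] by (auto simp: n1_def nu_def)
  define rq where "rq y = inverse (q (clamp y) + eta\<^sup>2)" for y
  have qd: "0 < q (clamp y) + eta\<^sup>2" for y using q0[of y] eta(1) by (simp add: add_nonneg_pos)
  have "\<exists>rq'. C1r rq rq'"
    unfolding rq_def[abs_def]
    by (rule exI, rule C1r_inverse[OF C1r_add[OF C1r_compose[OF C1q C1z] C1r_const[of "eta\<^sup>2"]]])
       (rule less_imp_neq[OF qd, symmetric])
  then obtain rq' where C1rq: "C1r rq rq'" by blast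
  have rq: "0 < rq y" for y using qd by (simp add: rq_def)
  \<comment> \<open>As \<open>C\<close> runs from 0 to \<open>q\<close> across a section,
    \<open>s\<close> runs from nearly -1 to nearly 1, and its \<open>x\<close>-derivative is
    concentrated where \<open>p\<close> is.\<close>
  define s where "s z = (2 * C (clamp (fst z), clamp (snd z)) - q (clamp (snd z))) * rq (snd z)" for z
  define sx where "sx z = 2 * (p (clamp (fst z), clamp (snd z)) * clamp' (fst z)) * rq (snd z)" for z
  obtain sy where C1s: "C1d s sx sy"
  proof -
    have 1: "C1d (\<lambda>z. C (clamp (fst z), clamp (snd z))) (\<lambda>z. p (clamp (fst z), clamp (snd z)) * clamp' (fst z))
        (\<lambda>z. Cy (clamp (fst z), clamp (snd z)) * clamp' (snd z))"
      by (rule C1d_compose[OF C1C C1z C1z])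
    show ?thesis
      by (rule that, rule C1d_eq[OF C1d_mult[OF C1d_diff[OF C1d_mult[OF C1d_const[of 2] 1]
            C1d_snd[OF C1r_compose[OF C1q C1z]]] C1d_snd[OF C1rq]] _ _ refl])
         (simp_all add: s_def sx_def)
  qed
  have sb: "\<bar>s z\<bar> \<le> 1" for z
  proof -
    have "\<bar>2 * C (clamp (fst z), clamp (snd z)) - q (clamp (snd z))\<bar> \<le> q (clamp (snd z)) + eta\<^sup>2"
      using Cb[OF zeta(1)[of "fst z"] zeta(1)[of "snd z"]] zero_le_power2[of eta] by linarith
    then have "\<bar>2 * C (clamp (fst z), clamp (snd z)) - q (clamp (snd z))\<bar> * rq (snd z) \<le> (q (clamp (snd z)) + eta\<^sup>2) * rq (snd z)"
      using rq[of "snd z"] by (intro mult_right_mono) auto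
    also have "\<dots> = 1" using qd[of "snd z"] by (simp add: rq_def)
    finally show ?thesis using rq[of "snd z"] by (simp add: s_def abs_mult)
  qed
  have sx0: "0 \<le> sx z" for z
  proof -
    have "0 \<le> p (clamp (fst z), clamp (snd z))"
      using zeta(1)[of "fst z"] zeta(1)[of "snd z"] by (intro p0) (auto simp: cbox_Pair_eq abs_le_iff minus_le_iff)
    then show ?thesis using rq[of "snd z"] zeta(2) by (simp add: sx_def less_imp_le)
  qed
  define Wb where "Wb = W (R + 1)"
  \<comment> \<open>Cut-off slopes are at most \<open>4 / L\<close>; in the vertical component they
    are multiplied by the weight, which is at most \<open>Wb\<close> where that component
    lives.\<close>
  define L where "L = max 1 (v * (4 + 4 * Wb) * 4 / eps)"
  have Wb: "0 \<le> Wb" by (simp add: Wb_def)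
  have L: "1 \<le> L" "0 < L" "v * (4 / L + Wb * (4 / L)) \<le> eps / 4"
  proof -
    show L1: "1 \<le> L" "0 < L" by (auto simp: L_def)
    have "v * (4 + 4 * Wb) * 4 / eps \<le> L" by (simp add: L_def)
    then have "v * (4 + 4 * Wb) * 4 \<le> L * eps" using eps by (simp add: pos_divide_le_eq)
    then have "v * (4 + 4 * Wb) / L \<le> eps / 4" using L1 by (simp add: pos_divide_le_eq mult.commute)
    then show "v * (4 / L + Wb * (4 / L)) \<le> eps / 4" by (simp add: algebra_simps add_divide_distrib)
  qed
  \<comment> \<open>Switches the extremal normal on between the axis and the lower edge
    \<open>h\<close> of the core.\<close>
  define T where "T y = step ((0 + 1 * y) / h)" for y
  define T' where "T' y = step' ((0 + 1 * y) / h) * (1 / h)" for y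
  have C1T: "C1r T T'" unfolding T_def[abs_def] T'_def[abs_def] by (rule C1r_compose[OF C1r_step C1r_affine])
  have T: "0 \<le> T y" "T y \<le> 1" "0 \<le> T' y" "y \<le> 0 \<Longrightarrow> T y = 0" "h \<le> y \<Longrightarrow> T y = 1" "h \<le> y \<Longrightarrow> T' y = 0" for y
  proof -
    show "0 \<le> T y" "T y \<le> 1" using step_bounds by (auto simp: T_def)
    show "0 \<le> T' y" using step'_bounds h by (simp add: T'_def)
    show "T y = 0" if "y \<le> 0" unfolding T_def by (rule step_0) (use that h in \<open>simp add: divide_nonpos_pos\<close>)
    have "1 \<le> (0 + 1 * y) / h" if "h \<le> y" using that h by (simp add: pos_le_divide_eq)
    then show "T y = 1" "T' y = 0" if "h \<le> y" using that step_1 step'_0 unfolding T_def T'_def by auto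
  qed
  note YL = C1r_cutoff[of R L] cutoff_bounds[of R L] cutoff'_bound[OF L(2), of R] cutoff_inside[OF L(2), of _ R] cutoff_outside[OF L(2), of R]
  define Y where "Y = cutoff R L"
  define Y' where "Y' = cutoff' R L"
  have Y: "C1r Y Y'" "0 \<le> Y x" "Y x \<le> 1" "\<bar>Y' x\<bar> \<le> 4 / L" "\<bar>x\<bar> \<le> R \<Longrightarrow> Y x = 1" "\<bar>x\<bar> \<le> R \<Longrightarrow> Y' x = 0"
      "R + L \<le> \<bar>x\<bar> \<Longrightarrow> Y x = 0" for x
    using YL unfolding Y_def Y'_def by auto
  \<comment> \<open>The divergence contains no \<open>x\<close>-derivative of the vertical
    component, so its cut-off in \<open>x\<close> may have width 1. This bounds the weight by
    \<open>Wb\<close> before \<open>L\<close> is chosen.\<close>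
  define X where "X = cutoff R 1"
  define X' where "X' = cutoff' R 1"
  have X: "C1r X X'" "0 \<le> X x" "X x \<le> 1" "\<bar>x\<bar> \<le> R \<Longrightarrow> X x = 1" "R + 1 \<le> \<bar>x\<bar> \<Longrightarrow> X x = 0" for x
    using C1r_cutoff[of R 1] cutoff_bounds[of R 1] cutoff_inside[of 1 x R] cutoff_outside[of 1 R x]
    unfolding X_def X'_def by auto
  define F1 where "F1 y = Y y * T y * n1 y" for y
  define F2 where "F2 y = Y y * (T y * nu y)" for y
  define F3 where "F3 y = Y y * (T y * nu y - (1 - T y))" for y
  define F2' where "F2' y = Y' y * (T y * nu y) + Y y * (T' y * nu y + T y * (k (V y) * V' y))" for y
  define F3' where "F3' y = Y' y * (T y * nu y - (1 - T y)) + Y y * ((T' y * nu y + T y * (k (V y) * V' y)) - (0 - T' y))" for y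
  have "\<exists>F1'. C1r F1 F1'"
    unfolding F1_def[abs_def] by (rule exI, rule C1r_mult[OF C1r_mult[OF Y(1) C1T] C1n1])
  then obtain F1' where C1F1: "C1r F1 F1'" by blast
  have C1F2: "C1r F2 F2'"
    unfolding F2_def[abs_def] F2'_def[abs_def] by (intro C1r_mult Y(1) C1T C1nu)
  have C1F3: "C1r F3 F3'"
    unfolding F3_def[abs_def] F3'_def[abs_def] by (intro C1r_mult C1r_diff C1r_const Y(1) C1T C1nu)
  define a1 where "a1 z = Y (fst z) * F1 (snd z) * s z" for z
  define a1x where "a1x z = Y' (fst z) * F1 (snd z) * s z + Y (fst z) * F1 (snd z) * sx z" for z
  obtain a1y where C1a1: "C1d a1 a1x a1y"
    by (rule that, rule C1d_eq[OF C1d_mult[OF C1d_mult[OF C1d_fst[OF Y(1)] C1d_snd[OF C1F1]] C1s] _ _ refl])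
       (simp_all add: a1_def a1x_def)
  define a2 where "a2 z = X (fst z) * F2 (snd z)" for z
  define b2 where "b2 z = X (fst z) * F3 (snd z)" for z
  obtain a2x where C1a2: "C1d a2 a2x (\<lambda>z. X (fst z) * F2' (snd z))"
    by (rule that, rule C1d_eq[OF C1d_mult[OF C1d_fst[OF X(1)] C1d_snd[OF C1F2]] _ refl])
       (simp_all add: a2_def)
  obtain b2x where C1b2: "C1d b2 b2x (\<lambda>z. X (fst z) * F3' (snd z))"
    by (rule that, rule C1d_eq[OF C1d_mult[OF C1d_fst[OF X(1)] C1d_snd[OF C1F3]] _ refl])
       (simp_all add: b2_def)
  have F0: "F1 y = 0" "F2 y = 0" "F3 y = 0" if "\<bar>y\<bar> > R + L" for y
    using Y(7)[of y] that by (auto simp: F1_def F2_def F3_def)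
  have C1c: "a1 \<in> C1c" "a2 \<in> C1c" "b2 \<in> C1c"
  proof -
    have *: "\<bar>x\<bar> \<le> R + L" if "Y x \<noteq> 0" for x using Y(7)[of x] that by linarith
    have **: "\<bar>x\<bar> \<le> R + L" if "X x \<noteq> 0" for x using X(5)[of x] L(1) that by linarith
    have ***: "\<bar>y\<bar> \<le> R + L" if "F1 y \<noteq> 0 \<or> F2 y \<noteq> 0 \<or> F3 y \<noteq> 0" for y using F0[of y] that by linarith
    show "a1 \<in> C1c" by (rule C1d_imp_C1c[OF C1a1, of "R + L"]) (auto simp: a1_def intro: * ***)
    show "a2 \<in> C1c" by (rule C1d_imp_C1c[OF C1a2, of "R + L"]) (auto simp: a2_def intro: ** ***)
    show "b2 \<in> C1c" by (rule C1d_imp_C1c[OF C1b2, of "R + L"]) (auto simp: b2_def intro: ** ***)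
  qed
  have na1: "(a1 z)\<^sup>2 \<le> (T (snd z) * n1 (snd z))\<^sup>2" for z
  proof -
    have "\<bar>a1 z\<bar> = (T (snd z) * n1 (snd z)) * (Y (fst z) * Y (snd z) * \<bar>s z\<bar>)"
      using Y(2) T(1) n(2) by (simp add: a1_def F1_def abs_mult less_imp_le)
    also have "\<dots> \<le> (T (snd z) * n1 (snd z)) * 1"
      using Y(2,3) T(1) n(2) sb[of z] by (intro mult_left_mono mult_le_one) (auto simp: less_imp_le)
    finally show ?thesis using abs_le_square_iff[of "a1 z" "T (snd z) * n1 (snd z)"] T(1) n(2)
      by (simp add: abs_mult less_imp_le)
  qed
  have XY: "\<bar>X x * (Y y * t)\<bar> \<le> \<bar>t\<bar>" for x y t
  proof -
    have "X x * Y y * \<bar>t\<bar> \<le> 1 * \<bar>t\<bar>" using X(2,3) Y(2,3) by (intro mult_right_mono mult_le_one) auto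
    then show ?thesis using X(2) Y(2) by (simp add: abs_mult mult.assoc)
  qed
  have norm_a: "(a1 z)\<^sup>2 + (a2 z)\<^sup>2 \<le> 1" for z
  proof -
    let ?y = "snd z"
    have "(a2 z)\<^sup>2 \<le> (T ?y * nu ?y)\<^sup>2"
      using XY[of "fst z" ?y "T ?y * nu ?y"] by (simp add: a2_def F2_def abs_le_square_iff)
    with na1[of z] have "(a1 z)\<^sup>2 + (a2 z)\<^sup>2 \<le> (T ?y)\<^sup>2 * ((n1 ?y)\<^sup>2 + (nu ?y)\<^sup>2)"
      by (simp add: power_mult_distrib algebra_simps)
    also have "\<dots> \<le> 1" using T(1,2) by (simp add: n(5) power_le_one)
    finally show ?thesis .
  qed
  \<comment> \<open>Apart from factors of modulus at most 1 in each component, the field is the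
    convex combination of the unit vectors \<open>(n1, nu)\<close> and \<open>(0, -1)\<close> with
    weights \<open>T\<close> and \<open>1 - T\<close>.\<close>
  have norm_b: "(a1 z)\<^sup>2 + (b2 z)\<^sup>2 \<le> 1" for z
  proof -
    let ?y = "snd z"
    have "(b2 z)\<^sup>2 \<le> (T ?y * nu ?y - (1 - T ?y))\<^sup>2"
      using XY[of "fst z" ?y "T ?y * nu ?y - (1 - T ?y)"] by (simp add: b2_def F3_def abs_le_square_iff)
    with na1[of z] have "(a1 z)\<^sup>2 + (b2 z)\<^sup>2 \<le> (T ?y)\<^sup>2 * ((n1 ?y)\<^sup>2 + (nu ?y)\<^sup>2) - 2 * (T ?y * (1 - T ?y)) * nu ?y + (1 - T ?y)\<^sup>2"
      by (simp add: power_mult_distrib power2_eq_square algebra_simps)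
    also have "\<dots> \<le> (T ?y)\<^sup>2 + 2 * (T ?y * (1 - T ?y)) * 1 + (1 - T ?y)\<^sup>2"
    proof -
      have "2 * (T ?y * (1 - T ?y)) * (- nu ?y) \<le> 2 * (T ?y * (1 - T ?y)) * 1"
        using T(1,2) n(4)[of ?y] by (intro mult_left_mono) auto
      then show ?thesis by (simp add: n(5))
    qed
    also have "\<dots> = 1" by (simp add: power2_eq_square algebra_simps)
    finally show ?thesis .
  qed
  define D where "D z = (gdiv a1 a2 z + gdiv a1 b2 z) / 2" for z
  have D: "D z = a1x z + W (fst z) * (X (fst z) * ((F2' (snd z) + F3' (snd z)) / 2))" for z
    unfolding D_def gdiv_def C1d_partial[OF C1a1] C1d_partial[OF C1a2] C1d_partial[OF C1b2]
    by (simp add: field_simps)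
  \<comment> \<open>In the mean of both fields the slope \<open>T'\<close> is multiplied by
    \<open>nu + 1 / 2\<close>, which Young's value makes nonnegative; for the first field alone the
    factor would be \<open>nu\<close>, of no definite sign.\<close>
  have F23: "(F2' y + F3' y) / 2 = Y' y * (T y * nu y - (1 - T y) / 2)
      + Y y * (T' y * (nu y + 1 / 2) + T y * (k (V y) * V' y))" for y
    by (simp add: F2'_def F3'_def field_simps)
  define D0 where "D0 z = 2 * n1 (snd z) / (q (snd z) + eta\<^sup>2) * p z
        + W (fst z) * (q (snd z) * curvature l (n1 (snd z)))" for z
  have Dcore: "D (x, y) = D0 (x, y)" if "(x, y) \<in> Gc" for x y
  proof -
    have xy: "\<bar>x\<bar> \<le> R" "h \<le> y" "\<bar>y\<bar> \<le> R" using that h by (auto simp: core)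
    have v: "Y x = 1" "Y' x = 0" "Y y = 1" "Y' y = 0" "X x = 1" "T y = 1" "T' y = 0"
      "clamp x = x" "clamp y = y" "clamp' x = 1" "clamp' y = 1"
      using xy Y(5,6) X(4) T(5,6) zeta(3,4) by blast+
    have k: "k (V y) = curvature l (n1 y)" by (simp only: k_def n1_def)
    have t: "0 * A + 1 * (1 * 1 * n) * (2 * (P * 1) * inverse Q) + w * (1 * (0 * N + 1 * (0 * N' + 1 * (kk * (qq * 1)))))
      = 2 * n / Q * P + w * (qq * kk)" for A n P Q w N N' kk qq :: real
      by (simp add: divide_inverse)
    have "D (x, y) = 0 * ((1 * 1 * n1 y) * s (x, y)) + 1 * (1 * 1 * n1 y) * (2 * (p (x, y) * 1) * inverse (q y + eta\<^sup>2))
        + W x * (1 * (0 * (1 * nu y - (1 - 1) / 2) + 1 * (0 * (nu y + 1 / 2) + 1 * (k (V y) * (q y * 1)))))"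
      unfolding D F23 a1x_def sx_def rq_def V'_def fst_conv snd_conv F1_def v by (simp only: mult.assoc)
    then show ?thesis
      unfolding D0_def fst_conv snd_conv k[symmetric] t .
  qed
  define kap where "kap = 4 / L + Wb * (4 / L)"
  \<comment> \<open>Only the slopes of the outer cut-offs can contribute negatively; the terms with
    \<open>sx\<close>, \<open>T'\<close> and the curvature are nonnegative. Hence the part of
    \<open>G\<close> outside the core costs at most \<open>kap * v\<close>.\<close>
  have Dlow: "- kap \<le> D (x, y)" if "0 < y" for x y
  proof -
    have F1: "0 \<le> F1 y" "F1 y \<le> 1"
      using Y(2,3) T(1,2) n(2,3) by (auto simp: F1_def less_imp_le intro!: mult_le_one)
    have 1: "- (4 / L) \<le> Y' x * F1 y * s (x, y)"
    proof -
      have "\<bar>Y' x * F1 y * s (x, y)\<bar> \<le> 4 / L * 1 * 1"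
        unfolding abs_mult using Y(4) F1 sb L by (intro mult_mono) auto
      then show ?thesis by linarith
    qed
    have 2: "0 \<le> Y x * F1 y * sx (x, y)" using Y(2) F1 sx0 by simp
    have t: "\<bar>T y * nu y - (1 - T y) / 2\<bar> \<le> 1"
    proof -
      have "\<bar>T y * nu y\<bar> \<le> T y * 1" using mult_left_mono[OF n(4)[of y] T(1)[of y]] T(1)[of y] by (simp add: abs_mult)
      then have "T y * nu y \<le> T y" "- T y \<le> T y * nu y" by (simp_all only: abs_le_iff mult_1_right) linarith
      moreover have "\<bar>u - (1 - t) / 2\<bar> \<le> 1" if "u \<le> t" "- t \<le> u" "t \<le> 1" for t u :: real
        using that by (simp add: abs_le_iff field_simps)
      ultimately show ?thesis using T(2)[of y] by blast
    qed
    have 3: "- (Wb * (4 / L)) \<le> W x * X x * (Y' y * (T y * nu y - (1 - T y) / 2))"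
    proof -
      have a: "W x * X x \<le> Wb"
      proof (cases "R + 1 \<le> \<bar>x\<bar>")
        case True then show ?thesis using X(5) Wb by simp
      next
        case False
        then have "W x \<le> Wb" unfolding Wb_def using R(1) by (intro W_mono) auto
        then have "W x * X x \<le> Wb * 1" using X(2,3) Wb by (intro mult_mono) auto
        then show ?thesis by simp
      qed
      have "\<bar>W x * X x * (Y' y * (T y * nu y - (1 - T y) / 2))\<bar> \<le> Wb * (4 / L * 1)"
        unfolding abs_mult[of "W x * X x"] abs_mult[of "Y' y"]
        using a X(2) Y(4) t L Wb by (intro mult_mono) (auto simp: abs_mult)
      then show ?thesis by linarith
    qed
    have 4: "0 \<le> W x * X x * (Y y * (T' y * (nu y + 1 / 2) + T y * (k (V y) * V' y)))"
    proof -
      have "0 \<le> nu y + 1 / 2" using n(6)[of y] by linarith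
      with T(3) have "0 \<le> T' y * (nu y + 1 / 2)" by (intro mult_nonneg_nonneg)
      moreover have "0 \<le> T y * (k (V y) * V' y)"
        by (intro mult_nonneg_nonneg T(1) k0 V'0)
      ultimately have "0 \<le> T' y * (nu y + 1 / 2) + T y * (k (V y) * V' y)"
        by (rule add_nonneg_nonneg)
      then show ?thesis
        by (rule mult_nonneg_nonneg[OF mult_nonneg_nonneg[OF W_nonneg X(2)] mult_nonneg_nonneg[OF Y(2)]])
    qed
    have "D (x, y) = (Y' x * F1 y * s (x, y) + Y x * F1 y * sx (x, y)) + (W x * X x * (Y' y * (T y * nu y - (1 - T y) / 2))
        + W x * X x * (Y y * (T' y * (nu y + 1 / 2) + T y * (k (V y) * V' y))))"
      unfolding D F23 a1x_def by (simp add: algebra_simps)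
    then show ?thesis using 1 2 3 4 by (simp add: kap_def)
  qed
  have kap: "0 \<le> kap" using L Wb by (simp add: kap_def)
  have iD: "integrable lborel (\<lambda>z. indicator G z * D z)"
    unfolding D_def
    using set_integrable_gdiv[OF C1c(1,2) G(1)] set_integrable_gdiv[OF C1c(1,3) G(1)]
    by (auto simp: set_integrable_def algebra_simps add_divide_distrib intro!: Bochner_Integration.integrable_add)
  have eqGc: "indicator Gc z * (indicator G z * D z) = indicator Gc z * D0 z" for z
    using Dcore by (cases z) (auto simp: indicator_def core)
  have iD0: "integrable lborel (\<lambda>z. indicator Gc z * D0 z)"
  proof -
    have "integrable lborel (\<lambda>z. (indicator G z * D z) * indicator Gc z)"
      by (rule integrable_real_mult_indicator[OF _ iD]) simp
    moreover have "(\<lambda>z. (indicator G z * D z) * indicator Gc z) = (\<lambda>z. indicator Gc z * D0 z)"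
      by (rule ext) (metis eqGc mult.commute)
    ultimately show ?thesis by metis
  qed
  have iG: "integrable lborel (indicator G :: _ \<Rightarrow> real)"
    using G by (intro integrable_real_indicator) auto
  have "(LINT z|lborel. indicator Gc z * D0 z - kap * indicator G z) \<le> (LINT z|lborel. indicator G z * D z)"
  proof (rule integral_mono[OF Bochner_Integration.integrable_diff[OF iD0 integrable_mult_right[OF iG]] iD])
    show "indicator Gc z * D0 z - kap * indicator G z \<le> indicator G z * D z" for z
    proof -
      obtain x y where z: "z = (x, y)" by (cases z)
      show ?thesis
        using Dlow[of y x] G(2)[of z] Dcore[of x y] core[of x y] kap
        by (auto simp: indicator_def z)
    qed
  qed
  also have "(LINT z|lborel. indicator Gc z * D0 z - kap * indicator G z) = (LINT z|lborel. indicator Gc z * D0 z) - kap * v"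
    by (subst Bochner_Integration.integral_diff[OF iD0 integrable_mult_right[OF iG]]) (simp add: mG)
  finally have 1: "(LINT z|lborel. indicator Gc z * D0 z) - kap * v \<le> (LINT z|lborel. indicator G z * D z)" .
  have 2: "c * (mu / (1 + eta) - eta * R) - C0 * (LINT z:cbox (-b, -b) (b, b)|lborel. \<bar>p z - indicator Gc z\<bar>)
      \<le> (LINT z|lborel. indicator Gc z * D0 z)"
    unfolding c_def C0_def mu_def D0_def
  proof (rule core_bound[OF l s0(1) eta(1), where h=h])
    show "continuous_on UNIV p" by (rule C1dD(2)[OF C1C])
    show "integrable lborel (\<lambda>z. indicator Gc z * (2 * n1 (snd z) / (q (snd z) + eta\<^sup>2) * p z
        + W (fst z) * (q (snd z) * curvature l (n1 (snd z)))))"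
      using iD0 unfolding D0_def .
  qed (use h hR R(1) core p0 qint n in \<open>auto simp: b_def\<close>)
  have 3: "C0 * (LINT z:cbox (-b, -b) (b, b)|lborel. \<bar>p z - indicator Gc z\<bar>) \<le> eps / 4"
    using mult_left_mono[OF less_imp_le[OF E] C0] E0(3) by linarith
  have 4: "c * v - eps / 4 - eps / 4 \<le> c * (mu / (1 + eta) - eta * R)"
  proof -
    have "mu * (1 - eta * eta) \<le> mu * 1" using mu(3) by (intro mult_left_mono) auto
    then have "(mu - mu * eta) * (1 + eta) \<le> mu" by (simp add: algebra_simps)
    then have "mu - mu * eta \<le> mu / (1 + eta)" using eta(1) by (simp add: pos_le_divide_eq)
    moreover have "mu * eta \<le> v * eta" using mu eta(1) by (intro mult_right_mono) auto
    ultimately have "c * (mu - eta * (v + R)) \<le> c * (mu / (1 + eta) - eta * R)"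
      using c by (intro mult_left_mono) (auto simp: algebra_simps)
    moreover have "c * (v - eps / (4 * c)) \<le> c * mu" using mu(1) c by (intro mult_left_mono) auto
    moreover have "c * (v - eps / (4 * c)) = c * v - eps / 4" using c by (simp add: field_simps)
    ultimately show ?thesis using eta(2) by (simp add: right_diff_distrib)
  qed
  have 5: "kap * v \<le> eps / 4" using L(3) by (simp add: kap_def mult.commute)
  have 6: "(LINT z|lborel. indicator G z * D z) = ((LINT p:G|lborel. gdiv a1 a2 p) + (LINT p:G|lborel. gdiv a1 b2 p)) / 2"
  proof -
    note i = set_integrable_gdiv[OF C1c(1,2) G(1)] set_integrable_gdiv[OF C1c(1,3) G(1)]
    have "(LINT z:G|lborel. gdiv a1 a2 z + gdiv a1 b2 z) / 2 = (LINT z|lborel. indicator G z * D z)"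
      unfolding D_def set_lebesgue_integral_def by (simp flip: integral_divide_zero)
    then show ?thesis using set_integral_add(2)[OF i] by simp
  qed
  show ?thesis
  proof (rule that[OF C1c(1,2,1,3) norm_a norm_b])
    show "a1 z = 0 \<and> a2 z = 0" if "snd z \<le> 0" for z
      using T(4)[OF that] by (simp add: a1_def a2_def F1_def F2_def)
    show "rate l * v - eps \<le> ((LINT p:G|lborel. gdiv a1 a2 p) + (LINT p:G|lborel. gdiv a1 b2 p)) / 2"
      using 1 2 3 4 5 unfolding 6[symmetric] c_def[symmetric] by linarith
  qed
qed

end

section \<open>Gluing the fields of both half planes and the lower bound\<close>

lemma C1c_reflect: "f \<in> C1c \<Longrightarrow> (\<lambda>z. f (reflect z)) \<in> C1c"
  and C1c_minus: "f \<in> C1c \<Longrightarrow> (\<lambda>z. - f z) \<in> C1c"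
  and C1c_add: "f \<in> C1c \<Longrightarrow> g \<in> C1c \<Longrightarrow> (\<lambda>z. f z + g z) \<in> C1c"
proof -
  have box: "p \<in> cbox (-B, -B) (B, B) \<longleftrightarrow> \<bar>fst p\<bar> \<le> B \<and> \<bar>snd p\<bar> \<le> B" for p :: "real \<times> real" and B
    by (cases p) (auto simp: cbox_Pair_eq)
  have supp: "\<exists>B. \<forall>p. f p \<noteq> 0 \<longrightarrow> \<bar>fst p\<bar> \<le> B \<and> \<bar>snd p\<bar> \<le> B" if f: "f \<in> C1c" for f
    by (rule C1c_support[OF f]) (metis box)
  show "(\<lambda>z. f (reflect z)) \<in> C1c" if f: "f \<in> C1c"
  proof -
    obtain B where B: "\<And>p. f p \<noteq> 0 \<Longrightarrow> \<bar>fst p\<bar> \<le> B \<and> \<bar>snd p\<bar> \<le> B" using supp[OF f] by blast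
    show ?thesis
      by (rule C1d_imp_C1c[OF C1d_reflect[OF C1c_imp_C1d[OF f]], of B]) (use B in \<open>force dest: B\<close>)
  qed
  show "(\<lambda>z. - f z) \<in> C1c" if f: "f \<in> C1c"
  proof -
    obtain B where B: "\<And>p. f p \<noteq> 0 \<Longrightarrow> \<bar>fst p\<bar> \<le> B \<and> \<bar>snd p\<bar> \<le> B" using supp[OF f] by blast
    have "C1d (\<lambda>z. 0 - f z) (\<lambda>z. 0 - partial_x f z) (\<lambda>z. 0 - partial_y f z)"
      by (intro C1d_diff C1d_const C1c_imp_C1d f)
    then have "(\<lambda>z. 0 - f z) \<in> C1c" by (rule C1d_imp_C1c[of _ _ _ B]) (use B in auto)
    then show ?thesis by simp
  qed
  show "(\<lambda>z. f z + g z) \<in> C1c" if f: "f \<in> C1c" and g: "g \<in> C1c"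
  proof -
    obtain B where B: "\<And>p. f p \<noteq> 0 \<Longrightarrow> \<bar>fst p\<bar> \<le> B \<and> \<bar>snd p\<bar> \<le> B" using supp[OF f] by blast
    obtain B' where B': "\<And>p. g p \<noteq> 0 \<Longrightarrow> \<bar>fst p\<bar> \<le> B' \<and> \<bar>snd p\<bar> \<le> B'" using supp[OF g] by blast
    show ?thesis
    proof (rule C1d_imp_C1c[OF C1d_add[OF C1c_imp_C1d[OF f] C1c_imp_C1d[OF g]], of "max B B'"])
      fix p assume "f p + g p \<noteq> 0"
      then have "f p \<noteq> 0 \<or> g p \<noteq> 0" by auto
      then show "\<bar>fst p\<bar> \<le> max B B' \<and> \<bar>snd p\<bar> \<le> max B B'" using B[of p] B'[of p] by auto
    qed
  qed
qed

lemma C1d_minus: "C1d f fx fy \<Longrightarrow> C1d (\<lambda>z. - f z) (\<lambda>z. - fx z) (\<lambda>z. - fy z)"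
  using C1d_diff[OF C1d_const[of 0]] by fastforce

lemma x_axis_null: "{p :: real \<times> real. snd p = 0} \<in> null_sets lebesgue"
proof -
  have "negligible {p :: real \<times> real. (0, 1) \<bullet> p = 0}"
    by (rule negligible_hyperplane) (auto simp: zero_prod_def)
  moreover have "{p :: real \<times> real. (0, 1) \<bullet> p = 0} = {p. snd p = 0}" by (auto simp: inner_prod_def)
  ultimately show ?thesis by (simp add: negligible_iff_null_sets)
qed

lemma half_plane_measurable [measurable]:
  "{p :: real \<times> real. 0 < snd p} \<in> sets borel" "{p :: real \<times> real. snd p < 0} \<in> sets borel"
  by (auto intro!: borel_open open_Collect_less continuous_intros)

lemma upper_part_eq: "upper_part E = E \<inter> {p. 0 < snd p}"
  by (auto simp: upper_part_def)

lemma lower_part_eq: "lower_part E = E \<inter> {p. snd p < 0}"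
  by (auto simp: lower_part_def)

lemma sym_diff_null_subset:
  assumes "N \<in> null_sets lebesgue" "sym_diff A B \<subseteq> N"
  shows "sym_diff A B \<in> null_sets lebesgue"
  using null_sets_completion_subset[OF assms(2,1)] .

context grushin
begin

lemma gdiv_add:
  assumes "f1 \<in> C1c" "f2 \<in> C1c" "g1 \<in> C1c" "g2 \<in> C1c"
  shows "gdiv (\<lambda>z. f1 z + g1 z) (\<lambda>z. f2 z + g2 z) p = gdiv f1 f2 p + gdiv g1 g2 p"
  unfolding gdiv_def
    C1d_partial[OF C1d_add[OF C1c_imp_C1d[OF assms(1)] C1c_imp_C1d[OF assms(3)]]]
    C1d_partial[OF C1d_add[OF C1c_imp_C1d[OF assms(2)] C1c_imp_C1d[OF assms(4)]]]
  by (simp add: algebra_simps)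

lemma gdiv_reflect:
  assumes "f1 \<in> C1c" "f2 \<in> C1c"
  shows "gdiv (\<lambda>z. f1 (reflect z)) (\<lambda>z. - f2 (reflect z)) p = gdiv f1 f2 (reflect p)"
  unfolding gdiv_def
    C1d_partial[OF C1d_reflect[OF C1c_imp_C1d[OF assms(1)]]]
    C1d_partial[OF C1d_minus[OF C1d_reflect[OF C1c_imp_C1d[OF assms(2)]]]]
  by simp

lemma gdiv_vanish:
  assumes "f1 \<in> C1c" "f2 \<in> C1c" "open S" "p \<in> S" "\<And>q. q \<in> S \<Longrightarrow> f1 q = 0 \<and> f2 q = 0"
  shows "gdiv f1 f2 p = 0"
  unfolding gdiv_def
  using C1d_vanish_open[OF C1c_imp_C1d[OF assms(1)] assms(3,4)]
    C1d_vanish_open[OF C1c_imp_C1d[OF assms(2)] assms(3,4)] assms(5) by auto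

text \<open>The competitor need not be symmetric, so each half has its own pair of fields. The
  \<open>b\<close> fields test the two halves; the \<open>a\<close> fields, which vanish on and
  beyond the axis, are added up to test the whole set. Each half then contributes the mean estimated
  in \<open>lower_fields\<close>, twice and with the factor 1/2 of the energy.\<close>

lemma partition_lower_eps:
  assumes F: "F \<in> admissible_y v" and v: "0 < v" and l: "0 < l" "v < area l"
    and eps: "0 < eps"
  shows "ereal (2 * (rate l * v - eps)) \<le> partition_perimeter \<alpha> F"
proof -
  have Fm: "F \<in> sets lebesgue" and Fv: "emeasure lebesgue (upper_part F) = ennreal v" "emeasure lebesgue (lower_part F) = ennreal v"
    using F by (auto simp: admissible_y_def)
  obtain G where G: "G \<in> sets borel" "G \<subseteq> F" "F - G \<in> null_sets lebesgue"
    by (rule lebesgue_borel_subset[OF Fm])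
  define Gp where "Gp = G \<inter> {p. 0 < snd p}"
  define Gm where "Gm = G \<inter> {p. snd p < 0}"
  have [measurable]: "Gp \<in> sets borel" "Gm \<in> sets borel" using G(1) unfolding Gp_def Gm_def by measurable
  have hl: "{p :: real \<times> real. 0 < snd p} \<in> sets lebesgue" "{p :: real \<times> real. snd p < 0} \<in> sets lebesgue"
    using half_plane_measurable by auto
  have Um: "upper_part F \<in> sets lebesgue" "lower_part F \<in> sets lebesgue"
    unfolding upper_part_eq lower_part_eq by (intro sets.Int Fm hl)+
  have Up: "sym_diff (upper_part F) Gp \<in> null_sets lebesgue"
    by (rule sym_diff_null_subset[OF G(3)]) (use G(2) in \<open>auto simp: upper_part_eq Gp_def\<close>)
  have Lp: "sym_diff (lower_part F) Gm \<in> null_sets lebesgue"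
    by (rule sym_diff_null_subset[OF G(3)]) (use G(2) in \<open>auto simp: lower_part_eq Gm_def\<close>)
  have Fp: "sym_diff F (Gp \<union> Gm) \<in> null_sets lebesgue"
  proof (rule sym_diff_null_subset[OF null_sets.Un[OF G(3) x_axis_null]])
    show "sym_diff F (Gp \<union> Gm) \<subseteq> (F - G) \<union> {p. snd p = 0}"
      using G(2) by (auto simp: Gp_def Gm_def) 
  qed
  have sd: "emeasure lebesgue A = emeasure lebesgue B"
    if "A \<in> sets lebesgue" "B \<in> sets lebesgue" "sym_diff A B \<in> null_sets lebesgue" for A B :: "(real \<times> real) set"
  proof (rule emeasure_eq_AE[OF _ that(1,2)])
    show "AE x in lebesgue. x \<in> A \<longleftrightarrow> x \<in> B"
      using AE_not_in[OF that(3)] by eventually_elim auto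
  qed
  have eGp: "emeasure lborel Gp = ennreal v"
    using sd[OF Um(1) _ Up] Fv by simp
  \<comment> \<open>The lower half is moved to the upper half plane, where the fields are
    constructed; they are reflected back with the sign of the vertical component reversed.\<close>
  define H where "H = reflect -` Gm"
  have H: "H \<in> sets borel" unfolding H_def by measurable
  have eH: "emeasure lborel H = ennreal v"
    using sd[OF Um(2) _ Lp] Fv by (simp add: H_def emeasure_reflect)
  have Gm_H: "Gm = reflect -` H" by (auto simp: H_def vimage_def)
  obtain a1 a2 b1 b2 where a: "a1 \<in> C1c" "a2 \<in> C1c" "b1 \<in> C1c" "b2 \<in> C1c"
    "\<And>p. (a1 p)\<^sup>2 + (a2 p)\<^sup>2 \<le> 1" "\<And>p. (b1 p)\<^sup>2 + (b2 p)\<^sup>2 \<le> 1"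
    "\<And>p. snd p \<le> 0 \<Longrightarrow> a1 p = 0 \<and> a2 p = 0"
    "rate l * v - eps \<le> ((LINT p:Gp|lborel. gdiv a1 a2 p) + (LINT p:Gp|lborel. gdiv b1 b2 p)) / 2"
    by (rule lower_fields[OF _ _ eGp v l eps]) (auto simp: Gp_def G(1))
  obtain c1 c2 d1 d2 where c: "c1 \<in> C1c" "c2 \<in> C1c" "d1 \<in> C1c" "d2 \<in> C1c"
    "\<And>p. (c1 p)\<^sup>2 + (c2 p)\<^sup>2 \<le> 1" "\<And>p. (d1 p)\<^sup>2 + (d2 p)\<^sup>2 \<le> 1"
    "\<And>p. snd p \<le> 0 \<Longrightarrow> c1 p = 0 \<and> c2 p = 0"
    "rate l * v - eps \<le> ((LINT p:H|lborel. gdiv c1 c2 p) + (LINT p:H|lborel. gdiv d1 d2 p)) / 2"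
    by (rule lower_fields[OF H _ eH v l eps]) (auto simp: H_def Gm_def)
  define c1' c2' d1' d2' where "c1' z = c1 (reflect z)" and "c2' z = - c2 (reflect z)"
    and "d1' z = d1 (reflect z)" and "d2' z = - d2 (reflect z)" for z
  have C': "c1' \<in> C1c" "c2' \<in> C1c" "d1' \<in> C1c" "d2' \<in> C1c"
    unfolding c1'_def[abs_def] c2'_def[abs_def] d1'_def[abs_def] d2'_def[abs_def]
    by (intro C1c_reflect C1c_minus c)+
  have gc: "gdiv c1' c2' z = gdiv c1 c2 (reflect z)" for z
    unfolding c1'_def[abs_def] c2'_def[abs_def] by (rule gdiv_reflect[OF c(1,2)])
  have gd: "gdiv d1' d2' z = gdiv d1 d2 (reflect z)" for z
    unfolding d1'_def[abs_def] d2'_def[abs_def] by (rule gdiv_reflect[OF c(3,4)])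
  have ic: "(LINT z:Gm|lborel. gdiv c1' c2' z) = (LINT z:H|lborel. gdiv c1 c2 z)"
    unfolding Gm_H by (subst set_integral_reflect[OF borel_measurable_gdiv[OF C'(1,2)] H]) (simp add: gc)
  have id: "(LINT z:Gm|lborel. gdiv d1' d2' z) = (LINT z:H|lborel. gdiv d1 d2 z)"
    unfolding Gm_H by (subst set_integral_reflect[OF borel_measurable_gdiv[OF C'(3,4)] H]) (simp add: gd)
  \<comment> \<open>At every point one of the two fields is zero, so the sum still has norm at most
    1.\<close>
  define e1 e2 where "e1 z = a1 z + c1' z" and "e2 z = a2 z + c2' z" for z
  have e: "e1 \<in> C1c" "e2 \<in> C1c"
    unfolding e1_def[abs_def] e2_def[abs_def] by (intro C1c_add a C')+
  have c0: "c1' z = 0 \<and> c2' z = 0" if "0 \<le> snd z" for z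
    using c(7)[of "reflect z"] that by (simp add: c1'_def c2'_def)
  have en: "(e1 z)\<^sup>2 + (e2 z)\<^sup>2 \<le> 1" for z
    using a(5)[of z] c(5)[of "reflect z"] a(7)[of z] c0[of z]
    by (cases "0 \<le> snd z") (auto simp: e1_def e2_def c1'_def c2'_def)
  have "(LINT z:Gp \<union> Gm|lborel. gdiv e1 e2 z) = (LINT z:Gp|lborel. gdiv e1 e2 z) + (LINT z:Gm|lborel. gdiv e1 e2 z)"
    by (rule set_integral_Un) (auto simp: Gp_def Gm_def G(1) intro!: set_integrable_gdiv e)
  also have "(LINT z:Gp|lborel. gdiv e1 e2 z) = (LINT z:Gp|lborel. gdiv a1 a2 z)"
  proof (rule set_lebesgue_integral_cong)
    show "\<forall>z. z \<in> Gp \<longrightarrow> gdiv e1 e2 z = gdiv a1 a2 z"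
    proof (intro allI impI)
      fix z assume "z \<in> Gp"
      then have "gdiv c1' c2' z = 0"
        by (intro gdiv_vanish[OF C'(1,2), of "{z. 0 < snd z}"])
           (auto simp: Gp_def c0 intro!: open_Collect_less continuous_intros)
      then show "gdiv e1 e2 z = gdiv a1 a2 z"
        unfolding e1_def[abs_def] e2_def[abs_def] by (simp add: gdiv_add[OF a(1,2) C'(1,2)])
    qed
  qed simp
  also have "(LINT z:Gm|lborel. gdiv e1 e2 z) = (LINT z:Gm|lborel. gdiv c1' c2' z)"
  proof (rule set_lebesgue_integral_cong)
    show "\<forall>z. z \<in> Gm \<longrightarrow> gdiv e1 e2 z = gdiv c1' c2' z"
    proof (intro allI impI)
      fix z assume "z \<in> Gm"
      then have "gdiv a1 a2 z = 0"
        by (intro gdiv_vanish[OF a(1,2), of "{z. snd z < 0}"])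
           (auto simp: Gm_def a(7) intro!: open_Collect_less continuous_intros)
      then show "gdiv e1 e2 z = gdiv c1' c2' z"
        unfolding e1_def[abs_def] e2_def[abs_def] by (simp add: gdiv_add[OF a(1,2) C'(1,2)])
    qed
  qed simp
  finally have ie: "(LINT z:Gp \<union> Gm|lborel. gdiv e1 e2 z) = (LINT z:Gp|lborel. gdiv a1 a2 z) + (LINT z:H|lborel. gdiv c1 c2 z)"
    by (simp only: ic)
  define x where "x = (LINT z:Gp|lborel. gdiv b1 b2 z)"
  define y where "y = (LINT z:H|lborel. gdiv d1 d2 z)"
  define w where "w = (LINT z:Gp|lborel. gdiv a1 a2 z) + (LINT z:H|lborel. gdiv c1 c2 z)"
  have 1: "ereal x \<le> grushin_perimeter \<alpha> (upper_part F)"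
    unfolding x_def by (rule grushin_perimeter_ge[OF Um(1) _ Up a(3,4,6)]) simp
  have 2: "ereal y \<le> grushin_perimeter \<alpha> (lower_part F)"
    unfolding y_def id[symmetric]
    by (rule grushin_perimeter_ge[OF Um(2) _ Lp C'(3,4)]) (simp_all add: d1'_def d2'_def c(6))
  have 3: "ereal w \<le> grushin_perimeter \<alpha> F"
    unfolding w_def ie[symmetric]
    by (rule grushin_perimeter_ge[OF Fm _ Fp e en]) simp
  have "2 * (rate l * v - eps) \<le> 1 / 2 * (x + y + w)"
  proof -
    have "2 * k \<le> 1 / 2 * (x + y + (A + B))" if "k \<le> (A + x) / 2" "k \<le> (B + y) / 2" for k A B
      using that by simp
    from this[OF a(8)[folded x_def] c(8)[folded y_def]] show ?thesis by (simp only: w_def)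
  qed
  then have "ereal (2 * (rate l * v - eps)) \<le> ereal (1 / 2) * (ereal x + ereal y + ereal w)"
    by simp
  also have "\<dots> \<le> partition_perimeter \<alpha> F"
    unfolding partition_perimeter_def by (intro ereal_mult_left_mono add_mono 1 2 3) simp
  finally show ?thesis .
qed

text \<open>A slightly larger scale \<open>l' = l * (1 + t)\<close> makes the area strictly larger
  than \<open>v\<close>, as \<open>partition_lower_eps\<close> requires, and lowers the rate only by
  the factor \<open>1 / (1 + t)\<close>, which is at least \<open>1 - t\<close>.\<close>

lemma partition_lower:
  assumes F: "F \<in> admissible_y v" and v: "0 < v" and l: "0 < l" "v = area l"
  shows "ereal (2 * (rate l * v)) \<le> partition_perimeter \<alpha> F"
proof (rule ereal_le_epsilon2)
  fix e :: real assume e: "0 < e"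
  define c where "c = rate l * v"
  have c: "0 < c" using alpha_nonneg l v by (simp add: c_def)
  \<comment> \<open>The scale then costs \<open>e / 4\<close>, as does the inner tolerance; doubling
    both gives \<open>e\<close>.\<close>
  define t where "t = e / (4 * c)"
  have t: "0 < t" "c * t = e / 4" using e c by (auto simp: t_def)
  define l' where "l' = l * (1 + t)"
  have l': "l < l'" using l t by (simp add: l'_def)
  have "l\<^sup>2 * W l < l'\<^sup>2 * W l'"
  proof -
    have "l\<^sup>2 * W l \<le> l\<^sup>2 * W l'" using l l' by (intro mult_left_mono W_mono) auto
    also have "\<dots> < l'\<^sup>2 * W l'" using l l' W_pos[of l'] by (intro mult_strict_right_mono power_strict_mono) auto
    finally show ?thesis .
  qed
  then have "v < area l'"
    unfolding l(2) using sin_moment_pos[of tau 2] tau_bounds by simp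
  then have "ereal (2 * (rate l' * v - e / 4)) \<le> partition_perimeter \<alpha> F"
    using l l' e by (intro partition_lower_eps[OF F v]) auto
  moreover have "c - e / 4 \<le> rate l' * v"
  proof -
    have "c * (1 - t * t) \<le> c * 1" using c by (intro mult_left_mono) auto
    then have "c * (1 - t) * (1 + t) \<le> c" by (simp add: algebra_simps)
    then have "c * (1 - t) \<le> c / (1 + t)" using t by (simp add: pos_le_divide_eq)
    moreover have "c / (1 + t) = rate l' * v" by (simp add: c_def l'_def mult.assoc)
    moreover have "c * (1 - t) = c - e / 4" using t by (simp add: right_diff_distrib)
    ultimately show ?thesis by simp
  qed
  then have "ereal (2 * c) \<le> ereal (2 * (rate l' * v - e / 4)) + ereal e"
    by simp
  ultimately show "ereal (2 * (rate l * v)) \<le> partition_perimeter \<alpha> F + ereal e"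
    unfolding c_def[symmetric] by (meson add_right_mono order_trans)
qed

end

section \<open>The extremal set\<close>

lemma has_integral_FTC_Icc:
  fixes F f :: "real \<Rightarrow> real"
  assumes "a \<le> b" "\<And>x. (F has_real_derivative f x) (at x)"
  shows "(f has_integral F b - F a) {a..b}"
proof (rule fundamental_theorem_of_calculus[OF assms(1)])
  show "(F has_vector_derivative f x) (at x within {a..b})" for x
    using assms(2)[of x] unfolding has_real_derivative_iff_has_vector_derivative
    by (rule has_vector_derivative_at_within)
qed

locale grushin_extremal = grushin +
  fixes l :: real
  assumes l_pos: "0 < l"
begin

definition height :: "real \<Rightarrow> real" where
  "height t = l * W l * (sin_moment 1 tau - sin_moment 1 t)"

definition r :: real where "r = height 0"

definition angle :: "real \<Rightarrow> real" where
  "angle = the_inv_into {0..tau} height"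

text \<open>The profile, extended evenly and, since the top has angle 0, by the value 0 above
  \<open>r\<close>. It is therefore continuous on the whole line.\<close>

definition G :: "real \<Rightarrow> real" where
  "G y = l * sin (angle (min \<bar>y\<bar> r))"

abbreviation right_arc :: "real \<Rightarrow> real \<times> real" where
  "right_arc t \<equiv> (l * sin t, height t)"

abbreviation left_arc :: "real \<Rightarrow> real \<times> real" where
  "left_arc t \<equiv> (- (l * sin t), height t)"

lemma lW_pos: "0 < l * W l"
  using l_pos W_pos[of l] by simp

lemma DERIV_height: "(height has_real_derivative - (l * W l * (sin t * W (sin t)))) (at t)"
proof -
  have "(height has_real_derivative l * W l * (0 - sin t ^ 1 * W (sin t))) (at t)"
    unfolding height_def by (intro DERIV_cmult DERIV_diff DERIV_const sin_moment)
  then show ?thesis by simp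
qed

lemma continuous_on_height: "continuous_on A height"
  by (intro continuous_at_imp_continuous_on ballI DERIV_isCont[OF DERIV_height])

lemma height_strict_antimono: "0 \<le> x \<Longrightarrow> x < y \<Longrightarrow> y \<le> pi \<Longrightarrow> height y < height x"
  unfolding height_def
  by (intro mult_strict_left_mono lW_pos diff_strict_left_mono sin_moment_strict_mono)

lemma height_antimono: "0 \<le> x \<Longrightarrow> x \<le> y \<Longrightarrow> y \<le> pi \<Longrightarrow> height y \<le> height x"
  using height_strict_antimono[of x y] by (cases "x = y") auto

lemma height_tau [simp]: "height tau = 0"
  by (simp add: height_def)

lemma height_0: "height 0 = r"
  by (simp add: r_def)

lemma r_pos: "0 < r"
  using height_strict_antimono[of 0 tau] tau_bounds by (simp add: r_def)

lemma height_image: "height ` {0..tau} = {0..r}"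
proof (intro equalityI subsetI)
  fix y assume "y \<in> height ` {0..tau}"
  then obtain t where t: "y = height t" "0 \<le> t" "t \<le> tau" by auto
  show "y \<in> {0..r}"
    using height_antimono[of 0 t] height_antimono[of t tau] t tau_bounds by (simp add: height_0)
next
  fix y assume y: "y \<in> {0..r}"
  have "\<exists>t\<ge>0. t \<le> tau \<and> height t = y"
    by (rule IVT2') (use y tau_bounds continuous_on_height in \<open>auto simp: height_0\<close>)
  then show "y \<in> height ` {0..tau}" by auto
qed

lemma inj_height: "inj_on height {0..tau}"
proof (rule inj_onI)
  fix x y assume "x \<in> {0..tau}" "y \<in> {0..tau}" "height x = height y"
  with height_strict_antimono[of x y] height_strict_antimono[of y x] tau_bounds
  show "x = y" by force
qed

lemma angle_height: "0 \<le> t \<Longrightarrow> t \<le> tau \<Longrightarrow> angle (height t) = t"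
  unfolding angle_def by (rule the_inv_into_f_f[OF inj_height]) auto

lemma height_angle: "0 \<le> y \<Longrightarrow> y \<le> r \<Longrightarrow> height (angle y) = y"
  unfolding angle_def by (rule f_the_inv_into_f[OF inj_height]) (simp add: height_image)

lemma angle_bounds: "0 \<le> y \<Longrightarrow> y \<le> r \<Longrightarrow> 0 \<le> angle y \<and> angle y \<le> tau"
  using the_inv_into_into[OF inj_height, of y "{0..tau}"] by (simp add: angle_def height_image)

lemma continuous_on_angle: "continuous_on {0..r} angle"
  unfolding height_image[symmetric]
  by (rule continuous_on_inv[OF continuous_on_height]) (auto simp: angle_height)

lemma continuous_on_G [continuous_intros]: "continuous_on A G"
proof -
  have "continuous_on A (\<lambda>y. angle (min \<bar>y\<bar> r))"
    by (rule continuous_on_compose2[OF continuous_on_angle])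
       (use r_pos in \<open>auto intro!: continuous_intros\<close>)
  then show ?thesis unfolding G_def by (intro continuous_intros)
qed

lemma G_even [simp]: "G (- y) = G y" "G \<bar>y\<bar> = G y"
  by (simp_all add: G_def)

lemma G_height: "0 \<le> t \<Longrightarrow> t \<le> tau \<Longrightarrow> G (height t) = l * sin t"
  using height_antimono[of 0 t] height_antimono[of t tau] tau_bounds
  by (simp add: G_def height_0 angle_height min_absorb1)

lemma G_angle: "0 \<le> y \<Longrightarrow> y \<le> r \<Longrightarrow> G y = l * sin (angle y)"
  by (simp add: G_def)

lemma G_0: "r \<le> \<bar>y\<bar> \<Longrightarrow> G y = 0"
  using angle_height[of 0] tau_bounds by (simp add: G_def min_absorb2 height_0)

lemma G_bounds: "0 \<le> G y" "G y \<le> l"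
proof -
  have "0 \<le> angle (min \<bar>y\<bar> r) \<and> angle (min \<bar>y\<bar> r) \<le> tau"
    using r_pos by (intro angle_bounds) auto
  then have "0 \<le> sin (angle (min \<bar>y\<bar> r))" using tau_bounds by (intro sin_ge_zero) auto
  then show "0 \<le> G y" "G y \<le> l" using l_pos by (auto simp: G_def)
qed

lemma integral_height_subst:
  assumes "continuous_on {0..r} f"
  shows "((\<lambda>t. l * W l * (sin t * W (sin t)) * f (height t)) has_integral integral {0..r} f) {0..tau}"
proof -
  have "((\<lambda>t. - (l * W l * (sin t * W (sin t))) *\<^sub>R f (height t)) has_integral
      (integral {height 0..height tau} f - integral {height tau..height 0} f)) {0..tau}"
  proof (rule has_integral_substitution_general[where s="{}" and c=0 and d=r])
    show "height ` {0..tau} \<subseteq> {0..r}" by (simp add: height_image)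
    show "(height has_real_derivative - (l * W l * (sin x * W (sin x)))) (at x within {0..tau})" for x
      by (rule has_field_derivative_at_within[OF DERIV_height])
  qed (use tau_bounds assms continuous_on_height in auto)
  then have "((\<lambda>t. - (l * W l * (sin t * W (sin t)) * f (height t))) has_integral - integral {0..r} f) {0..tau}"
    using r_pos by (simp add: height_0)
  from has_integral_neg[OF this] show ?thesis by simp
qed

definition K :: "(real \<times> real) set" where
  "K = {(x, y). 0 \<le> y \<and> y \<le> r \<and> \<bar>x\<bar> \<le> G y}"

text \<open>Strict inequality makes the sections open intervals, as Schwarz symmetry demands. The
  height is bounded because \<open>G\<close> vanishes beyond \<open>r\<close>. The closed set
  \<open>K\<close> is used for integration instead.\<close>

definition E :: "(real \<times> real) set" where
  "E = {(x, y). \<bar>x\<bar> < G y}"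

lemma continuous_on_G_snd: "continuous_on A (\<lambda>p. G (snd p))"
  by (rule continuous_on_compose2[OF continuous_on_G[of UNIV]]) (auto intro!: continuous_intros)

lemma open_E: "open E"
proof -
  have "E = {p. \<bar>fst p\<bar> < G (snd p)}" by (auto simp: E_def)
  then show ?thesis by (simp only:) (intro open_Collect_less continuous_intros continuous_on_G_snd)
qed

lemma closed_K: "closed K"
proof -
  have "K = {p. 0 \<le> snd p \<and> snd p \<le> r \<and> \<bar>fst p\<bar> \<le> G (snd p)}" by (auto simp: K_def)
  then show ?thesis by (simp only:) (intro closed_Collect_conj closed_Collect_le continuous_intros continuous_on_G_snd)
qed

lemma E_measurable [measurable]: "E \<in> sets borel" "K \<in> sets borel"
  using open_E closed_K by auto

lemma K_subset: "K \<subseteq> cbox (-l, -r) (l, r)"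
proof (rule subsetI)
  fix p assume "p \<in> K"
  then show "p \<in> cbox (-l, -r) (l, r)"
    using G_bounds(2)[of "snd p"] r_pos by (cases p) (auto simp: K_def cbox_Pair_eq)
qed

lemma E_subset: "E \<subseteq> cbox (-l, -r) (l, r)"
proof (rule subsetI)
  fix p assume p: "p \<in> E"
  have "\<bar>snd p\<bar> < r" using G_0[of "snd p"] p by (cases "r \<le> \<bar>snd p\<bar>") (auto simp: E_def)
  then show "p \<in> cbox (-l, -r) (l, r)"
    using G_bounds(2)[of "snd p"] p by (cases p) (auto simp: E_def cbox_Pair_eq)
qed

text \<open>One computation serves both \<open>K\<close> and the upper half of \<open>E\<close>.
  Height 0 is exempt because there the upper half of \<open>E\<close> has an empty section although
  \<open>G 0\<close> is positive. The substitution \<open>y = height t\<close> turns the area into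
  the moment of index 2.\<close>

lemma measure_profile:
  assumes A [measurable]: "A \<in> sets borel" and sub: "A \<subseteq> cbox (-l, -r) (l, r)"
    and sec: "\<And>y. y \<noteq> 0 \<Longrightarrow> measure lborel {x. (x, y) \<in> A} = indicator {0..r} y * (2 * G y)"
  shows "emeasure lborel A = ennreal (area l)"
proof -
  have [measurable]: "G \<in> borel_measurable borel"
    by (intro borel_measurable_continuous_onI continuous_on_G)
  have fin: "emeasure lborel A < \<infinity>"
    using emeasure_mono[OF sub, of lborel] by (simp add: le_less_trans emeasure_lborel_cbox_eq)
  then have iA: "integrable (lborel \<Otimes>\<^sub>M lborel) (\<lambda>(x, y). indicator A (x, y) :: real)"
    by (simp add: lborel_prod)
  have "measure lborel A = (LINT y|lborel. LINT x|lborel. indicator A (x, y))"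
    using lborel_pair.integral_snd[OF iA] fin by (simp add: lborel_prod)
  also have "\<dots> = (LINT y:{0..r}|lborel. 2 * G y)"
    unfolding set_lebesgue_integral_def
  proof (rule integral_cong_AE)
    show "AE y in lborel. (LINT x|lborel. indicator A (x, y)) = indicator {0..r} y *\<^sub>R (2 * G y)"
      using AE_lborel_singleton[of 0]
    proof eventually_elim
      case (elim y)
      have "(LINT x|lborel. indicator A (x, y)) = (LINT x|lborel. indicator {x. (x, y) \<in> A} x :: real)"
        by (simp add: indicator_def)
      then show ?case using sec[OF elim] by simp
    qed
  qed measurable
  also have "\<dots> = integral {0..r} (\<lambda>y. 2 * G y)"
    by (intro set_borel_integral_eq_integral borel_integrable_atLeastAtMost' continuous_intros)
  also have "\<dots> = integral {0..tau} (\<lambda>t. l * W l * (sin t * W (sin t)) * (2 * G (height t)))"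
    by (rule integral_unique[OF integral_height_subst, symmetric]) (intro continuous_intros)
  also have "\<dots> = integral {0..tau} (\<lambda>t. 2 * l\<^sup>2 * W l * (sin t ^ 2 * W (sin t)))"
    by (rule integral_cong) (simp add: G_height power2_eq_square)
  also have "\<dots> = area l"
  proof -
    have "((\<lambda>t. 2 * l\<^sup>2 * W l * (sin t ^ 2 * W (sin t))) has_integral
        area l - 2 * l\<^sup>2 * W l * sin_moment 2 0) {0..tau}"
      by (intro has_integral_FTC_Icc DERIV_cmult sin_moment less_imp_le tau_bounds)
    from integral_unique[OF this] show ?thesis by (simp only: sin_moment mult_zero_right diff_zero)
  qed
  finally show ?thesis using fin by (simp add: emeasure_eq_ennreal_measure)
qed

lemma measure_K: "emeasure lborel K = ennreal (area l)"
  and measure_E_upper: "emeasure lborel (upper_part E) = ennreal (area l)"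
proof -
  have U: "upper_part E \<in> sets borel" unfolding upper_part_eq by measurable
  show "emeasure lborel (upper_part E) = ennreal (area l)"
  proof (rule measure_profile[OF U])
    show "upper_part E \<subseteq> cbox (-l, -r) (l, r)" using E_subset by (auto simp: upper_part_def)
    fix y :: real assume "y \<noteq> 0"
    then show "measure lborel {x. (x, y) \<in> upper_part E} = indicator {0..r} y * (2 * G y)"
    proof (cases "0 < y")
      case True
      then have "{x. (x, y) \<in> upper_part E} = {- G y<..<G y}" by (auto simp: upper_part_def E_def)
      then show ?thesis using True G_0[of y] G_bounds(1)[of y] by (cases "y \<le> r") auto
    qed (auto simp: upper_part_def)
  qed
  show "emeasure lborel K = ennreal (area l)"
  proof (rule measure_profile[OF E_measurable(2) K_subset])
    fix y :: real
    show "measure lborel {x. (x, y) \<in> K} = indicator {0..r} y * (2 * G y)"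
    proof (cases "0 \<le> y \<and> y \<le> r")
      case True
      then have "{x. (x, y) \<in> K} = {- G y..G y}" by (auto simp: K_def)
      then show ?thesis using True G_bounds(1)[of y] by auto
    next
      case False
      then have "{x. (x, y) \<in> K} = {}" by (auto simp: K_def)
      then show ?thesis using False by auto
    qed
  qed
qed

text \<open>One set contains the other and their finite measures agree, so no separate argument
  about the boundary curve is required.\<close>

lemma E_upper_K: "sym_diff (upper_part E) K \<in> null_sets lebesgue"
proof -
  have sub: "upper_part E \<subseteq> K"
  proof (rule subsetI)
    fix p assume p: "p \<in> upper_part E"
    have "snd p \<le> r" using G_0[of "snd p"] p by (cases "r \<le> \<bar>snd p\<bar>") (auto simp: upper_part_def E_def)
    with p show "p \<in> K" by (auto simp: upper_part_def E_def K_def)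
  qed
  have U: "upper_part E \<in> sets borel" unfolding upper_part_eq by measurable
  have "emeasure lborel (K - upper_part E) = 0"
    using emeasure_Diff[OF _ _ _ sub, of lborel] U measure_K measure_E_upper by simp
  then have "K - upper_part E \<in> null_sets lborel" using U by (auto simp: null_sets_def)
  then have "K - upper_part E \<in> null_sets lebesgue" by (rule null_sets_completionI)
  then show ?thesis by (rule sym_diff_null_subset) (use sub in auto)
qed

end

section \<open>Divergence theorem on the extremal set\<close>

lemma sin_ge_iff:
  assumes "0 \<le> b" "b \<le> pi / 2" "0 \<le> t" "t \<le> pi"
  shows "sin b \<le> sin t \<longleftrightarrow> b \<le> t \<and> t \<le> pi - b"
proof -
  have *: "sin b \<le> sin s \<longleftrightarrow> b \<le> s" if "0 \<le> s" "s \<le> pi / 2" for s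
    using assms that sin_mono_le_eq[of b s] by auto
  show ?thesis
  proof (cases "t \<le> pi / 2")
    case True
    then show ?thesis using *[of t] assms by auto
  next
    case False
    have "sin b \<le> sin (pi - t) \<longleftrightarrow> b \<le> pi - t" using False assms by (intro *) auto
    then show ?thesis using False assms by auto
  qed
qed

lemma set_integral_Icc_HK:
  fixes f :: "real \<Rightarrow> real"
  assumes "continuous_on {a..b} f"
  shows "(LINT x|lborel. indicator {a..b} x * f x) = integral {a..b} f"
  using set_borel_integral_eq_integral(2)[OF borel_integrable_atLeastAtMost'[OF assms]]
  by (simp add: set_lebesgue_integral_def)

lemma integral_FTC_indicator:
  fixes F f :: "real \<Rightarrow> real"
  assumes "a \<le> b" "\<And>x. (F has_real_derivative f x) (at x)" "continuous_on UNIV f"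
  shows "(LINT x|lborel. indicator {a..b} x * f x) = F b - F a"
proof -
  have "has_bochner_integral lborel (\<lambda>x. f x * indicator {a..b} x) (F b - F a)"
    by (rule has_bochner_integral_FTC_Icc_real)
       (use assms in \<open>auto simp: continuous_on_eq_continuous_at\<close>)
  then show ?thesis by (simp add: has_bochner_integral_iff mult.commute)
qed

context grushin_extremal
begin

text \<open>A vertical line meets the arc at the angles \<open>arcsin (\<bar>x\<bar> / l)\<close>
  and, below, \<open>pi\<close> minus that angle.\<close>

definition top_y :: "real \<Rightarrow> real" where
  "top_y x = height (arcsin (\<bar>x\<bar> / l))"

text \<open>The arc stops at \<open>tau\<close>: for \<open>\<bar>x\<bar>\<close> up to
  \<open>l * sin tau\<close> the minimum is \<open>tau\<close>, of height 0, and the section starts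
  on the axis. Beyond that the set overhangs.\<close>

definition bot_y :: "real \<Rightarrow> real" where
  "bot_y x = height (min (pi - arcsin (\<bar>x\<bar> / l)) tau)"

lemma arcsin_abs_bounds:
  assumes "\<bar>x\<bar> \<le> l"
  shows "0 \<le> arcsin (\<bar>x\<bar> / l)" "arcsin (\<bar>x\<bar> / l) \<le> pi / 2" "sin (arcsin (\<bar>x\<bar> / l)) = \<bar>x\<bar> / l"
proof -
  have "0 \<le> \<bar>x\<bar> / l" "\<bar>x\<bar> / l \<le> 1" using assms l_pos by auto
  then show "0 \<le> arcsin (\<bar>x\<bar> / l)" "arcsin (\<bar>x\<bar> / l) \<le> pi / 2" "sin (arcsin (\<bar>x\<bar> / l)) = \<bar>x\<bar> / l"
    using arcsin_le_arcsin[of 0 "\<bar>x\<bar> / l"] arcsin_bounded[of "\<bar>x\<bar> / l"] by auto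
qed

text \<open>For \<open>y\<close> between 0 and \<open>r\<close>, with \<open>t\<close> the angle at
  height \<open>y\<close>, membership says that \<open>sin t\<close> is at least
  \<open>\<bar>x\<bar> / l\<close>. This confines \<open>t\<close> to an interval symmetric about
  \<open>pi / 2\<close>, and \<open>height\<close> is decreasing.\<close>

lemma K_section:
  assumes "\<bar>x\<bar> \<le> l"
  shows "(x, y) \<in> K \<longleftrightarrow> bot_y x \<le> y \<and> y \<le> top_y x" "bot_y x \<le> top_y x"
proof -
  define b where "b = arcsin (\<bar>x\<bar> / l)"
  note b = arcsin_abs_bounds[OF assms, folded b_def]
  define c where "c = min (pi - b) tau"
  have c: "b \<le> c" unfolding c_def using b(2) pi_gt_zero by (intro min.boundedI) linarith+
  have c': "c \<le> tau" unfolding c_def by (rule min.cobounded2)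
  note c = c c'
  have eq: "top_y x = height b" "bot_y x = height c" by (simp_all add: top_y_def bot_y_def b_def c_def)
  have range: "height b \<le> r" "0 \<le> height c" "height c \<le> height b"
    using height_antimono[of 0 b] height_antimono[of c tau] height_antimono[of b c] b c tau_bounds
    by (auto simp: height_0)
  show "bot_y x \<le> top_y x" using range eq by simp
  show "(x, y) \<in> K \<longleftrightarrow> bot_y x \<le> y \<and> y \<le> top_y x"
  proof (cases "0 \<le> y \<and> y \<le> r")
    case True
    define t where "t = angle y"
    have t: "0 \<le> t" "t \<le> tau" "height t = y"
      using angle_bounds[of y] height_angle[of y] True by (auto simp: t_def)
    have "(x, y) \<in> K \<longleftrightarrow> \<bar>x\<bar> / l \<le> sin t"
      using True l_pos by (auto simp: K_def G_angle t_def pos_divide_le_eq mult.commute)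
    also have "\<dots> \<longleftrightarrow> b \<le> t \<and> t \<le> pi - b"
      unfolding b(3)[symmetric] using t tau_bounds b by (intro sin_ge_iff) auto
    also have "\<dots> \<longleftrightarrow> b \<le> t \<and> t \<le> c" using t by (auto simp: c_def)
    also have "b \<le> t \<longleftrightarrow> y \<le> height b"
      using height_antimono[of b t] height_strict_antimono[of t b] t b c tau_bounds by force
    also have "t \<le> c \<longleftrightarrow> height c \<le> y"
      using height_antimono[of t c] height_strict_antimono[of c t] t b c tau_bounds by force
    finally show ?thesis using eq by auto
  next
    case False
    then show ?thesis using range eq by (auto simp: K_def)
  qed
qed

lemma K_section_empty: "l < \<bar>x\<bar> \<Longrightarrow> (x, y) \<notin> K"
  using G_bounds(2)[of y] by (auto simp: K_def)

lemma continuous_on_top_bot: "continuous_on {-l..l} top_y" "continuous_on {-l..l} bot_y"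
proof -
  have "continuous_on {-l..l} (\<lambda>x. arcsin (\<bar>x\<bar> / l))"
    by (intro continuous_on_arcsin continuous_intros) (use l_pos in \<open>auto simp: divide_le_eq\<close>, smt (verit) divide_nonneg_pos)
  then show "continuous_on {-l..l} top_y" "continuous_on {-l..l} bot_y"
    unfolding top_y_def bot_y_def
    by (auto intro!: continuous_on_compose2[OF continuous_on_height[of UNIV]] continuous_intros)
qed

lemma top_bot_param:
  shows "0 \<le> t \<Longrightarrow> t \<le> pi / 2 \<Longrightarrow> top_y (l * sin t) = height t"
    and "pi / 2 \<le> t \<Longrightarrow> t \<le> tau \<Longrightarrow> bot_y (l * sin t) = height t"
    and "0 \<le> x \<Longrightarrow> x \<le> l * sin tau \<Longrightarrow> bot_y x = 0"
proof -
  have a: "arcsin (\<bar>l * sin t\<bar> / l) = t" if "0 \<le> t" "t \<le> pi / 2" for t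
  proof -
    have "0 \<le> sin t" using that by (intro sin_ge_zero) auto
    then have "\<bar>l * sin t\<bar> / l = sin t" using l_pos by simp
    then show ?thesis using that arcsin_sin[of t] by simp
  qed
  show "top_y (l * sin t) = height t" if "0 \<le> t" "t \<le> pi / 2"
    using a[OF that] by (simp add: top_y_def)
  show "bot_y (l * sin t) = height t" if "pi / 2 \<le> t" "t \<le> tau"
    using a[of "pi - t"] that tau_bounds by (simp add: bot_y_def)
  show "bot_y x = 0" if x: "0 \<le> x" "x \<le> l * sin tau"
  proof -
    have "sin tau = sin (pi - tau)" by (rule sin_pi_minus[symmetric])
    then have "x / l \<le> sin (pi - tau)" "0 \<le> x / l" using x l_pos by (auto simp: pos_divide_le_eq mult.commute)
    then have "arcsin (x / l) \<le> arcsin (sin (pi - tau))"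
      by (intro arcsin_le_arcsin) auto
    also have "\<dots> = pi - tau" using pi_gt_zero by (intro arcsin_sin) linarith+
    finally have "tau \<le> pi - arcsin (\<bar>x\<bar> / l)" using x by simp
    then show ?thesis by (simp only: bot_y_def min_absorb2 height_tau)
  qed
qed

text \<open>The substitution \<open>x = l * sin t\<close> covers the top for \<open>t\<close> up to
  \<open>pi / 2\<close> and the overhanging bottom for \<open>t\<close> from \<open>pi / 2\<close>
  to \<open>tau\<close>; the negative cosine there provides the minus sign. The rest of the bottom
  is the axis segment.\<close>

lemma flux_subst:
  fixes \<psi> :: "real \<times> real \<Rightarrow> real"
  assumes c: "continuous_on UNIV \<psi>"
  shows "integral {0..l} (\<lambda>x. W x * (\<psi> (x, top_y x) - \<psi> (x, bot_y x))) =
    integral {0..tau} (\<lambda>t. l * W l * (W (sin t) * cos t * \<psi> (right_arc t)))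
      - integral {0..l * sin tau} (\<lambda>x. W x * \<psi> (x, 0))"
proof -
  define x0 where "x0 = l * sin tau"
  have st: "0 < sin tau" using tau_bounds by (intro sin_gt_zero) auto
  have x0: "0 \<le> x0" "x0 \<le> l" using st l_pos by (auto simp: x0_def)
  have cT: "continuous_on {0..l} top_y" and cB: "continuous_on {0..l} bot_y"
    by (rule continuous_on_subset[OF continuous_on_top_bot(1)] continuous_on_subset[OF continuous_on_top_bot(2)], use l_pos in auto)+
  define f where "f x = W x * \<psi> (x, top_y x)" for x
  define g where "g x = W x * \<psi> (x, bot_y x)" for x
  have cf: "continuous_on {0..l} f" and cg: "continuous_on {0..l} g"
    unfolding f_def g_def
    by (intro continuous_intros continuous_on_compose2[OF c] continuous_on_Pair cT cB; simp)+
  have dsin: "((\<lambda>t. l * sin t) has_real_derivative l * cos t) (at t within A)" for t A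
    by (auto intro!: derivative_eq_intros)
  define F where "F t = l * W l * (W (sin t) * cos t * \<psi> (right_arc t))" for t
  have cF: "continuous_on A F" for A
    unfolding F_def by (intro continuous_intros continuous_on_compose2[OF c] continuous_on_Pair continuous_on_height) simp_all
  have iF: "F integrable_on {a..b}" for a b by (rule integrable_continuous_real[OF cF])
  have 1: "integral {0..l} f = integral {0..pi / 2} F"
  proof -
    have "((\<lambda>t. (l * cos t) *\<^sub>R f (l * sin t)) has_integral
        (integral {l * sin 0..l * sin (pi / 2)} f - integral {l * sin (pi / 2)..l * sin 0} f)) {0..pi / 2}"
    proof (rule has_integral_substitution_general[where s="{}" and c=0 and d=l])
      show "(\<lambda>t. l * sin t) ` {0..pi / 2} \<subseteq> {0..l}"
        using l_pos by (auto intro!: mult_nonneg_nonneg sin_ge_zero)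
    qed (use dsin cf in \<open>auto intro!: continuous_intros\<close>)
    then have "((\<lambda>t. (l * cos t) *\<^sub>R f (l * sin t)) has_integral integral {0..l} f) {0..pi / 2}"
      using l_pos by simp
    then have "integral {0..l} f = integral {0..pi / 2} (\<lambda>t. (l * cos t) *\<^sub>R f (l * sin t))"
      by (simp add: integral_unique)
    also have "\<dots> = integral {0..pi / 2} F"
      by (rule integral_cong) (simp add: f_def F_def top_bot_param W_mult)
    finally show ?thesis .
  qed
  have 2: "integral {x0..l} g = - integral {pi / 2..tau} F"
  proof -
    have sb: "sin tau \<le> sin t" if "pi / 2 \<le> t" "t \<le> tau" for t
    proof -
      have "sin (pi - tau) \<le> sin (pi - t)" using that tau_bounds by (intro sin_monotone_2pi_le) auto
      then show ?thesis by (simp only: sin_pi_minus)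
    qed
    have "((\<lambda>t. (l * cos t) *\<^sub>R g (l * sin t)) has_integral
        (integral {l * sin (pi / 2)..l * sin tau} g - integral {l * sin tau..l * sin (pi / 2)} g)) {pi / 2..tau}"
    proof (rule has_integral_substitution_general[where s="{}" and c=x0 and d=l])
      show "(\<lambda>t. l * sin t) ` {pi / 2..tau} \<subseteq> {x0..l}"
        using l_pos sb by (auto simp: x0_def)
      show "continuous_on {x0..l} g" by (rule continuous_on_subset[OF cg]) (use x0 in auto)
    qed (use dsin tau_bounds in \<open>auto intro!: continuous_intros\<close>)
    moreover have "integral {l..x0} g = 0"
      using x0 by (cases "x0 = l") auto
    ultimately have "((\<lambda>t. (l * cos t) *\<^sub>R g (l * sin t)) has_integral - integral {x0..l} g) {pi / 2..tau}"
      by (simp add: x0_def)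
    then have "- integral {x0..l} g = integral {pi / 2..tau} (\<lambda>t. (l * cos t) *\<^sub>R g (l * sin t))"
      by (simp add: integral_unique)
    also have "\<dots> = integral {pi / 2..tau} F"
      by (rule integral_cong) (simp add: g_def F_def top_bot_param W_mult)
    finally show ?thesis by simp
  qed
  have 3: "integral {0..x0} g = integral {0..x0} (\<lambda>x. W x * \<psi> (x, 0))"
    by (rule integral_cong) (simp add: g_def top_bot_param x0_def)
  have "integral {0..l} (\<lambda>x. W x * (\<psi> (x, top_y x) - \<psi> (x, bot_y x))) = integral {0..l} f - integral {0..l} g"
    unfolding f_def g_def right_diff_distrib
    by (rule Henstock_Kurzweil_Integration.integral_diff; rule integrable_continuous_real, fold f_def g_def, rule cf cg)
  also have "integral {0..l} g = integral {0..x0} g + integral {x0..l} g"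
    using x0 by (intro Henstock_Kurzweil_Integration.integral_combine[symmetric] integrable_continuous_real cg) auto
  also have "integral {0..l} f - (integral {0..x0} g + integral {x0..l} g)
      = integral {0..pi / 2} F + integral {pi / 2..tau} F - integral {0..x0} (\<lambda>x. W x * \<psi> (x, 0))"
    by (simp add: 1 2 3)
  also have "integral {0..pi / 2} F + integral {pi / 2..tau} F = integral {0..tau} F"
    using tau_bounds(1,3) pi_gt_zero by (intro Henstock_Kurzweil_Integration.integral_combine iF) simp_all
  finally show ?thesis by (simp only: F_def[abs_def] x0_def)
qed

text \<open>The weighted flux through the segment of the set on the x-axis, folded onto nonnegative
  \<open>x\<close>.\<close>

definition trace :: "(real \<times> real \<Rightarrow> real) \<Rightarrow> real" where
  "trace f = integral {0..l * sin tau} (\<lambda>x. W x * (f (x, 0) + f (- x, 0)))"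

text \<open>The horizontal part is integrated along horizontal sections, the vertical part along
  vertical ones. In the parameter \<open>t\<close> both carry the factor
  \<open>l * W l * W (sin t)\<close>, the weighted length element, multiplied by the components of
  the normal \<open>(sin t, cos t)\<close> on the right arc and \<open>(- sin t, cos t)\<close> on
  the left one.\<close>

lemma divergence_K:
  assumes f: "f1 \<in> C1c" "f2 \<in> C1c"
  shows "(LINT z:K|lborel. gdiv f1 f2 z) =
    integral {0..tau} (\<lambda>t. l * W l * (W (sin t) * ((sin t * f1 (right_arc t) + cos t * f2 (right_arc t))
      + (sin t * - f1 (left_arc t) + cos t * f2 (left_arc t))))) - trace f2"
proof -
  note C1 = C1c_imp_C1d[OF f(1)] and C2 = C1c_imp_C1d[OF f(2)]
  note c1 = C1d_continuous[OF C1, of UNIV] and c2 = C1d_continuous[OF C2, of UNIV]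
  have cpx: "continuous_on UNIV (\<lambda>x. partial_x f1 (x, y))" for y
    by (rule continuous_on_compose2[OF C1dD(2)[OF C1]]) (auto intro!: continuous_intros)
  have cpy: "continuous_on UNIV (\<lambda>y. partial_y f2 (x, y))" for x
    by (rule continuous_on_compose2[OF C1dD(3)[OF C2]]) (auto intro!: continuous_intros)
  have intK: "integrable lborel (\<lambda>z. indicator K z * f z)" if "continuous_on UNIV f" for f :: "real \<times> real \<Rightarrow> real"
  proof -
    have "compact K" using closed_K K_subset bounded_subset[OF bounded_cbox] by (auto simp: compact_eq_bounded_closed)
    from borel_integrable_compact[OF this continuous_on_subset[OF that]] show ?thesis by simp
  qed
  have i1: "integrable lborel (\<lambda>z. indicator K z * partial_x f1 z)"
    by (rule intK[OF C1dD(2)[OF C1]])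
  have i2: "integrable lborel (\<lambda>z. indicator K z * (W (fst z) * partial_y f2 z))"
    by (rule intK) (intro continuous_intros C1dD(3)[OF C2])
  have "(LINT z:K|lborel. gdiv f1 f2 z)
      = (LINT z|lborel. indicator K z * partial_x f1 z + indicator K z * (W (fst z) * partial_y f2 z))"
    by (simp add: set_lebesgue_integral_def gdiv_def distrib_left)
  also have "\<dots> = (LINT z|lborel. indicator K z * partial_x f1 z) + (LINT z|lborel. indicator K z * (W (fst z) * partial_y f2 z))"
    by (rule Bochner_Integration.integral_add[OF i1 i2])
  also have "(LINT z|lborel. indicator K z * partial_x f1 z)
      = integral {0..tau} (\<lambda>t. l * W l * (sin t * W (sin t)) * (f1 (right_arc t) - f1 (left_arc t)))"
  proof -
    have "(LINT z|lborel. indicator K z * partial_x f1 z) = (LINT y|lborel. LINT x|lborel. indicator K (x, y) * partial_x f1 (x, y))"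
      using lborel_pair.integral_snd[of "\<lambda>x y. indicator K (x, y) * partial_x f1 (x, y)"] i1
      by (simp add: lborel_prod split_beta')
    also have "\<dots> = (LINT y|lborel. indicator {0..r} y * (f1 (G y, y) - f1 (- G y, y)))"
    proof (rule Bochner_Integration.integral_cong)
      fix y
      have "(LINT x|lborel. indicator K (x, y) * partial_x f1 (x, y))
          = (LINT x|lborel. indicator {0..r} y * (indicator {- G y..G y} x * partial_x f1 (x, y)))"
        by (rule Bochner_Integration.integral_cong) (auto simp: K_def indicator_def)
      also have "\<dots> = indicator {0..r} y * (f1 (G y, y) - f1 (- G y, y))"
        using G_bounds(1)[of y]
        by (simp add: integral_FTC_indicator[OF _ C1d_DERIV_x[OF C1] cpx])
      finally show "(LINT x|lborel. indicator K (x, y) * partial_x f1 (x, y)) = indicator {0..r} y * (f1 (G y, y) - f1 (- G y, y))" .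
    qed simp
    also have "\<dots> = integral {0..r} (\<lambda>y. f1 (G y, y) - f1 (- G y, y))"
      by (intro set_integral_Icc_HK continuous_on_diff continuous_on_compose2[OF c1] continuous_intros) auto
    also have "\<dots> = integral {0..tau} (\<lambda>t. l * W l * (sin t * W (sin t)) * (f1 (G (height t), height t) - f1 (- G (height t), height t)))"
      by (rule integral_unique[OF integral_height_subst, symmetric])
         (intro continuous_on_diff continuous_on_compose2[OF c1] continuous_intros, auto)
    also have "\<dots> = integral {0..tau} (\<lambda>t. l * W l * (sin t * W (sin t)) * (f1 (right_arc t) - f1 (left_arc t)))"
      by (rule integral_cong) (simp add: G_height)
    finally show ?thesis .
  qed
  also have "(LINT z|lborel. indicator K z * (W (fst z) * partial_y f2 z))
      = integral {0..tau} (\<lambda>t. l * W l * (W (sin t) * cos t * (f2 (right_arc t) + f2 (left_arc t)))) - trace f2"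
  proof -
    let ?\<psi> = "\<lambda>(x, y). f2 (x, y) + f2 (- x, y)"
    define k where "k x = W x * (f2 (x, top_y x) - f2 (x, bot_y x))" for x
    have ck: "continuous_on {-l..l} k"
      unfolding k_def
      by (intro continuous_intros continuous_on_compose2[OF c2] continuous_on_Pair continuous_on_top_bot) auto
    have "(LINT z|lborel. indicator K z * (W (fst z) * partial_y f2 z))
        = (LINT x|lborel. LINT y|lborel. indicator K (x, y) * (W x * partial_y f2 (x, y)))"
      using lborel_pair.integral_fst[of "\<lambda>x y. indicator K (x, y) * (W x * partial_y f2 (x, y))"] i2
      by (simp add: lborel_prod split_beta')
    also have "\<dots> = (LINT x|lborel. indicator {-l..l} x * k x)"
    proof (rule Bochner_Integration.integral_cong)
      fix x
      show "(LINT y|lborel. indicator K (x, y) * (W x * partial_y f2 (x, y))) = indicator {-l..l} x * k x"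
      proof (cases "\<bar>x\<bar> \<le> l")
        case True
        have "(LINT y|lborel. indicator K (x, y) * (W x * partial_y f2 (x, y)))
            = (LINT y|lborel. W x * (indicator {bot_y x..top_y x} y * partial_y f2 (x, y)))"
          by (rule Bochner_Integration.integral_cong) (auto simp: indicator_def K_section[OF True])
        also have "\<dots> = k x"
          using K_section(2)[OF True]
          by (simp add: k_def integral_FTC_indicator[OF _ C1d_DERIV_y[OF C2] cpy])
        finally show ?thesis using True by (auto simp: indicator_def abs_le_iff minus_le_iff)
      next
        case False
        then have "(x, y) \<notin> K" for y using K_section_empty[of x y] by auto
        then show ?thesis using False by (auto simp: indicator_def abs_le_iff minus_le_iff)
      qed
    qed simp
    also have "\<dots> = integral {-l..l} k" by (rule set_integral_Icc_HK[OF ck])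
    also have "\<dots> = integral {-l..0} k + integral {0..l} k"
      using l_pos by (intro Henstock_Kurzweil_Integration.integral_combine[symmetric] integrable_continuous_real ck) auto
    also have "integral {-l..0} k = integral {0..l} (\<lambda>x. k (- x))"
      using Henstock_Kurzweil_Integration.integral_reflect_real[where a=0 and b=l and f="\<lambda>x. k (- x)"] by simp
    also have "integral {0..l} (\<lambda>x. k (- x)) + integral {0..l} k = integral {0..l} (\<lambda>x. k (- x) + k x)"
    proof (rule Henstock_Kurzweil_Integration.integral_add[symmetric])
      show "(\<lambda>x. k (- x)) integrable_on {0..l}" "k integrable_on {0..l}"
        by (intro integrable_continuous_real continuous_on_compose2[OF ck] continuous_intros
            continuous_on_subset[OF ck]; use l_pos in auto)+
    qed
    also have "(\<lambda>x. k (- x) + k x) = (\<lambda>x. W x * (?\<psi> (x, top_y x) - ?\<psi> (x, bot_y x)))"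
      by (auto simp: k_def top_y_def bot_y_def algebra_simps)
    also have "integral {0..l} \<dots> =
      integral {0..tau} (\<lambda>t. l * W l * (W (sin t) * cos t * ?\<psi> (right_arc t)))
      - integral {0..l * sin tau} (\<lambda>x. W x * ?\<psi> (x, 0))"
      by (rule flux_subst)
         (auto simp: split_beta' intro!: continuous_on_add continuous_on_compose2[OF c2] continuous_intros)
    finally show ?thesis by (simp add: trace_def)
  qed
  also have "integral {0..tau} (\<lambda>t. l * W l * (sin t * W (sin t)) * (f1 (right_arc t) - f1 (left_arc t)))
      + (integral {0..tau} (\<lambda>t. l * W l * (W (sin t) * cos t * (f2 (right_arc t) + f2 (left_arc t)))) - trace f2)
     = integral {0..tau} (\<lambda>t. l * W l * (sin t * W (sin t)) * (f1 (right_arc t) - f1 (left_arc t))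
        + l * W l * (W (sin t) * cos t * (f2 (right_arc t) + f2 (left_arc t)))) - trace f2"
  proof -
    have i: "(\<lambda>t. l * W l * (sin t * W (sin t)) * (f1 (right_arc t) - f1 (left_arc t))) integrable_on {0..tau}"
      "(\<lambda>t. l * W l * (W (sin t) * cos t * (f2 (right_arc t) + f2 (left_arc t)))) integrable_on {0..tau}"
      by (intro integrable_continuous_real continuous_intros continuous_on_compose2[OF c1] continuous_on_compose2[OF c2]
          continuous_on_Pair continuous_on_height; simp)+
    show ?thesis by (simp add: Henstock_Kurzweil_Integration.integral_add[OF i])
  qed
  finally show ?thesis
    by (rule trans) (rule arg_cong2[where f="(-)"], rule integral_cong, simp_all add: algebra_simps)
qed

end

section \<open>Perimeter and geometry of the extremal set\<close>

context grushin_extremal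
begin

lemma has_integral_W_sin: "((\<lambda>t. 2 * (l * W l) * W (sin t)) has_integral 2 * (l * W l) * sin_moment 0 tau) {0..tau}"
proof -
  have "((\<lambda>t. 2 * (l * W l) * (sin t ^ 0 * W (sin t))) has_integral
      2 * (l * W l) * sin_moment 0 tau - 2 * (l * W l) * sin_moment 0 0) {0..tau}"
    by (intro has_integral_FTC_Icc DERIV_cmult sin_moment less_imp_le tau_bounds)
  then show ?thesis by (simp only: sin_moment mult_zero_right diff_zero power_0 mult_1_left)
qed

text \<open>Cauchy-Schwarz on the arcs only. The axis term is kept exact, since it has to cancel
  against the one of the reflected half.\<close>

lemma divergence_K_le:
  assumes f: "f1 \<in> C1c" "f2 \<in> C1c" and n: "\<And>p. (f1 p)\<^sup>2 + (f2 p)\<^sup>2 \<le> 1"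
  shows "(LINT z:K|lborel. gdiv f1 f2 z) \<le> 2 * (l * W l) * sin_moment 0 tau - trace f2"
proof -
  have *: "s * a + c * b \<le> 1" if "s\<^sup>2 + c\<^sup>2 = 1" "a\<^sup>2 + b\<^sup>2 \<le> 1" for s c a b :: real
    using zero_le_power2[of "s - a"] zero_le_power2[of "c - b"] that by (simp add: power2_diff)
  note c1 = C1d_continuous[OF C1c_imp_C1d[OF f(1)], of UNIV] and c2 = C1d_continuous[OF C1c_imp_C1d[OF f(2)], of UNIV]
  let ?f = "\<lambda>t. l * W l * (W (sin t) * ((sin t * f1 (right_arc t) + cos t * f2 (right_arc t))
      + (sin t * - f1 (left_arc t) + cos t * f2 (left_arc t))))"
  have "?f integrable_on {0..tau}"
    by (intro integrable_continuous_real continuous_intros continuous_on_compose2[OF c1] continuous_on_compose2[OF c2]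
          continuous_on_Pair continuous_on_height; simp)
  then have "integral {0..tau} ?f \<le> 2 * (l * W l) * sin_moment 0 tau"
  proof (rule has_integral_le[OF integrable_integral has_integral_W_sin])
    fix t
    have "sin t * f1 (right_arc t) + cos t * f2 (right_arc t) \<le> 1"
      "sin t * - f1 (left_arc t) + cos t * f2 (left_arc t) \<le> 1"
      by (intro *; simp add: n)+
    then have "l * W l * (W (sin t) * ((sin t * f1 (right_arc t) + cos t * f2 (right_arc t))
      + (sin t * - f1 (left_arc t) + cos t * f2 (left_arc t)))) \<le> l * W l * (W (sin t) * (1 + 1))"
      using lW_pos by (intro mult_left_mono add_mono) auto
    then show "?f t \<le> 2 * (l * W l) * W (sin t)" by simp
  qed
  then show ?thesis unfolding divergence_K[OF f] by simp
qed

lemma trace_bound: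
  assumes f: "f \<in> C1c" and n: "\<And>p. \<bar>f p\<bar> \<le> 1"
  shows "\<bar>trace f\<bar> \<le> 2 * U (l * sin tau)"
proof -
  note c = C1d_continuous[OF C1c_imp_C1d[OF f], of UNIV]
  have st: "0 \<le> l * sin tau" using tau_bounds l_pos by (intro mult_nonneg_nonneg sin_ge_zero) auto
  have h: "((\<lambda>x. 2 * W x) has_integral 2 * U (l * sin tau) - 2 * U 0) {0..l * sin tau}"
    by (intro has_integral_FTC_Icc DERIV_cmult DERIV_U st)
  have "norm (trace f) \<le> integral {0..l * sin tau} (\<lambda>x. 2 * W x)"
    unfolding trace_def
  proof (rule integral_norm_bound_integral)
    show "(\<lambda>x. W x * (f (x, 0) + f (- x, 0))) integrable_on {0..l * sin tau}"
      by (intro integrable_continuous_real continuous_intros continuous_on_compose2[OF c] continuous_on_Pair; simp)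
    show "(\<lambda>x. 2 * W x) integrable_on {0..l * sin tau}" using h by blast
    fix x
    have "\<bar>f (x, 0) + f (- x, 0)\<bar> \<le> 2" using n[of "(x, 0)"] n[of "(- x, 0)"] by linarith
    then have "W x * \<bar>f (x, 0) + f (- x, 0)\<bar> \<le> W x * 2" by (intro mult_left_mono) auto
    then show "norm (W x * (f (x, 0) + f (- x, 0))) \<le> 2 * W x" by (simp add: abs_mult)
  qed
  also have "\<dots> = 2 * U (l * sin tau)" using integral_unique[OF h] by (simp only: U_0 mult_zero_right diff_zero)
  finally show ?thesis by simp
qed

definition K' :: "(real \<times> real) set" where "K' = reflect -` K"

lemma K'_measurable [measurable]: "K' \<in> sets borel"
  unfolding K'_def by (rule reflect_vimage_borel) simp

lemma lower_part_E: "lower_part E = reflect -` upper_part E"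
  by (auto simp: lower_part_def upper_part_def E_def)

lemma parts_E_measurable: "upper_part E \<in> sets borel" "lower_part E \<in> sets borel"
  unfolding upper_part_eq lower_part_eq by measurable

lemma E_lower_K': "sym_diff (lower_part E) K' \<in> null_sets lebesgue"
proof -
  have S: "sym_diff (upper_part E) K \<in> sets borel" using parts_E_measurable by auto
  have "emeasure lborel (reflect -` sym_diff (upper_part E) K) = emeasure lborel (sym_diff (upper_part E) K)"
    by (rule emeasure_reflect[OF S])
  also have "\<dots> = emeasure lebesgue (sym_diff (upper_part E) K)" using S by simp
  also have "\<dots> = 0" using E_upper_K by (simp add: null_sets_def)
  finally have "reflect -` sym_diff (upper_part E) K \<in> null_sets lborel"
    using reflect_vimage_borel[OF S] by (simp add: null_sets_def)
  then have "reflect -` sym_diff (upper_part E) K \<in> null_sets lebesgue" by (rule null_sets_completionI)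
  then show ?thesis by (rule sym_diff_null_subset) (auto simp: lower_part_E K'_def)
qed

lemma E_K_K': "sym_diff E (K \<union> K') \<in> null_sets lebesgue"
proof (rule sym_diff_null_subset[OF null_sets.Un[OF null_sets.Un[OF E_upper_K E_lower_K'] x_axis_null]])
  show "sym_diff E (K \<union> K') \<subseteq> sym_diff (upper_part E) K \<union> sym_diff (lower_part E) K' \<union> {p. snd p = 0}"
  proof (rule subsetI)
    fix p assume p: "p \<in> sym_diff E (K \<union> K')"
    consider "snd p = 0" | "0 < snd p" | "snd p < 0" by linarith
    then show "p \<in> sym_diff (upper_part E) K \<union> sym_diff (lower_part E) K' \<union> {p. snd p = 0}"
      by cases (use p in \<open>auto simp: upper_part_eq lower_part_eq K'_def K_def reflect_def\<close>)
  qed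
qed

text \<open>Reflection changes the sign of the vertical component, hence the sign of the
  trace.\<close>

lemma divergence_K':
  assumes f: "f1 \<in> C1c" "f2 \<in> C1c" and n: "\<And>p. (f1 p)\<^sup>2 + (f2 p)\<^sup>2 \<le> 1"
  shows "(LINT z:K'|lborel. gdiv f1 f2 z) \<le> 2 * (l * W l) * sin_moment 0 tau + trace f2"
proof -
  have "(LINT z:K'|lborel. gdiv f1 f2 z) = (LINT z:K|lborel. gdiv f1 f2 (reflect z))"
    unfolding K'_def by (rule set_integral_reflect[OF borel_measurable_gdiv[OF f]]) simp
  also have "\<dots> = (LINT z:K|lborel. gdiv (\<lambda>z. f1 (reflect z)) (\<lambda>z. - f2 (reflect z)) z)"
    by (simp add: gdiv_reflect[OF f])
  also have "\<dots> \<le> 2 * (l * W l) * sin_moment 0 tau - trace (\<lambda>z. - f2 (reflect z))"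
    by (rule divergence_K_le) (simp_all add: n C1c_reflect C1c_minus f)
  also have "trace (\<lambda>z. - f2 (reflect z)) = integral {0..l * sin tau} (\<lambda>x. - (W x * (f2 (x, 0) + f2 (- x, 0))))"
    unfolding trace_def by (rule integral_cong) (simp add: algebra_simps)
  also have "\<dots> = - trace f2" by (simp add: trace_def)
  finally show ?thesis by simp
qed

text \<open>\<open>A\<close> is the weighted length of the two arcs of one half, \<open>B\<close>
  that of the axis segment. Each half has perimeter at most \<open>A + B\<close>; for the whole set
  the traces cancel and leave \<open>A + A\<close>. The energy is thus at most
  \<open>2 * A + B\<close>, which \<open>sin_moment_reduction\<close> at \<open>tau\<close> turns
  into the value of the lower bound.\<close>

lemma partition_E_le:
  "partition_perimeter \<alpha> E \<le> ereal (2 * (rate l * (area l)))"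
proof -
  define A where "A = 2 * (l * W l) * sin_moment 0 tau"
  define B where "B = 2 * U (l * sin tau)"
  have abs1: "\<bar>b\<bar> \<le> 1" if "a\<^sup>2 + b\<^sup>2 \<le> 1" for a b :: real
    using that zero_le_power2[of a] by (intro iffD1[OF abs_square_le_1]) linarith
  have lm: "upper_part E \<in> sets lebesgue" "lower_part E \<in> sets lebesgue" "E \<in> sets lebesgue"
    using parts_E_measurable by auto
  have 1: "grushin_perimeter \<alpha> (upper_part E) \<le> ereal (A + B)"
  proof (rule grushin_perimeter_le[OF lm(1) _ E_upper_K])
    fix f1 f2 :: "real \<times> real \<Rightarrow> real"
    assume f: "f1 \<in> C1c" "f2 \<in> C1c" "\<And>p. (f1 p)\<^sup>2 + (f2 p)\<^sup>2 \<le> 1"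
    then have "\<bar>trace f2\<bar> \<le> B" unfolding B_def by (intro trace_bound abs1)
    then show "(LINT z:K|lborel. gdiv f1 f2 z) \<le> A + B"
      using divergence_K_le[OF f] by (simp add: A_def abs_le_iff)
  qed simp
  have 2: "grushin_perimeter \<alpha> (lower_part E) \<le> ereal (A + B)"
  proof (rule grushin_perimeter_le[OF lm(2) _ E_lower_K'])
    fix f1 f2 :: "real \<times> real \<Rightarrow> real"
    assume f: "f1 \<in> C1c" "f2 \<in> C1c" "\<And>p. (f1 p)\<^sup>2 + (f2 p)\<^sup>2 \<le> 1"
    then have "\<bar>trace f2\<bar> \<le> B" unfolding B_def by (intro trace_bound abs1)
    then show "(LINT z:K'|lborel. gdiv f1 f2 z) \<le> A + B"
      using divergence_K'[OF f] by (simp add: A_def abs_le_iff)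
  qed simp
  have 3: "grushin_perimeter \<alpha> E \<le> ereal (A + A)"
  proof (rule grushin_perimeter_le[OF lm(3) _ E_K_K'])
    fix f1 f2 :: "real \<times> real \<Rightarrow> real"
    assume f: "f1 \<in> C1c" "f2 \<in> C1c" "\<And>p. (f1 p)\<^sup>2 + (f2 p)\<^sup>2 \<le> 1"
    have "AE p in lborel. snd (p :: real \<times> real) \<noteq> 0"
      using AE_not_in[OF x_axis_null] by (simp add: AE_completion_iff)
    then have "AE p in lborel. \<not> (p \<in> K \<and> p \<in> K')"
      by eventually_elim (auto simp: K'_def K_def reflect_def)
    then have "(LINT z:K \<union> K'|lborel. gdiv f1 f2 z) = (LINT z:K|lborel. gdiv f1 f2 z) + (LINT z:K'|lborel. gdiv f1 f2 z)"
      by (intro set_integral_Un_AE set_integrable_gdiv f) auto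
    then show "(LINT z:K \<union> K'|lborel. gdiv f1 f2 z) \<le> A + A"
      using divergence_K'[OF f] divergence_K_le[OF f] by (simp add: A_def)
  qed simp
  have "partition_perimeter \<alpha> E \<le> ereal (1 / 2) * (ereal (A + B) + ereal (A + B) + ereal (A + A))"
    unfolding partition_perimeter_def by (intro ereal_mult_left_mono add_mono 1 2 3) simp
  also have "\<dots> = ereal (2 * A + B)" by (simp add: field_simps)
  also have "2 * A + B = 2 * (rate l * (area l))"
  proof -
    have p: "\<alpha> + 1 \<noteq> 0" "l \<noteq> 0" using alpha_nonneg l_pos by auto
    have "2 * (rate l * (area l))
        = 4 * (l * W l) * ((\<alpha> + 2) * sin_moment 2 tau) / (\<alpha> + 1)"
    proof -
      have "2 * (x / (a * l) * (2 * l\<^sup>2 * w * m)) = 4 * (l * w) * (x * m) / a" if "a \<noteq> 0" for a x w m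
        using that p(2) by (simp add: power2_eq_square field_simps)
      from this[OF p(1)] show ?thesis .
    qed
    also have "\<dots> = 4 * (l * W l) * ((\<alpha> + 1) * sin_moment 0 tau + sin tau * W (sin tau) / 2) / (\<alpha> + 1)"
      unfolding sin_moment_reduction cos_tau by simp
    also have "\<dots> = 4 * (l * W l) * sin_moment 0 tau + 2 * (l * W l) * (sin tau * W (sin tau)) / (\<alpha> + 1)"
    proof -
      have "4 * k * (a * m + s / 2) / a = 4 * k * m + 2 * k * s / a" if "a \<noteq> 0" for a k m s :: real
        using that by (simp add: field_simps)
      from this[OF p(1)] show ?thesis .
    qed
    also have "2 * (l * W l) * (sin tau * W (sin tau)) / (\<alpha> + 1) = B"
      unfolding B_def U_def W_mult by (simp only: times_divide_eq_right mult_ac)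
    finally show ?thesis by (simp add: A_def)
  qed
  finally show ?thesis .
qed

text \<open>Along the curve the slope of \<open>U (G y)\<close> in \<open>y\<close> is minus the
  cotangent of the angle, so \<open>k\<close> is the cotangent at \<open>y0\<close>. Concavity is
  obtained in the parameter \<open>t\<close>: the function \<open>h\<close> has derivative of the
  sign of \<open>sin (a - t)\<close> and is therefore maximal at \<open>a\<close>. This avoids
  differentiating \<open>angle\<close>.\<close>

lemma profile_support_line:
  assumes y0: "0 < y0" "y0 < r"
  obtains k where "\<And>y. 0 \<le> y \<Longrightarrow> y \<le> r \<Longrightarrow> U (G y) \<le> U (G y0) + k * (y0 - y)"
proof -
  define a where "a = angle y0"
  have a: "0 \<le> a" "a \<le> tau" "height a = y0" using angle_bounds[of y0] height_angle[of y0] y0 by (auto simp: a_def)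
  have "a \<noteq> 0" using a(3) y0 height_0 by auto
  then have sa: "0 < sin a" using a tau_bounds by (intro sin_gt_zero) auto
  define k where "k = cos a / sin a"
  define h where "h t = U (l * sin t) + k * height t" for t
  have dh: "(h has_real_derivative l * W l * W (sin t) * sin (a - t) / sin a) (at t)" for t
  proof -
    have "((\<lambda>t. U (l * sin t)) has_real_derivative W (l * sin t) * (l * cos t)) (at t)"
      by (rule DERIV_chain2[OF DERIV_U DERIV_cmult[OF DERIV_sin]])
    then have "(h has_real_derivative W (l * sin t) * (l * cos t) + k * - (l * W l * (sin t * W (sin t)))) (at t)"
      unfolding h_def by (intro DERIV_add DERIV_cmult DERIV_height)
    moreover have "W (l * sin t) * (l * cos t) + k * - (l * W l * (sin t * W (sin t))) = l * W l * W (sin t) * sin (a - t) / sin a"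
      using sa by (simp add: k_def W_mult sin_diff field_simps)
    ultimately show ?thesis by simp
  qed
  have max: "h t \<le> h a" if t: "0 \<le> t" "t \<le> tau" for t
  proof (cases "t \<le> a")
    case True
    then show ?thesis
    proof (rule DERIV_nonneg_imp_nondecreasing)
      fix s assume "t \<le> s" "s \<le> a"
      then have "0 \<le> sin (a - s)" using a t tau_bounds by (intro sin_ge_zero) auto
      then have "0 \<le> l * W l * W (sin s) * sin (a - s) / sin a" using lW_pos sa by simp
      with dh show "\<exists>d. (h has_real_derivative d) (at s) \<and> 0 \<le> d" by blast
    qed
  next
    case False
    then have "a \<le> t" by simp
    then show ?thesis
    proof (rule DERIV_nonpos_imp_nonincreasing)
      fix s assume "a \<le> s" "s \<le> t"
      then have "0 \<le> sin (s - a)" using a t tau_bounds by (intro sin_ge_zero) auto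
      moreover have "sin (a - s) = - sin (s - a)" using sin_minus[of "s - a"] by simp
      ultimately have "l * W l * W (sin s) * sin (a - s) / sin a \<le> 0" using lW_pos sa
        by (simp add: mult_nonneg_nonpos divide_nonpos_pos)
      with dh show "\<exists>d. (h has_real_derivative d) (at s) \<and> d \<le> 0" by blast
    qed
  qed
  show ?thesis
  proof (rule that[of k])
    fix y assume y: "0 \<le> y" "y \<le> r"
    have "h (angle y) \<le> h a" using angle_bounds[OF y] by (intro max) auto
    then show "U (G y) \<le> U (G y0) + k * (y0 - y)"
      using y y0 a by (simp add: h_def G_angle height_angle a_def[symmetric] algebra_simps)
  qed
qed

lemma transform_E: "grushin_transform \<alpha> ` upper_part E = {(\<xi>, y). 0 < y \<and> \<bar>\<xi>\<bar> < U (G y)}"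
proof -
  have T: "grushin_transform \<alpha> (x, y) = (U x, y)" for x y
  proof (cases "x = 0")
    case False
    then have "\<bar>x\<bar> powr (\<alpha> + 1) = \<bar>x\<bar> * W x" by (simp add: powr_add W_powr)
    moreover have "sgn x * \<bar>x\<bar> = x" by (simp add: sgn_mult_abs)
    ultimately show ?thesis by (simp add: grushin_transform_def U_def flip: mult.assoc)
  qed (simp add: grushin_transform_def)
  have mono: "\<bar>U x\<bar> < U g \<longleftrightarrow> \<bar>x\<bar> < g" if "0 \<le> g" for x g
  proof -
    have "\<bar>U x\<bar> = U \<bar>x\<bar>" using U_minus[of x] U_nonneg[of x] U_nonneg[of "- x"] by (cases "0 \<le> x") auto
    moreover have "U \<bar>x\<bar> < U g \<longleftrightarrow> \<bar>x\<bar> < g"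
      using U_strict_mono[of "\<bar>x\<bar>" g] U_strict_mono[of g "\<bar>x\<bar>"] that by (cases "\<bar>x\<bar>" g rule: linorder_cases) auto
    ultimately show ?thesis by simp
  qed
  show ?thesis
  proof (intro equalityI subsetI)
    fix p assume "p \<in> grushin_transform \<alpha> ` upper_part E"
    then show "p \<in> {(\<xi>, y). 0 < y \<and> \<bar>\<xi>\<bar> < U (G y)}"
      using mono[OF G_bounds(1)] by (auto simp: upper_part_def E_def T)
  next
    fix p assume p: "p \<in> {(\<xi>, y). 0 < y \<and> \<bar>\<xi>\<bar> < U (G y)}"
    obtain \<xi> y where xy: "p = (\<xi>, y)" by (cases p)
    with p have *: "0 < y" "\<bar>\<xi>\<bar> < U (G y)" by auto
    have "\<exists>x\<ge>- G y. x \<le> G y \<and> U x = \<xi>"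
      by (rule IVT') (use * G_bounds(1)[of y] in \<open>auto simp: U_minus intro!: continuous_intros\<close>)
    then obtain x where "U x = \<xi>" by blast
    with * mono[OF G_bounds(1)] have "(x, y) \<in> upper_part E" by (auto simp: upper_part_def E_def)
    then show "p \<in> grushin_transform \<alpha> ` upper_part E"
      using T[of x y] xy \<open>U x = \<xi>\<close> by (metis image_eqI)
  qed
qed

text \<open>The transformed set is the region between a concave function and its negative. Both
  points lie strictly below the supporting line at the height \<open>m\<close> of their combination,
  and averaging cancels the slope term.\<close>

lemma E_transformed_convex: "y_transformed_convex \<alpha> E"
  unfolding y_transformed_convex_def transform_E
proof (rule convexI)
  fix p q :: "real \<times> real" and u w :: real
  assume p: "p \<in> {(\<xi>, y). 0 < y \<and> \<bar>\<xi>\<bar> < U (G y)}" and q: "q \<in> {(\<xi>, y). 0 < y \<and> \<bar>\<xi>\<bar> < U (G y)}"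
    and uw: "0 \<le> u" "0 \<le> w" "u + w = 1"
  obtain a y where a: "p = (a, y)" by (cases p)
  obtain b z where b: "q = (b, z)" by (cases q)
  have *: "0 < y" "\<bar>a\<bar> < U (G y)" "0 < z" "\<bar>b\<bar> < U (G z)" using p q a b by auto
  have lt: "y < r" if "0 < y" "\<bar>a\<bar> < U (G y)" for a y
    using G_0[of y] that by (cases "r \<le> y") auto
  define m where "m = u * y + w * z"
  have m: "0 < m" "m < r"
  proof -
    have w: "w = 1 - u" using uw by simp
    show "0 < m" using * uw convex_bound_lt[of "- y" 0 "- z" u w] by (simp add: m_def)
    show "m < r" using lt[OF *(1,2)] lt[OF *(3,4)] uw unfolding m_def by (intro convex_bound_lt) auto
  qed
  obtain k where k: "\<And>t. 0 \<le> t \<Longrightarrow> t \<le> r \<Longrightarrow> U (G t) \<le> U (G m) + k * (m - t)"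
    using profile_support_line[OF m] by metis
  have 1: "\<bar>a\<bar> < U (G m) + k * (m - y)" "\<bar>b\<bar> < U (G m) + k * (m - z)"
    using k[of y] k[of z] * lt[OF *(1,2)] lt[OF *(3,4)] by auto
  have "u * (\<bar>a\<bar> - k * (m - y)) + w * (\<bar>b\<bar> - k * (m - z)) < U (G m)"
    using 1 uw by (intro convex_bound_lt) auto
  moreover have "u * (m - y) + w * (m - z) = 0"
  proof -
    have "u * (m - y) + w * (m - z) = (u + w) * m - m" by (simp add: m_def algebra_simps)
    then show ?thesis using uw by simp
  qed
  then have "k * (u * (m - y) + w * (m - z)) = 0" by simp
  ultimately have "u * \<bar>a\<bar> + w * \<bar>b\<bar> < U (G m)" by (simp add: algebra_simps)
  moreover have "\<bar>u * a + w * b\<bar> \<le> u * \<bar>a\<bar> + w * \<bar>b\<bar>"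
    using uw abs_triangle_ineq[of "u * a" "w * b"] by (simp add: abs_mult)
  ultimately show "u *\<^sub>R p + w *\<^sub>R q \<in> {(\<xi>, y). 0 < y \<and> \<bar>\<xi>\<bar> < U (G y)}"
    using m by (simp add: a b m_def)
qed

text \<open>On a compact subset the angle stays above that of the largest height, so the derivative
  of \<open>height\<close> is bounded away from 0 and its inverse \<open>angle\<close> is Lipschitz;
  composing with the sine keeps this.\<close>

lemma G_lip_loc: "G \<in> lip_loc {0<..<r}"
  unfolding lip_loc_def
proof (intro CollectI allI impI)
  fix X :: "real set" assume X: "compact X \<and> X \<subseteq> {0<..<r}"
  show "\<exists>L. L-lipschitz_on X G"
  proof (cases "X = {}")
    case False
    then obtain b where b: "b \<in> X" "\<And>y. y \<in> X \<Longrightarrow> y \<le> b" using compact_attains_sup[of X] X by auto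
    have br: "0 < b" "b < r" using b X by auto
    \<comment> \<open>Since \<open>pi / 3\<close> is \<open>pi - tau\<close>, the sine is at least
      \<open>sin \<beta>\<close> on all of \<open>[\<beta>, tau]\<close>, also past
      \<open>pi / 2\<close>.\<close>
    define \<beta> where "\<beta> = min (angle b) (pi / 3)"
    have "angle b \<noteq> 0" using height_angle[of b] br height_0 by auto
    with angle_bounds[of b] br have \<beta>: "0 < \<beta>" "\<beta> \<le> pi / 3" "\<beta> \<le> angle b" by (auto simp: \<beta>_def)
    define s where "s = sin \<beta>"
    have s: "0 < s" unfolding s_def using \<beta> pi_gt_zero by (intro sin_gt_zero) linarith+
    define c where "c = l * W l * (s * W s)"
    have c: "0 < c" using lW_pos s W_pos[of s] by (simp add: c_def)
    have ang: "\<beta> \<le> angle y" "angle y \<le> tau" if "y \<in> X" for y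
    proof -
      have y: "0 \<le> y" "y \<le> r" "y \<le> b" using that X b by auto
      have "angle b \<le> angle y"
        using height_strict_antimono[of "angle y" "angle b"] angle_bounds[of y] angle_bounds[of b] height_angle[of y] height_angle[of b] y br tau_bounds
        by (cases "angle b \<le> angle y") auto
      then show "\<beta> \<le> angle y" "angle y \<le> tau" using \<beta>(3) angle_bounds[of y] y by auto
    qed
    have main: "c * \<bar>t - t'\<bar> \<le> \<bar>height t - height t'\<bar> \<and> \<bar>sin t - sin t'\<bar> \<le> \<bar>t - t'\<bar>"
      if tt: "\<beta> \<le> t" "t < t'" "t' \<le> tau" for t t'
    proof -
      obtain z where z: "t < z" "z < t'" "height t' - height t = (t' - t) * - (l * W l * (sin z * W (sin z)))"
        using MVT2[OF tt(2) DERIV_height] by blast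
      have "s \<le> sin z"
        unfolding s_def using sin_ge_iff[of \<beta> z] z tt \<beta> pi_gt_zero by (auto simp: field_simps)
      then have "s * W s \<le> sin z * W (sin z)" using s W_mono[of s "sin z"] by (intro mult_mono) auto
      then have "(t' - t) * c \<le> (t' - t) * (l * W l * (sin z * W (sin z)))"
        unfolding c_def using tt lW_pos by (intro mult_left_mono) auto
      moreover have "height t - height t' = (t' - t) * (l * W l * (sin z * W (sin z)))" using z(3) by simp
      moreover have "\<bar>t - t'\<bar> = t' - t" using tt by simp
      ultimately have 1: "c * \<bar>t - t'\<bar> \<le> \<bar>height t - height t'\<bar>"
        by (simp only: mult.commute[of c] abs_ge_self order_trans[OF _ abs_ge_self])
      obtain z' where "sin t' - sin t = (t' - t) * cos z'"
        using MVT2[OF tt(2) DERIV_sin] by blast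
      then have "\<bar>sin t - sin t'\<bar> = \<bar>t - t'\<bar> * \<bar>cos z'\<bar>" by (metis abs_minus_commute abs_mult)
      also have "\<dots> \<le> \<bar>t - t'\<bar> * 1" by (intro mult_left_mono) auto
      finally show ?thesis using 1 by simp
    qed
    have main': "c * \<bar>t - t'\<bar> \<le> \<bar>height t - height t'\<bar> \<and> \<bar>sin t - sin t'\<bar> \<le> \<bar>t - t'\<bar>"
      if "\<beta> \<le> t" "t \<le> tau" "\<beta> \<le> t'" "t' \<le> tau" for t t'
      using main[of t t'] main[of t' t] that by (cases t t' rule: linorder_cases) (auto simp: abs_minus_commute)
    have "(l / c)-lipschitz_on X G"
    proof (rule lipschitz_onI)
      fix y y' assume y: "y \<in> X" "y' \<in> X"
      then have yr: "0 \<le> y" "y \<le> r" "0 \<le> y'" "y' \<le> r" using X by auto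
      have m: "c * \<bar>angle y - angle y'\<bar> \<le> \<bar>y - y'\<bar>" "\<bar>sin (angle y) - sin (angle y')\<bar> \<le> \<bar>angle y - angle y'\<bar>"
        using main'[OF ang(1,2)[OF y(1)] ang(1,2)[OF y(2)]] yr by (auto simp: height_angle)
      have "\<bar>G y - G y'\<bar> = l * \<bar>sin (angle y) - sin (angle y')\<bar>"
        using yr l_pos by (simp add: G_angle abs_mult flip: right_diff_distrib)
      also have "\<dots> \<le> l * \<bar>angle y - angle y'\<bar>" using m(2) l_pos by (intro mult_left_mono) auto
      also have "\<dots> \<le> l * (\<bar>y - y'\<bar> / c)"
        using m(1) c l_pos by (intro mult_left_mono) (auto simp: pos_le_divide_eq mult.commute)
      finally show "dist (G y) (G y') \<le> l / c * dist y y'" by (simp add: dist_real_def)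
    qed (use l_pos c in simp)
    then show ?thesis by blast
  qed (auto intro: lipschitz_on_empty)
qed

lemma E_ae_equal: "ae_equal E {(x, y). \<bar>x\<bar> \<le> G \<bar>y\<bar> \<and> \<bar>y\<bar> \<le> r}"
proof -
  have "{(x, y). \<bar>x\<bar> \<le> G \<bar>y\<bar> \<and> \<bar>y\<bar> \<le> r} = K \<union> K'"
    by (auto simp: K'_def K_def)
  then show ?thesis using E_K_K' by (simp add: ae_equal_def)
qed

lemma E_symmetric: "E \<in> x_schwarz_symmetric" "E \<in> y_symmetric"
proof -
  have "{x. (x, t) \<in> E} = {- G t<..<G t}" for t by (auto simp: E_def)
  then show "E \<in> x_schwarz_symmetric" by (auto simp: x_schwarz_symmetric_def) (auto simp: E_def)
  show "E \<in> y_symmetric" by (auto simp: y_symmetric_def) (auto simp: E_def)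
qed

lemma E_admissible: "E \<in> admissible_y (area l)"
  using parts_E_measurable measure_E_upper emeasure_reflect[OF parts_E_measurable(1)]
  by (simp add: admissible_y_def lower_part_E)

end

text \<open>The area is a positive multiple of the power of \<open>l\<close> with exponent
  \<open>\<alpha> + 2\<close>, so every volume has its scale.\<close>

lemma (in grushin) ex_scale:
  assumes "0 < v"
  obtains l where "0 < l" "v = area l"
proof -
  define z where "z = v / (2 * sin_moment 2 tau)"
  have m: "0 < sin_moment 2 tau" using sin_moment_pos tau_bounds by simp
  then have z: "0 < z" using assms by (simp add: z_def)
  define l where "l = z powr (1 / (\<alpha> + 2))"
  have l: "0 < l" using z by (simp add: l_def)
  have "l\<^sup>2 * W l = l powr (\<alpha> + 2)" using l by (simp add: W_powr powr_add powr_numeral)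
  also have "\<dots> = z" using z alpha_nonneg by (simp add: l_def powr_powr)
  finally have "v = area l" using m by (simp add: z_def mult.assoc)
  with l show ?thesis by (rule that)
qed

theorem theorem5p2:
  fixes \<alpha> v :: real
  assumes "\<alpha> \<ge> 0" and "v > 0"
  shows "\<exists>E. E \<in> admissible_y v \<inter> x_schwarz_symmetric \<inter> y_symmetric
           \<and> bounded E
           \<and> y_transformed_convex \<alpha> E
           \<and> partition_perimeter \<alpha> E = (INF F \<in> admissible_y v. partition_perimeter \<alpha> F)
           \<and> (\<exists>r g. r > 0 \<and> continuous_on {0..r} g \<and> g \<in> lip_loc {0<..<r}
                \<and> ae_equal E {(x, y). \<bar>x\<bar> \<le> g \<bar>y\<bar> \<and> \<bar>y\<bar> \<le> r})"
proof -
  interpret grushin \<alpha> by unfold_locales (fact assms(1))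
  obtain l where l: "0 < l" "v = area l"
    using ex_scale[OF assms(2)] .
  interpret grushin_extremal \<alpha> l by unfold_locales (fact l(1))
  have adm: "E \<in> admissible_y v" using E_admissible l(2) by simp
  have "partition_perimeter \<alpha> E \<le> partition_perimeter \<alpha> F" if "F \<in> admissible_y v" for F
    using partition_E_le partition_lower[OF that assms(2) l] unfolding l(2)[symmetric] by (rule order_trans)
  then have "partition_perimeter \<alpha> E = (INF F \<in> admissible_y v. partition_perimeter \<alpha> F)"
    using adm by (intro antisym INF_greatest INF_lower)
  moreover have "bounded E" using bounded_subset[OF bounded_cbox E_subset] .
  ultimately show ?thesis
    using adm E_symmetric E_transformed_convex r_pos continuous_on_G G_lip_loc E_ae_equal by blast
qed

end
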